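(* Let $r\ge2$ and let $\mathcal{H}$ be a hereditary property of $r$-graphs containing $r$-graphs on $n$ vertices for every $n$. Fix an $r$-dimensional density vector $\mathbf{p}$. Then the limit $\mathrm{dist}(\mathbf{p},\mathcal{H}):=\lim_{n\to\infty}\mathrm{dist}_n(\mathbf{p},\mathcal{H})$ exists. Moreover: (1) $\mathrm{dist}(\mathbf{p},\mathcal{H})=\inf_{K\in\mathcal{K}(\mathcal{H})}f_K(\mathbf{p})=\inf_{K\in\mathcal{K}(\mathcal{H})}g_K(\mathbf{p})$. (2) For a fixed $\epsilon>0$, with probability approaching $1$ as $n\to\infty$, $$\mathrm{dist}(\mathbf{p},\mathcal{H})-\epsilon\le\mathrm{dist}(G(n,\mathbf{p}),\mathcal{H})\le\mathrm{dist}(\mathbf{p},\mathcal{H}).$$ (3) $\mathrm{dist}(\mathbf{p},\mathcal{H})=\lim_{n\to\infty}\mathbf{E}[\mathrm{dist}(G(n,\mathbf{p}),\mathcal{H})]$. (4) As a function of $\mathbf{p}$, $\mathrm{dist}(\mathbf{p},\mathcal{H})$ is continuous over the domain of $r$-dimensional density vectors and is concave down. (5) $\mathrm{dist}(\mathbf{p},\mathcal{H})$ achieves its maximum, which equals $\mathrm{dist}(\mathcal{H})$, at some density vector $\mathbf{p}^*_{\mathcal{H}}$, and so $$\mathrm{dist}(\mathcal{H})=\lim_{n\to\infty}\mathbf{E}[\mathrm{dist}(G(n,\mathbf{p}^*_{\mathcal{H}}),\mathcal{H})].$$ (6) Both $\mathbf{p}^*_{\mathcal{H}}$ and $\mathrm{dist}(\mathcal{H})$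 exist, and, writing $\mathbf{p}^*_{\mathcal{H}}$ also for the set of all density vectors at which the maximum is attained, this set is convex and closed in $[0,1]^{r-1}$ (density vectors being identified with their first $r-1$ coordinates).
   Context: An $r$-graph is a pair $G=(V,c)$ with $V$ finite and $c:\binom V2\to\{1,\ldots,r\}$; $E_\rho(G)$ is the set of edges of color $\rho$. A hereditary property of $r$-graphs is a set of $r$-graphs closed under vertex-deletion and isomorphism. $\mathrm{Forb}(H)$ is the set of $r$-graphs with no induced copy of $H$ (a copy obtained by vertex deletion), and $\mathcal{F}(\mathcal{H})$ is a family of $r$-graphs with $\mathcal{H}=\bigcap_{H\in\mathcal{F}(\mathcal{H})}\mathrm{Forb}(H)$. Distance. For $r$-graphs $G,G'$ on the same $n$ labeled vertices, $\mathrm{dist}(G,G')$ is the number of edges whose colors differ, divided by $\binom n2$; $\mathrm{dist}(G,\mathcal{H})=\min\{\mathrm{dist}(G,G'):V(G')=V(G),G'\in\mathcal{H}\}$; $\mathrm{dist}(n,\mathcal{H})=\max\{\mathrm{dist}(G,\mathcal{H}):|V(G)|=n\}$; $\mathrm{dist}(\mathcal{H})=\lim_{n\to\infty}\mathrm{dist}(n,\mathcal{H})$. A density vector is $\mathbf{p}=(p_1,\ldots,p_r)$ with $p_\rho\ge0$ and $\sum_\rho p_\rho=1$. Define $$\mathrm{dist}_n(\mathbf{p},\mathcal{H})=\max\{\mathrm{dist}(G,\mathcal{H}):|V(G)|=n,\ |E_\rho(G)|=p_\rho\tbinom n2,\ \rho=1,\ldots,r\},$$ where, for integrality, $|E_\rho(G)|$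 is taken to be $\lfloor p_\rho\binom n2\rfloor$ for $\rho<r$ and $|E_r(G)|$ is what remains. $G(n,\mathbf{p})$ is the random $r$-graph on $n$ labeled vertices in which each edge independently receives color $\rho$ with probability $p_\rho$. Types. An $r$-type is a pair $K=(U,\phi)$ with $U$ a finite vertex set and $\phi:U\times U\to2^{\{1,\ldots,r\}}\setminus\{\emptyset\}$ such that $\phi(x,y)=\phi(y,x)$ and $\phi(x,x)\ne\{1,\ldots,r\}$ for all $x,y\in U$. An $r$-graph $H=(V,c)$ embeds in $K$, written $H\mapsto K$, if there is a map $\gamma:V\to U$ with $c(\{v,v'\})\in\phi(\gamma(v),\gamma(v'))$ for all distinct $v,v'\in V$. $\mathcal{K}(\mathcal{H})$ is the set of all $r$-types $K$ such that no $H\in\mathcal{F}(\mathcal{H})$ embeds in $K$. For an $r$-type $K$ with vertices $u_1,\ldots,u_k$, let $\mathbf{M}_K(\mathbf{p})$ be the $k\times k$ matrix with $(i,j)$ entry $1-\sum_{\rho\in\phi(u_i,u_j)}p_\rho$. With $\mathbf 1$ the all-ones vector, $$f_K(\mathbf{p})=\left(\tfrac1k\mathbf 1\right)^T\mathbf{M}_K(\mathbf{p})\left(\tfrac1k\mathbf 1\right),\qquad g_K(\mathbf{p})=\min\{\mathbf{w}^T\mathbf{M}_K(\mathbf{p})\mathbf{w}:\mathbf{w}^T\mathbf 1=1,\ \mathbf{w}\ge\mathbf 0\}.$$ A function $\psi$ on density vectors is concave down if $\psi(t\mathbf{p}_1+(1-t)\mathbf{p}_2)\ge t\psi(\mathbf{p}_1)+(1-t)\psi(\mathbf{p}_2)$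 for all density vectors $\mathbf{p}_1,\mathbf{p}_2$ and $t\in[0,1]$.
   Formalization: In (2) the upper bound is proved as dist(G(n,p),H) ≤ dist(p,H)+ε; without ε it fails, e.g. r=2, H = graphs with all edges of colour 2, p=(1/2,1/2), where it holds only with probability tending to 1/2. *)

theory Defs
  imports "HOL-Analysis.Analysis" "HOL-Probability.Probability" "HOL-Library.Ramsey"
begin

section \<open>r-graphs and hereditary properties\<close>

text \<open>An edge is a member of \<^term>\<open>nsets V 2\<close>, i.e. a two-element subset of \<^term>\<open>V\<close>.
  Colourings are extensional, so equality of pairs \<^term>\<open>(V, c)\<close> is equality of r-graphs.
  The empty vertex set is allowed.\<close>

type_synonym 'v rgraph = "'v set \<times> ('v set \<Rightarrow> nat)"

definition rgraphs :: "nat \<Rightarrow> 'v rgraph set" where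
  "rgraphs r = {(V, c). finite V \<and> c \<in> nsets V 2 \<rightarrow>\<^sub>E {1..r}}"

definition verts :: "'v rgraph \<Rightarrow> 'v set" where
  "verts G = fst G"

definition colour :: "'v rgraph \<Rightarrow> 'v set \<Rightarrow> nat" where
  "colour G = snd G"

definition edges_of_colour :: "'v rgraph \<Rightarrow> nat \<Rightarrow> 'v set set" where
  "edges_of_colour G \<rho> = {e \<in> nsets (verts G) 2. colour G e = \<rho>}"

definition delete_verts :: "'v rgraph \<Rightarrow> 'v set \<Rightarrow> 'v rgraph" where
  "delete_verts G W = (verts G - W, restrict (colour G) (nsets (verts G - W) 2))"

definition rgraph_iso :: "'v rgraph \<Rightarrow> 'w rgraph \<Rightarrow> bool" where
  "rgraph_iso G H \<longleftrightarrow>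
     (\<exists>f. bij_betw f (verts G) (verts H) \<and>
          (\<forall>e \<in> nsets (verts G) 2. colour H (f ` e) = colour G e))"

definition hereditary :: "nat \<Rightarrow> 'v rgraph set \<Rightarrow> bool" where
  "hereditary r \<H> \<longleftrightarrow>
     \<H> \<subseteq> rgraphs r \<and>
     (\<forall>G \<in> \<H>. \<forall>W. delete_verts G W \<in> \<H>) \<and>
     (\<forall>G \<in> \<H>. \<forall>G' \<in> rgraphs r. rgraph_iso G G' \<longrightarrow> G' \<in> \<H>)"

definition Forb :: "nat \<Rightarrow> 'v rgraph \<Rightarrow> 'v rgraph set" where
  "Forb r H = {G \<in> rgraphs r. \<not> (\<exists>W. rgraph_iso (delete_verts G W) H)}"

text \<open>The intersection with \<^term>\<open>rgraphs r\<close> only matters for the empty family, where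
  the intersection over the family is taken within the set of all r-graphs.\<close>

definition forbidden_family :: "nat \<Rightarrow> 'v rgraph set \<Rightarrow> 'v rgraph set \<Rightarrow> bool" where
  "forbidden_family r \<H> \<F> \<longleftrightarrow>
     \<F> \<subseteq> rgraphs r \<and> \<H> = rgraphs r \<inter> (\<Inter>H \<in> \<F>. Forb r H)"


section \<open>Edit distance\<close>

definition edit_dist :: "'v rgraph \<Rightarrow> 'v rgraph \<Rightarrow> real" where
  "edit_dist G G' =
     real (card {e \<in> nsets (verts G) 2. colour G e \<noteq> colour G' e}) / real (card (verts G) choose 2)"

definition edit_dist_to :: "'v rgraph \<Rightarrow> 'v rgraph set \<Rightarrow> real" where
  "edit_dist_to G \<H> = Min {edit_dist G G' | G'. verts G' = verts G \<and> G' \<in> \<H>}"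

definition max_edit_dist :: "nat \<Rightarrow> nat \<Rightarrow> 'v rgraph set \<Rightarrow> real" where
  "max_edit_dist r n \<H> = Max {edit_dist_to G \<H> | G. G \<in> rgraphs r \<and> card (verts G) = n}"

definition lim_edit_dist :: "nat \<Rightarrow> 'v rgraph set \<Rightarrow> real" where
  "lim_edit_dist r \<H> = lim (\<lambda>n. max_edit_dist r n \<H>)"


section \<open>Density vectors\<close>

definition density_vectors :: "nat \<Rightarrow> (nat \<Rightarrow> real) set" where
  "density_vectors r = {p \<in> {1..r} \<rightarrow>\<^sub>E {0..}. (\<Sum>\<rho> = 1..r. p \<rho>) = 1}"

text \<open>The number of edges of the last colour \<^term>\<open>r\<close> is determined by the other ones.\<close>

definition max_edit_dist_dens :: "nat \<Rightarrow> nat \<Rightarrow> (nat \<Rightarrow> real) \<Rightarrow> 'v rgraph set \<Rightarrow> real" where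
  "max_edit_dist_dens r n p \<H> =
     Max {edit_dist_to G \<H> | G. G \<in> rgraphs r \<and> card (verts G) = n \<and>
            (\<forall>\<rho> \<in> {1..<r}. int (card (edges_of_colour G \<rho>)) = \<lfloor>p \<rho> * real (n choose 2)\<rfloor>)}"

definition edit_dist_dens :: "nat \<Rightarrow> (nat \<Rightarrow> real) \<Rightarrow> 'v rgraph set \<Rightarrow> real" where
  "edit_dist_dens r p \<H> = lim (\<lambda>n. max_edit_dist_dens r n p \<H>)"

definition colour_pmf :: "nat \<Rightarrow> (nat \<Rightarrow> real) \<Rightarrow> nat pmf" where
  "colour_pmf r p = embed_pmf (\<lambda>\<rho>. if \<rho> \<in> {1..r} then p \<rho> else 0)"

text \<open>Non-edges get the value \<^term>\<open>undefined\<close>, which makes the random colouring extensional.\<close>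

definition random_rgraph :: "nat \<Rightarrow> nat \<Rightarrow> (nat \<Rightarrow> real) \<Rightarrow> nat rgraph pmf" where
  "random_rgraph r n p =
     map_pmf (\<lambda>c. ({..<n}, c)) (Pi_pmf (nsets {..<n} 2) undefined (\<lambda>_. colour_pmf r p))"

definition concave_down :: "nat \<Rightarrow> ((nat \<Rightarrow> real) \<Rightarrow> real) \<Rightarrow> bool" where
  "concave_down r \<psi> \<longleftrightarrow>
     (\<forall>p \<in> density_vectors r. \<forall>q \<in> density_vectors r. \<forall>t \<in> {0..1}.
        \<psi> (\<lambda>\<rho>\<in>{1..r}. t * p \<rho> + (1 - t) * q \<rho>) \<ge> t * \<psi> p + (1 - t) * \<psi> q)"

definition continuous_on_densities :: "nat \<Rightarrow> ((nat \<Rightarrow> real) \<Rightarrow> real) \<Rightarrow> bool" where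
  "continuous_on_densities r \<psi> \<longleftrightarrow>
     continuous_map (subtopology (powertop_real {1..r}) (density_vectors r)) euclideanreal \<psi>"

definition max_densities :: "nat \<Rightarrow> 'v rgraph set \<Rightarrow> (nat \<Rightarrow> real) set" where
  "max_densities r \<H> =
     {p \<in> density_vectors r. \<forall>q \<in> density_vectors r. edit_dist_dens r q \<H> \<le> edit_dist_dens r p \<H>}"

definition first_coords :: "nat \<Rightarrow> (nat \<Rightarrow> real) \<Rightarrow> nat \<Rightarrow> real" where
  "first_coords r p = restrict p {1..r - 1}"

text \<open>Functions are not an instance of \<^class>\<open>real_vector\<close>, so the library notion of a
  convex set does not apply to sets of coordinate functions.\<close>

definition convex_coords :: "nat \<Rightarrow> (nat \<Rightarrow> real) set \<Rightarrow> bool" where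
  "convex_coords m S \<longleftrightarrow>
     (\<forall>x \<in> S. \<forall>y \<in> S. \<forall>t \<in> {0..1}. (\<lambda>i\<in>{1..m}. t * x i + (1 - t) * y i) \<in> S)"


section \<open>Types\<close>

text \<open>The vertex set of a type is required to be nonempty, since the uniform weighting
  below divides by its size.\<close>

type_synonym 'u rtype = "'u set \<times> ('u \<times> 'u \<Rightarrow> nat set)"

definition rtypes :: "nat \<Rightarrow> 'u rtype set" where
  "rtypes r = {(U, \<phi>). finite U \<and> U \<noteq> {} \<and>
     \<phi> \<in> U \<times> U \<rightarrow>\<^sub>E Pow {1..r} - {{}} \<and>
     (\<forall>x \<in> U. \<forall>y \<in> U. \<phi> (x, y) = \<phi> (y, x)) \<and>
     (\<forall>x \<in> U. \<phi> (x, x) \<noteq> {1..r})}"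

definition embeds :: "'v rgraph \<Rightarrow> 'u rtype \<Rightarrow> bool" where
  "embeds H K \<longleftrightarrow>
     (\<exists>\<gamma> \<in> verts H \<rightarrow> fst K. \<forall>v \<in> verts H. \<forall>v' \<in> verts H.
        v \<noteq> v' \<longrightarrow> colour H {v, v'} \<in> snd K (\<gamma> v, \<gamma> v'))"

text \<open>The types allowed by a property, in terms of a family of forbidden r-graphs.\<close>

definition allowed_types :: "nat \<Rightarrow> 'v rgraph set \<Rightarrow> 'u rtype set" where
  "allowed_types r \<F> = {K \<in> rtypes r. \<forall>H \<in> \<F>. \<not> embeds H K}"

definition type_matrix :: "'u rtype \<Rightarrow> (nat \<Rightarrow> real) \<Rightarrow> 'u \<Rightarrow> 'u \<Rightarrow> real" where
  "type_matrix K p x y = 1 - (\<Sum>\<rho> \<in> snd K (x, y). p \<rho>)"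

definition quad_form :: "'u rtype \<Rightarrow> (nat \<Rightarrow> real) \<Rightarrow> ('u \<Rightarrow> real) \<Rightarrow> real" where
  "quad_form K p w = (\<Sum>x \<in> fst K. \<Sum>y \<in> fst K. w x * type_matrix K p x y * w y)"

definition f_type :: "'u rtype \<Rightarrow> (nat \<Rightarrow> real) \<Rightarrow> real" where
  "f_type K p = quad_form K p (\<lambda>_. 1 / real (card (fst K)))"

text \<open>The infimum is a minimum, being that of a continuous function on a simplex.\<close>

definition g_type :: "'u rtype \<Rightarrow> (nat \<Rightarrow> real) \<Rightarrow> real" where
  "g_type K p =
     Inf {quad_form K p w | w. (\<Sum>x \<in> fst K. w x) = 1 \<and> (\<forall>x \<in> fst K. w x \<ge> 0)}"

end

theory Submission
  imports Defs
begin

text \<open>Upper bound: mapping the vertices of an r-graph at random to the vertices of an allowed type and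
  recolouring the edges that do not fit costs, on average, the value of the quadratic form at the edge
  densities of the graph. Hence the distance is at most the infimum of the quadratic forms, which is
  concave and Lipschitz in the density vector as an infimum of linear functions.

  Lower bound: let G be quasirandom (as a random r-graph is, by Hoeffding's inequality and a union bound over
  pairs of vertex sets) and G' a member of the property. The weak regularity lemma of Frieze and Kannan yields
  a partition for G'; to a pair of cells belongs the set of colours of non-negligible density. Quasirandomness
  of G shows that the average weight of the missing colours is at most about the distance of G and G'. A
  random k-tuple of vertices therefore shows a pattern of such colour sets that is about as cheap, with a
  probability bounded from below; by Jensen's inequality this persists for a blow-up in which every vertex of
  the tuple is replaced by M independent copies, while by the counting lemma the probability that the
  blow-up admits a choice of colours leaving the property is much smaller. Ramsey's theorem inside the M
  copies of a vertex selects its loop colour. The resulting type on k vertices excludes all forbidden r-graphs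
  of bounded size, hence all of them, because there are only finitely many types on k vertices. In this way
  the strong regularity lemma is avoided.\<close>

text \<open>Weak regularity suffices because the vertices of the type are sampled from the whole
  vertex set and not from chosen cells. The number of patterns on \<open>k\<close> vertices depends
  only on \<open>k\<close> and \<open>r\<close>, so some cheap pattern has probability at least a
  constant \<open>\<alpha>\<close> that knows nothing of the number of cells. The error
  \<open>\<eta>\<close> of the partition can then be chosen after \<open>\<alpha>\<close> and the
  size of the blow-up; it never has to beat the size of a single cell. The order of choice is
  \<open>k\<close>, \<open>m\<close>, \<open>M\<close>, \<open>\<tau>\<close>,
  \<open>\<alpha>\<close>, \<open>\<eta>\<close>, the number of cells, \<open>\<delta>\<close>. The
  obstacle is the diagonal of the type: a loop colour must be usable among many vertices mapped to
  one vertex of the type, and a single sampled vertex says nothing about that. Hence the blow-up and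
  Ramsey's theorem. One colour per loop is enough, since the diagonal contributes at most
  \<open>1 / k\<close>. The upper bound holds for all weightings, while the lower bound produces a
  type that is cheap for the uniform one. As \<open>g_type\<close> is at most \<open>f_type\<close>,
  the two bounds together also identify the two infima.\<close>

section \<open>Means over tuples\<close>

text \<open>Stated for commutative monoids because \<open>mean_blowup\<close> splits off a
  coordinate both in a sum over tuples and in a product over choice functions.\<close>

lemma (in comm_monoid_set) PiE_insert:
  assumes "i \<notin> I"
  shows "F g (PiE (insert i I) (\<lambda>_. V)) = F (\<lambda>z. F (\<lambda>a. g (z(i := a))) V) (PiE I (\<lambda>_. V))"
proof -
  have "F g (PiE (insert i I) (\<lambda>_. V)) = F (g \<circ> (\<lambda>(y, z). z(i := y))) (V \<times> PiE I (\<lambda>_. V))"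
    unfolding PiE_insert_eq by (rule reindex) (rule inj_combinator[OF assms])
  also have "\<dots> = F (\<lambda>(y, z). g (z(i := y))) (V \<times> PiE I (\<lambda>_. V))"
    by (rule cong) auto
  also have "\<dots> = F (\<lambda>y. F (\<lambda>z. g (z(i := y))) (PiE I (\<lambda>_. V))) V"
    by (simp add: cartesian_product)
  also have "\<dots> = F (\<lambda>z. F (\<lambda>a. g (z(i := a))) V) (PiE I (\<lambda>_. V))"
    by (rule swap)
  finally show ?thesis .
qed

text \<open>Division by zero gives an empty or infinite set the mean 0, so exchanging means and
  splitting off a coordinate need no case distinction.\<close>

definition mean :: "'a set \<Rightarrow> ('a \<Rightarrow> real) \<Rightarrow> real" where
  "mean A f = (\<Sum>x\<in>A. f x) / real (card A)"

lemma mean_mono: "(\<And>x. x \<in> A \<Longrightarrow> f x \<le> g x) \<Longrightarrow> mean A f \<le> mean A g"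
  unfolding mean_def by (intro divide_right_mono sum_mono) auto

lemma mean_nonneg: "(\<And>x. x \<in> A \<Longrightarrow> 0 \<le> f x) \<Longrightarrow> 0 \<le> mean A f"
  unfolding mean_def by (simp add: sum_nonneg)

lemma mean_swap: "mean A (\<lambda>x. mean B (\<lambda>y. f x y)) = mean B (\<lambda>y. mean A (\<lambda>x. f x y))"
  unfolding mean_def sum_divide_distrib[symmetric] by (subst sum.swap) (simp add: mult.commute)

lemma mean_PiE_insert:
  assumes "i \<notin> I" "finite I"
  shows "mean (PiE (insert i I) (\<lambda>_. V)) f = mean (PiE I (\<lambda>_. V)) (\<lambda>z. mean V (\<lambda>a. f (z(i := a))))"
  using assms unfolding mean_def
  by (simp add: sum.PiE_insert card_PiE sum_divide_distrib[symmetric])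

lemma mean_power_PiE:
  assumes "finite I" "finite V"
  shows "mean V h ^ card I = mean (PiE I (\<lambda>_. V)) (\<lambda>Y. \<Prod>a\<in>I. h (Y a))"
proof -
  have "(\<Sum>x\<in>V. h x) ^ card I = (\<Prod>a\<in>I. \<Sum>x\<in>V. h x)" by simp
  also have "\<dots> = (\<Sum>Y\<in>PiE I (\<lambda>_. V). \<Prod>a\<in>I. h (Y a))"
    by (rule prod_sum_PiE) (use assms in auto)
  finally show ?thesis using assms by (simp add: mean_def power_divide card_PiE)
qed

lemma convex_on_nonneg_power: "convex_on {0..} (\<lambda>x::real. x ^ q)"
proof (cases "even q")
  case True
  then show ?thesis using convex_power_even convex_on_subset by blast
next
  case False
  then show ?thesis using convex_power_odd by blast
qed

lemma power_mean_le_mean_power: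
  assumes "finite V" "V \<noteq> {}" "\<And>x. x \<in> V \<Longrightarrow> 0 \<le> h x"
  shows "mean V h ^ q \<le> mean V (\<lambda>x. h x ^ q)"
proof -
  have "(\<Sum>x\<in>V. (1 / real (card V)) *\<^sub>R h x) ^ q \<le> (\<Sum>x\<in>V. (1 / real (card V)) * h x ^ q)"
    using assms by (intro convex_on_sum[OF _ _ convex_on_nonneg_power]) auto
  then show ?thesis by (simp add: mean_def sum_divide_distrib)
qed

text \<open>Jensen's inequality is applied one coordinate at a time.\<close>

lemma mean_blowup:
  assumes V: "finite V" "V \<noteq> {}"
  shows "(\<And>x. 0 \<le> f x) \<Longrightarrow>
    mean (PiE {..<k} (\<lambda>_. V)) f ^ (M ^ k)
      \<le> mean (PiE {..<k} (\<lambda>_. PiE {..<M} (\<lambda>_. V)))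
            (\<lambda>X. \<Prod>s\<in>PiE {..<k} (\<lambda>_. {..<M}). f (\<lambda>i\<in>{..<k}. X i (s i)))"
proof (induction k arbitrary: f)
  case 0
  show ?case by (simp add: mean_def)
next
  case (Suc k)
  define W where "W = PiE {..<M} (\<lambda>_. V)"
  have W: "finite W" "W \<noteq> {}" using V by (auto simp: W_def PiE_eq_empty_iff intro!: finite_PiE)
  have fin: "finite (PiE {..<k} (\<lambda>_. V))" "PiE {..<k} (\<lambda>_. V) \<noteq> {}"
    using V by (auto simp: PiE_eq_empty_iff intro!: finite_PiE)
  have S: "{..<Suc k} = insert k {..<k}" by auto
  \<comment> \<open>\<open>fY Y\<close> tests one tuple of the first \<open>k\<close> coordinates
    together with all \<open>M\<close> copies \<open>Y\<close> of the last coordinate.\<close>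
  define fY where "fY Y z = (\<Prod>a<M. f (z(k := Y a)))" for Y z
  have fY0: "0 \<le> fY Y z" for Y z
    unfolding fY_def by (intro prod_nonneg) (auto simp: Suc.prems)
  let ?A = "PiE {..<k} (\<lambda>_. V)"
  have "mean (PiE {..<Suc k} (\<lambda>_. V)) f ^ M = mean ?A (\<lambda>z. mean V (\<lambda>a. f (z(k := a)))) ^ M"
    unfolding S by (subst mean_PiE_insert) auto
  also have "\<dots> \<le> mean ?A (\<lambda>z. mean V (\<lambda>a. f (z(k := a))) ^ M)"
    by (rule power_mean_le_mean_power[OF fin]) (auto intro!: mean_nonneg Suc.prems)
  also have "\<dots> = mean ?A (\<lambda>z. mean W (\<lambda>Y. fY Y z))"
    unfolding fY_def W_def using mean_power_PiE[of "{..<M}" V] V by simp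
  also have "\<dots> = mean W (\<lambda>Y. mean ?A (fY Y))"
    by (rule mean_swap)
  finally have 1: "mean (PiE {..<Suc k} (\<lambda>_. V)) f ^ M \<le> mean W (\<lambda>Y. mean ?A (fY Y))" .
  \<comment> \<open>The exponent is \<open>M * M ^ k\<close>. The factor \<open>M\<close> has
    produced the copies of the last coordinate; the power \<open>M ^ k\<close> passes under the mean
    over \<open>Y\<close> by a second use of Jensen and is then consumed by the induction hypothesis
    for \<open>fY Y\<close>.\<close>
  have "mean (PiE {..<Suc k} (\<lambda>_. V)) f ^ (M ^ Suc k) = (mean (PiE {..<Suc k} (\<lambda>_. V)) f ^ M) ^ (M ^ k)"
    by (simp add: power_mult)
  also have "\<dots> \<le> mean W (\<lambda>Y. mean ?A (fY Y)) ^ (M ^ k)"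
    by (intro power_mono 1 zero_le_power mean_nonneg Suc.prems)
  also have "\<dots> \<le> mean W (\<lambda>Y. mean ?A (fY Y) ^ (M ^ k))"
    by (rule power_mean_le_mean_power[OF W]) (auto intro!: mean_nonneg fY0)
  also have "\<dots> \<le> mean W (\<lambda>Y. mean (PiE {..<k} (\<lambda>_. W))
      (\<lambda>X. \<Prod>s\<in>PiE {..<k} (\<lambda>_. {..<M}). fY Y (\<lambda>i\<in>{..<k}. X i (s i))))"
    unfolding W_def by (intro mean_mono Suc.IH fY0)
  also have "\<dots> = mean (PiE {..<k} (\<lambda>_. W)) (\<lambda>X. mean W (\<lambda>Y.
      \<Prod>s\<in>PiE {..<k} (\<lambda>_. {..<M}). fY Y (\<lambda>i\<in>{..<k}. X i (s i))))"
    by (rule mean_swap)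
  also have "\<dots> = mean (PiE {..<Suc k} (\<lambda>_. W))
      (\<lambda>X. \<Prod>s\<in>PiE {..<Suc k} (\<lambda>_. {..<M}). f (\<lambda>i\<in>{..<Suc k}. X i (s i)))"
  proof -
    have eq: "(\<lambda>i\<in>{..<k}. X i (s i))(k := Y a)
       = (\<lambda>i\<in>insert k {..<k}. (X(k := Y)) i ((s(k := a)) i))" for X Y s a
      by (auto simp: restrict_def fun_eq_iff)
    show ?thesis
      unfolding S fY_def eq
      by (subst mean_PiE_insert, simp, simp, subst prod.PiE_insert, simp, rule refl)
  qed
  finally show ?case unfolding W_def .
qed

section \<open>Weak regularity and counting\<close>

text \<open>If no element of \<^term>\<open>Z\<close> has the label of \<^term>\<open>z\<close>, the value is \<^term>\<open>0::real\<close>,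
  so that the bounds below hold for all \<^term>\<open>z\<close>.\<close>

definition cond_mean :: "'a set \<Rightarrow> ('a \<Rightarrow> 'b) \<Rightarrow> ('a \<Rightarrow> real) \<Rightarrow> 'a \<Rightarrow> real" where
  "cond_mean Z Q f z = (\<Sum>z'\<in>{z'\<in>Z. Q z' = Q z}. f z') / real (card {z'\<in>Z. Q z' = Q z})"

lemma cond_mean_label: "Q z = Q z' \<Longrightarrow> cond_mean Z Q f z = cond_mean Z Q f z'"
  by (simp add: cond_mean_def)

lemma cond_mean_bounds:
  assumes "finite Z" "\<And>z. z \<in> Z \<Longrightarrow> 0 \<le> f z" "\<And>z. z \<in> Z \<Longrightarrow> f z \<le> 1"
  shows "0 \<le> cond_mean Z Q f z" "cond_mean Z Q f z \<le> 1"
proof -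
  show "0 \<le> cond_mean Z Q f z" unfolding cond_mean_def using assms by (auto intro!: divide_nonneg_nonneg sum_nonneg)
  have "(\<Sum>z'\<in>{z'\<in>Z. Q z' = Q z}. f z') \<le> (\<Sum>z'\<in>{z'\<in>Z. Q z' = Q z}. 1)"
    using assms by (intro sum_mono) auto
  then show "cond_mean Z Q f z \<le> 1" unfolding cond_mean_def by (auto simp: divide_le_eq_1)
qed

text \<open>The defining property of conditional expectation: \<open>g\<close> is constant on every
  label class, and replacing \<open>f\<close> by its average does not change the sum over a
  class.\<close>

lemma sum_cond_mean:
  assumes Z: "finite Z" and g: "\<And>z z'. z \<in> Z \<Longrightarrow> z' \<in> Z \<Longrightarrow> Q z = Q z' \<Longrightarrow> g z = g z'"
  shows "(\<Sum>z\<in>Z. cond_mean Z Q f z * g z) = (\<Sum>z\<in>Z. f z * g z)"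
proof -
  have L: "(\<Sum>z\<in>Z. h z) = (\<Sum>q\<in>Q ` Z. \<Sum>z\<in>{z\<in>Z. Q z = q}. h z)" for h :: "'a \<Rightarrow> real"
    using sum.group[of Z "Q ` Z" Q h] Z by simp
  have "(\<Sum>z\<in>{z\<in>Z. Q z = q}. cond_mean Z Q f z * g z) = (\<Sum>z\<in>{z\<in>Z. Q z = q}. f z * g z)"
    if "q \<in> Q ` Z" for q
  proof -
    obtain z0 where z0: "z0 \<in> Z" "Q z0 = q" using \<open>q \<in> Q ` Z\<close> by auto
    let ?C = "{z\<in>Z. Q z = q}"
    have c: "card ?C > 0" using Z z0 by (auto simp: card_gt_0_iff)
    have g0: "g z = g z0" if "z \<in> ?C" for z using g[of z z0] that z0 by auto
    have "(\<Sum>z\<in>?C. cond_mean Z Q f z * g z) = (\<Sum>z\<in>?C. (\<Sum>z'\<in>?C. f z') / real (card ?C) * g z0)"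
      by (rule sum.cong) (auto simp: cond_mean_def g0)
    also have "\<dots> = (\<Sum>z'\<in>?C. f z') * g z0" using c by simp
    also have "\<dots> = (\<Sum>z\<in>?C. f z * g z)" unfolding sum_distrib_right by (rule sum.cong) (auto simp: g0)
    finally show ?thesis .
  qed
  then show ?thesis unfolding L[of "\<lambda>z. cond_mean Z Q f z * g z"] L[of "\<lambda>z. f z * g z"]
    by (rule sum.cong[OF refl])
qed

text \<open>A bound on the cut norm of Frieze and Kannan without normalisation. The sets
  \<open>A\<close> and \<open>B\<close> may overlap.\<close>

definition cut_bounded :: "'v set \<Rightarrow> real \<Rightarrow> ('v \<times> 'v \<Rightarrow> real) \<Rightarrow> bool" where
  "cut_bounded V t W \<longleftrightarrow> (\<forall>A B. A \<subseteq> V \<longrightarrow> B \<subseteq> V \<longrightarrow> \<bar>\<Sum>z\<in>A \<times> B. W z\<bar> \<le> t)"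

text \<open>The product partition: conditional means with respect to these labels are the densities
  between pairs of cells.\<close>

definition pair_label :: "('v \<Rightarrow> 'b) \<Rightarrow> 'v \<times> 'v \<Rightarrow> 'b \<times> 'b" where
  "pair_label P z = (P (fst z), P (snd z))"

text \<open>\<open>D\<close> is constant on the cells of the finer partition as well, so
  \<open>D'\<close> and \<open>D\<close> both have the same inner product with \<open>D\<close> as
  \<open>a\<close> has. Hence \<open>D' - D\<close> is orthogonal to \<open>D\<close>.\<close>

lemma cond_mean_pythagoras:
  fixes a :: "'v \<times> 'v \<Rightarrow> real"
  assumes V: "finite V" and P': "\<And>x y. x \<in> V \<Longrightarrow> y \<in> V \<Longrightarrow> P' x = P' y \<Longrightarrow> P x = P y"
  defines "D \<equiv> cond_mean (V \<times> V) (pair_label P) a" and "D' \<equiv> cond_mean (V \<times> V) (pair_label P') a"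
  shows "(\<Sum>z\<in>V \<times> V. (D' z)\<^sup>2) = (\<Sum>z\<in>V \<times> V. (D z)\<^sup>2) + (\<Sum>z\<in>V \<times> V. (D' z - D z)\<^sup>2)"
proof -
  define Z where "Z = V \<times> V"
  have Z: "finite Z" using V by (simp add: Z_def)
  have const: "D z = D z'" if "z \<in> Z" "z' \<in> Z" "pair_label P' z = pair_label P' z'" for z z'
    unfolding D_def by (rule cond_mean_label) (use that P'[of "fst z" "fst z'"] P'[of "snd z" "snd z'"] in
      \<open>auto simp: Z_def pair_label_def\<close>)
  have 1: "(\<Sum>z\<in>Z. D' z * D z) = (\<Sum>z\<in>Z. a z * D z)"
    unfolding D'_def Z_def[symmetric] by (rule sum_cond_mean[OF Z const])
  have 2: "(\<Sum>z\<in>Z. D z * D z) = (\<Sum>z\<in>Z. a z * D z)"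
    unfolding D_def Z_def[symmetric] by (rule sum_cond_mean[OF Z cond_mean_label])
  have "(\<Sum>z\<in>Z. (D' z)\<^sup>2) = (\<Sum>z\<in>Z. (D z)\<^sup>2 + (D' z - D z)\<^sup>2 + 2 * (D' z * D z) - 2 * (D z * D z))"
    by (rule sum.cong) (auto simp: power2_eq_square algebra_simps)
  also have "\<dots> = (\<Sum>z\<in>Z. (D z)\<^sup>2) + (\<Sum>z\<in>Z. (D' z - D z)\<^sup>2)"
    using 1 2 by (simp add: sum.distrib sum_subtractf sum_distrib_left[symmetric])
  finally show ?thesis unfolding Z_def .
qed

text \<open>The indicator of \<open>A \<times> B\<close> is constant on the refined cells, so it has
  the same inner product with \<open>D' - D\<close> as with \<open>a - D\<close>, which exceeds
  \<eta> n^2 in absolute value. The squared norm of the indicator is at most n^2, so Cauchy-Schwarz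
  makes that of \<open>D' - D\<close> at least \<eta>^2 n^2, and Pythagoras turns this into a gain
  of energy.\<close>

lemma energy_increment:
  assumes V: "finite V" and A: "A \<subseteq> V" and B: "B \<subseteq> V"
    and big: "\<bar>\<Sum>z\<in>A \<times> B. a z - cond_mean (V \<times> V) (pair_label P) a z\<bar> > \<eta> * (real (card V))\<^sup>2"
    and \<eta>: "\<eta> > 0"
    and P': "\<And>x y. x \<in> V \<Longrightarrow> y \<in> V \<Longrightarrow> P' x = P' y \<Longrightarrow> P x = P y \<and> (x \<in> A \<longleftrightarrow> y \<in> A) \<and> (x \<in> B \<longleftrightarrow> y \<in> B)"
  shows "(\<Sum>z\<in>V \<times> V. (cond_mean (V \<times> V) (pair_label P') a z)\<^sup>2)
    \<ge> (\<Sum>z\<in>V \<times> V. (cond_mean (V \<times> V) (pair_label P) a z)\<^sup>2) + \<eta>\<^sup>2 * (real (card V))\<^sup>2"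
proof -
  define Z where "Z = V \<times> V"
  define D where "D = cond_mean Z (pair_label P) a"
  define D' where "D' = cond_mean Z (pair_label P') a"
  define n where "n = real (card V)"
  have Z: "finite Z" "real (card Z) = n\<^sup>2" using V by (auto simp: Z_def n_def card_cartesian_product power2_eq_square)
  define g where "g z = (of_bool (z \<in> A \<times> B) :: real)" for z
  have g': "g z = g z'" if "z \<in> Z" "z' \<in> Z" "pair_label P' z = pair_label P' z'" for z z'
    using that P'[of "fst z" "fst z'"] P'[of "snd z" "snd z'"]
    by (auto simp: Z_def pair_label_def g_def)
  have pyth: "(\<Sum>z\<in>Z. (D' z)\<^sup>2) = (\<Sum>z\<in>Z. (D z)\<^sup>2) + (\<Sum>z\<in>Z. (D' z - D z)\<^sup>2)"
    unfolding D_def D'_def Z_def by (rule cond_mean_pythagoras[OF V]) (use P' in blast)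
  have "(\<Sum>z\<in>Z. D' z * g z) = (\<Sum>z\<in>Z. a z * g z)"
    unfolding D'_def by (rule sum_cond_mean[OF Z(1)]) (rule g')
  then have "(\<Sum>z\<in>Z. (D' z - D z) * g z) = (\<Sum>z\<in>Z. (a z - D z) * g z)"
    by (simp add: algebra_simps sum_subtractf)
  also have "\<dots> = (\<Sum>z\<in>A \<times> B. a z - D z)"
    unfolding g_def using Z A B by (intro sum.mono_neutral_cong_right) (auto simp: Z_def)
  finally have c: "\<bar>\<Sum>z\<in>Z. (D' z - D z) * g z\<bar> > \<eta> * n\<^sup>2"
    using big unfolding D_def Z_def n_def by simp
  have n: "n > 0" 
  proof (rule ccontr)
    assume "\<not> n > 0"
    then have "V = {}" using V by (auto simp: n_def)
    then have "Z = {}" by (simp add: Z_def)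
    then show False using c \<eta> by (simp add: mult_less_0_iff)
  qed
  have "(\<eta> * n\<^sup>2)\<^sup>2 \<le> (\<Sum>z\<in>Z. (D' z - D z) * g z)\<^sup>2"
    using c \<eta> n by (subst power2_abs[symmetric, of "sum _ _"], intro power_mono) auto
  also have "\<dots> \<le> (\<Sum>z\<in>Z. (D' z - D z)\<^sup>2) * (\<Sum>z\<in>Z. (g z)\<^sup>2)"
    by (rule Cauchy_Schwarz_ineq_sum)
  also have "\<dots> \<le> (\<Sum>z\<in>Z. (D' z - D z)\<^sup>2) * n\<^sup>2"
  proof (intro mult_left_mono)
    have "(\<Sum>z\<in>Z. (g z)\<^sup>2) \<le> (\<Sum>z\<in>Z. 1)" by (intro sum_mono) (auto simp: g_def)
    then show "(\<Sum>z\<in>Z. (g z)\<^sup>2) \<le> n\<^sup>2" using Z by simp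
  qed (auto intro: sum_nonneg)
  finally have "\<eta>\<^sup>2 * n\<^sup>2 * n\<^sup>2 \<le> (\<Sum>z\<in>Z. (D' z - D z)\<^sup>2) * n\<^sup>2" 
    by (simp add: power_mult_distrib power2_eq_square mult_ac)
  then have "\<eta>\<^sup>2 * n\<^sup>2 \<le> (\<Sum>z\<in>Z. (D' z - D z)\<^sup>2)" using n by simp
  then show ?thesis using pyth unfolding D_def D'_def Z_def n_def by simp
qed

text \<open>Serves the matrices that did not cause a refinement: their energies must not drop while
  one of them gains.\<close>

lemma cond_mean_refine_energy:
  assumes V: "finite V"
    and P': "\<And>x y. x \<in> V \<Longrightarrow> y \<in> V \<Longrightarrow> P' x = P' y \<Longrightarrow> P x = P y"
  shows "(\<Sum>z\<in>V \<times> V. (cond_mean (V \<times> V) (pair_label P') a z)\<^sup>2)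
    \<ge> (\<Sum>z\<in>V \<times> V. (cond_mean (V \<times> V) (pair_label P) a z)\<^sup>2)"
proof -
  let ?D = "\<lambda>P. cond_mean (V \<times> V) (pair_label P) a"
  have "(\<Sum>z\<in>V \<times> V. (?D P' z)\<^sup>2) = (\<Sum>z\<in>V \<times> V. (?D P z)\<^sup>2) + (\<Sum>z\<in>V \<times> V. (?D P' z - ?D P z)\<^sup>2)"
    by (rule cond_mean_pythagoras[OF V]) (rule P')
  then show ?thesis by (simp add: sum_nonneg)
qed

text \<open>The weak regularity lemma of Frieze and Kannan, for several matrices at once. Cells are
  indexed by Boolean lists; each refinement by a pair of witness sets prepends two bits.\<close>

lemma weak_regularity:
  fixes a :: "'c \<Rightarrow> 'v \<times> 'v \<Rightarrow> real"
  assumes V: "finite V" and R: "finite R"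
    and a: "\<And>\<rho> z. \<rho> \<in> R \<Longrightarrow> z \<in> V \<times> V \<Longrightarrow> 0 \<le> a \<rho> z \<and> a \<rho> z \<le> 1"
    and \<eta>: "\<eta> > 0" and s: "real s * \<eta>\<^sup>2 > real (card R)" and ne: "V \<noteq> {}"
  shows "\<exists>t\<le>s. \<exists>P. P \<in> V \<rightarrow> {l :: bool list. length l = 2 * t} \<and>
    (\<forall>\<rho>\<in>R. cut_bounded V (\<eta> * (real (card V))\<^sup>2)
        (\<lambda>z. a \<rho> z - cond_mean (V \<times> V) (pair_label P) (a \<rho>) z))"
proof (rule ccontr)
  assume neg: "\<not> ?thesis"
  define n where "n = real (card V)"
  define en where "en P = (\<Sum>\<rho>\<in>R. \<Sum>z\<in>V \<times> V. (cond_mean (V \<times> V) (pair_label P) (a \<rho>) z)\<^sup>2)"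
    for P :: "'v \<Rightarrow> bool list"
  \<comment> \<open>If every partition with few cells fails, refinement can go on for
    \<open>s\<close> rounds. The energy then exceeds its maximum \<open>card R\<close> times n^2, by
    the choice of \<open>s\<close>.\<close>
  have "\<exists>P. P \<in> V \<rightarrow> {l :: bool list. length l = 2 * t} \<and> en P \<ge> real t * (\<eta>\<^sup>2 * n\<^sup>2)" if "t \<le> s" for t
    using that
  proof (induction t)
    case 0
    show ?case by (rule exI[of _ "\<lambda>_. []"]) (auto simp: en_def intro!: sum_nonneg)
  next
    case (Suc t)
    then obtain P where P: "P \<in> V \<rightarrow> {l :: bool list. length l = 2 * t}" "en P \<ge> real t * (\<eta>\<^sup>2 * n\<^sup>2)"
      by auto
    obtain \<rho> where \<rho>: "\<rho> \<in> R" and nc: "\<not> cut_bounded V (\<eta> * n\<^sup>2)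
        (\<lambda>z. a \<rho> z - cond_mean (V \<times> V) (pair_label P) (a \<rho>) z)"
      using neg P(1) Suc.prems unfolding n_def by (meson Suc_leD)
    then obtain A B where AB: "A \<subseteq> V" "B \<subseteq> V"
      and big: "\<bar>\<Sum>z\<in>A \<times> B. a \<rho> z - cond_mean (V \<times> V) (pair_label P) (a \<rho>) z\<bar> > \<eta> * n\<^sup>2"
      unfolding cut_bounded_def by (auto simp: not_le)
    define P' where "P' x = (x \<in> A) # (x \<in> B) # P x" for x
    have "en P' \<ge> en P + \<eta>\<^sup>2 * n\<^sup>2"
    proof -
      have "(\<Sum>z\<in>V \<times> V. (cond_mean (V \<times> V) (pair_label P') (a \<rho>) z)\<^sup>2)
        \<ge> (\<Sum>z\<in>V \<times> V. (cond_mean (V \<times> V) (pair_label P) (a \<rho>) z)\<^sup>2) + \<eta>\<^sup>2 * n\<^sup>2"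
        unfolding n_def by (rule energy_increment[OF V AB _ \<eta>]) (use big in \<open>auto simp: P'_def n_def\<close>)
      moreover have "(\<Sum>\<sigma>\<in>R-{\<rho>}. \<Sum>z\<in>V \<times> V. (cond_mean (V \<times> V) (pair_label P') (a \<sigma>) z)\<^sup>2)
        \<ge> (\<Sum>\<sigma>\<in>R-{\<rho>}. \<Sum>z\<in>V \<times> V. (cond_mean (V \<times> V) (pair_label P) (a \<sigma>) z)\<^sup>2)"
        by (intro sum_mono cond_mean_refine_energy V) (auto simp: P'_def)
      ultimately show ?thesis unfolding en_def using R \<rho> by (simp add: sum.remove[of R \<rho>])
    qed
    moreover have "P' \<in> V \<rightarrow> {l :: bool list. length l = 2 * Suc t}" using P(1) by (auto simp: P'_def)
    ultimately show ?case using P(2) by (intro exI[of _ P']) (auto simp: algebra_simps)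
  qed
  then obtain P where P: "en P \<ge> real s * (\<eta>\<^sup>2 * n\<^sup>2)" by blast
  have "en P \<le> (\<Sum>\<rho>\<in>R. \<Sum>z\<in>V \<times> V. 1)"
    unfolding en_def
  proof (intro sum_mono)
    fix \<rho> z assume "\<rho> \<in> R" "z \<in> V \<times> V"
    then show "(cond_mean (V \<times> V) (pair_label P) (a \<rho>) z)\<^sup>2 \<le> 1"
      using V a cond_mean_bounds[of "V \<times> V" "a \<rho>" "pair_label P" z] by (intro power_le_one) auto
  qed
  also have "\<dots> = real (card R) * n\<^sup>2" by (simp add: n_def card_cartesian_product power2_eq_square)
  finally have "real s * \<eta>\<^sup>2 * n\<^sup>2 \<le> real (card R) * n\<^sup>2" using P by (simp add: algebra_simps)
  moreover have "n\<^sup>2 > 0" using V ne by (simp add: n_def card_gt_0_iff)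
  ultimately show False using s by simp
qed

text \<open>The sum is linear in each of \<open>f\<close> and \<open>g\<close>, so 0-1 weights are
  extremal: first keep exactly the rows with positive weighted sum, then the columns that are
  positive on these rows. The one-sided form can be applied to \<open>W\<close> and to its
  negative.\<close>

lemma cut_weighted_le:
  assumes V: "finite V"
    and W: "\<And>A B. A \<subseteq> V \<Longrightarrow> B \<subseteq> V \<Longrightarrow> (\<Sum>z\<in>A \<times> B. W z) \<le> t"
    and f: "\<And>x. 0 \<le> f x" "\<And>x. f x \<le> 1" and g: "\<And>x. 0 \<le> g x" "\<And>x. g x \<le> (1::real)"
  shows "(\<Sum>x\<in>V. \<Sum>y\<in>V. f x * g y * W (x, y)) \<le> t"
proof -
  have pos: "(\<Sum>x\<in>V. h x * w x) \<le> (\<Sum>x\<in>{x\<in>V. w x > 0}. w x)"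
    if h: "\<And>x. 0 \<le> h x" "\<And>x. h x \<le> 1" for h w :: "'a \<Rightarrow> real"
  proof -
    have "h x * w x \<le> (if w x > 0 then w x else 0)" for x
      using h[of x] mult_right_mono[of "h x" 1 "w x"] by (auto simp: mult_nonneg_nonpos)
    then have "(\<Sum>x\<in>V. h x * w x) \<le> (\<Sum>x\<in>V. if w x > 0 then w x else 0)" by (intro sum_mono)
    also have "\<dots> = (\<Sum>x\<in>{x\<in>V. w x > 0}. w x)" using V by (simp add: sum.inter_filter)
    finally show ?thesis .
  qed
  define A where "A = {x\<in>V. (\<Sum>y\<in>V. g y * W (x, y)) > 0}"
  define B where "B = {y\<in>V. (\<Sum>x\<in>A. W (x, y)) > 0}"
  have "(\<Sum>x\<in>V. \<Sum>y\<in>V. f x * g y * W (x, y)) = (\<Sum>x\<in>V. f x * (\<Sum>y\<in>V. g y * W (x, y)))"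
    by (simp add: sum_distrib_left mult.assoc)
  also have "\<dots> \<le> (\<Sum>x\<in>A. \<Sum>y\<in>V. g y * W (x, y))" unfolding A_def by (rule pos[OF f])
  also have "\<dots> = (\<Sum>y\<in>V. g y * (\<Sum>x\<in>A. W (x, y)))" by (subst sum.swap) (simp add: sum_distrib_left)
  also have "\<dots> \<le> (\<Sum>y\<in>B. \<Sum>x\<in>A. W (x, y))" unfolding B_def by (rule pos[OF g])
  also have "\<dots> = (\<Sum>z\<in>A \<times> B. W z)" by (subst sum.swap) (simp add: sum.cartesian_product)
  also have "\<dots> \<le> t" by (rule W) (auto simp: A_def B_def)
  finally show ?thesis .
qed

lemma cut_bounded_weighted:
  assumes V: "finite V" and W: "cut_bounded V t W"
    and f: "\<And>x. 0 \<le> f x" "\<And>x. f x \<le> 1" and g: "\<And>x. 0 \<le> g x" "\<And>x. g x \<le> (1::real)"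
  shows "\<bar>\<Sum>x\<in>V. \<Sum>y\<in>V. f x * g y * W (x, y)\<bar> \<le> t"
proof -
  have "(\<Sum>x\<in>V. \<Sum>y\<in>V. f x * g y * W (x, y)) \<le> t"
    using W by (intro cut_weighted_le[OF V _ f g]) (auto simp: cut_bounded_def abs_le_iff)
  moreover have "(\<Sum>x\<in>V. \<Sum>y\<in>V. f x * g y * - W (x, y)) \<le> t"
    using W by (intro cut_weighted_le[OF V _ f g, where W = "\<lambda>z. - W z"])
      (auto simp: cut_bounded_def abs_le_iff sum_negf)
  ultimately show ?thesis by (simp add: sum_negf abs_le_iff)
qed

text \<open>Edges of index sets are increasing pairs and not two-element sets, so matrices can be
  evaluated at them without being symmetric.\<close>

definition index_pairs :: "nat set \<Rightarrow> (nat \<times> nat) set" where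
  "index_pairs I = {e \<in> I \<times> I. fst e < snd e}"

abbreviation pair_at :: "(nat \<Rightarrow> 'v) \<Rightarrow> nat \<times> nat \<Rightarrow> 'v \<times> 'v" where
  "pair_at x e \<equiv> (x (fst e), x (snd e))"

lemma finite_index_pairs: "finite I \<Longrightarrow> finite (index_pairs I)"
  by (simp add: index_pairs_def)

text \<open>Fix all vertices except the ends \<open>i\<close> and \<open>j\<close> of
  \<open>e0\<close>. Only \<open>e0\<close> contains both, so every other factor depends on at most
  one of them, the product splits as \<open>f z a * g z b\<close>, and the weighted cut bound
  applies to the two remaining sums.\<close>

lemma counting_step:
  fixes W :: "'v \<times> 'v \<Rightarrow> real" and v :: "nat \<times> nat \<Rightarrow> 'v \<times> 'v \<Rightarrow> real"
  assumes V: "finite V" and I: "finite I" and e0: "e0 \<in> index_pairs I"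
    and W: "cut_bounded V t W" and R: "R \<subseteq> index_pairs I - {e0}"
    and v: "\<And>e z. 0 \<le> v e z" "\<And>e z. v e z \<le> 1"
  shows "\<bar>\<Sum>x\<in>PiE I (\<lambda>_. V). W (x (fst e0), x (snd e0)) * (\<Prod>e\<in>R. v e (pair_at x e))\<bar>
    \<le> t * real (card V) ^ (card I - 2)"
proof -
  define i where "i = fst e0"
  define j where "j = snd e0"
  define I' where "I' = I - {i, j}"
  have ij: "i \<in> I" "j \<in> I" "i < j" using e0 by (auto simp: index_pairs_def i_def j_def)
  have fR: "finite R" using R finite_index_pairs[OF I] finite_subset by blast
  have I': "I = insert i (insert j I')" "i \<notin> insert j I'" "j \<notin> I'" "finite I'"
    using ij I by (auto simp: I'_def)
  have cI: "card I - 2 = card I'" using I' by simp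
  define R1 where "R1 = {e\<in>R. fst e = i \<or> snd e = i}"
  \<comment> \<open>Edges that meet neither end are put here too; their factors do not vary with
    \<open>b\<close>.\<close>
  define R2 where "R2 = R - R1"
  have R1: "fst e \<noteq> j \<and> snd e \<noteq> j" if "e \<in> R1" for e
    using that R ij e0 by (auto simp: R1_def index_pairs_def i_def j_def prod_eq_iff)
  have R2: "fst e \<noteq> i \<and> snd e \<noteq> i" if "e \<in> R2" for e
    using that by (auto simp: R1_def R2_def)
  define f where "f z a = (\<Prod>e\<in>R1. v e ((z(i := a)) (fst e), (z(i := a)) (snd e)))" for z :: "nat \<Rightarrow> 'v" and a
  define g where "g z b = (\<Prod>e\<in>R2. v e ((z(j := b)) (fst e), (z(j := b)) (snd e)))" for z :: "nat \<Rightarrow> 'v" and b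
  have split: "(\<Prod>e\<in>R. v e ((z(j := b, i := a)) (fst e), (z(j := b, i := a)) (snd e))) = f z a * g z b" for z a b
  proof -
    have "(\<Prod>e\<in>R. v e ((z(j := b, i := a)) (fst e), (z(j := b, i := a)) (snd e)))
      = (\<Prod>e\<in>R1. v e ((z(j := b, i := a)) (fst e), (z(j := b, i := a)) (snd e)))
        * (\<Prod>e\<in>R2. v e ((z(j := b, i := a)) (fst e), (z(j := b, i := a)) (snd e)))"
      unfolding R2_def by (subst mult.commute, rule prod.subset_diff) (use fR in \<open>auto simp: R1_def\<close>)
    also have "(\<Prod>e\<in>R1. v e ((z(j := b, i := a)) (fst e), (z(j := b, i := a)) (snd e))) = f z a"
      unfolding f_def using R1 by (intro prod.cong refl) auto
    also have "(\<Prod>e\<in>R2. v e ((z(j := b, i := a)) (fst e), (z(j := b, i := a)) (snd e))) = g z b"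
      unfolding g_def using R2 by (intro prod.cong refl) auto
    finally show ?thesis .
  qed
  have "(\<Sum>x\<in>PiE I (\<lambda>_. V). W (x i, x j) * (\<Prod>e\<in>R. v e (pair_at x e)))
    = (\<Sum>z\<in>PiE I' (\<lambda>_. V). \<Sum>b\<in>V. \<Sum>a\<in>V. W (a, b) * (f z a * g z b))"
  proof -
    have "(\<Sum>x\<in>PiE I (\<lambda>_. V). W (x i, x j) * (\<Prod>e\<in>R. v e (pair_at x e)))
      = (\<Sum>z\<in>PiE I' (\<lambda>_. V). \<Sum>b\<in>V. \<Sum>a\<in>V. W ((z(j := b, i := a)) i, (z(j := b, i := a)) j)
          * (\<Prod>e\<in>R. v e ((z(j := b, i := a)) (fst e), (z(j := b, i := a)) (snd e))))"
      by (simp only: I'(1) sum.PiE_insert[OF I'(2)] sum.PiE_insert[OF I'(3)])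
    then show ?thesis unfolding split using ij by simp
  qed
  also have "\<dots> = (\<Sum>z\<in>PiE I' (\<lambda>_. V). \<Sum>a\<in>V. \<Sum>b\<in>V. f z a * g z b * W (a, b))"
    by (rule sum.cong[OF refl], subst sum.swap) (simp add: mult_ac)
  also have "\<bar>\<dots>\<bar> \<le> (\<Sum>z\<in>PiE I' (\<lambda>_. V). \<bar>\<Sum>a\<in>V. \<Sum>b\<in>V. f z a * g z b * W (a, b)\<bar>)"
    by (rule sum_abs)
  also have "\<dots> \<le> (\<Sum>z\<in>PiE I' (\<lambda>_. V). t)"
    by (intro sum_mono cut_bounded_weighted[OF V W]) (auto simp: f_def g_def intro!: prod_nonneg prod_le_1 v)
  also have "\<dots> = t * real (card V) ^ (card I - 2)" using I' by (simp add: cI card_PiE)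
  finally show ?thesis unfolding i_def j_def .
qed

text \<open>Telescoping: \<open>u\<close> is replaced by \<open>w\<close> on one edge after the
  other, and \<open>counting_step\<close> bounds each exchange whatever mixture of \<open>u\<close>
  and \<open>w\<close> stands on the other edges.\<close>

lemma counting_lemma:
  fixes u w :: "nat \<times> nat \<Rightarrow> 'v \<times> 'v \<Rightarrow> real"
  assumes V: "finite V" and I: "finite I" and E: "E \<subseteq> index_pairs I"
    and cut: "\<And>e. e \<in> E \<Longrightarrow> cut_bounded V t (\<lambda>z. u e z - w e z)"
    and u: "\<And>e z. 0 \<le> u e z" "\<And>e z. u e z \<le> 1" and w: "\<And>e z. 0 \<le> w e z" "\<And>e z. w e z \<le> 1"
  shows "\<bar>(\<Sum>x\<in>PiE I (\<lambda>_. V). \<Prod>e\<in>E. u e (pair_at x e))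
        - (\<Sum>x\<in>PiE I (\<lambda>_. V). \<Prod>e\<in>E. w e (pair_at x e))\<bar>
    \<le> real (card E) * (t * real (card V) ^ (card I - 2))"
proof -
  have fE: "finite E" using E finite_index_pairs[OF I] finite_subset by blast
  define v where "v E1 e = (if e \<in> E1 then w e else u e)" for E1 e
  define S where "S E1 = (\<Sum>x\<in>PiE I (\<lambda>_. V). \<Prod>e\<in>E. v E1 e (pair_at x e))" for E1
  have "\<bar>S {} - S E1\<bar> \<le> real (card E1) * (t * real (card V) ^ (card I - 2))" if "finite E1" "E1 \<subseteq> E" for E1
    using that
  proof (induction E1 rule: finite_induct)
    case empty
    show ?case by simp
  next
    case (insert e0 E1)
    have e0: "e0 \<in> E" using insert by simp
    have "S E1 - S (insert e0 E1) = (\<Sum>x\<in>PiE I (\<lambda>_. V). (u e0 (x (fst e0), x (snd e0)) - w e0 (x (fst e0), x (snd e0)))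
        * (\<Prod>e\<in>E - {e0}. v E1 e (pair_at x e)))"
      unfolding S_def sum_subtractf[symmetric]
    proof (rule sum.cong[OF refl])
      fix x :: "nat \<Rightarrow> 'v"
      have "(\<Prod>e\<in>E - {e0}. v (insert e0 E1) e (pair_at x e))
         = (\<Prod>e\<in>E - {e0}. v E1 e (pair_at x e))"
        by (rule prod.cong) (auto simp: v_def)
      then show "(\<Prod>e\<in>E. v E1 e (pair_at x e)) - (\<Prod>e\<in>E. v (insert e0 E1) e (pair_at x e))
        = (u e0 (x (fst e0), x (snd e0)) - w e0 (x (fst e0), x (snd e0)))
        * (\<Prod>e\<in>E - {e0}. v E1 e (pair_at x e))"
        using insert(2) by (simp add: prod.remove[OF fE e0] v_def left_diff_distrib)
    qed
    also have "\<bar>\<dots>\<bar> \<le> t * real (card V) ^ (card I - 2)"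
      using E e0 by (intro counting_step[OF V I _ cut[OF e0], where R = "E - {e0}"]) (auto simp: v_def u w)
    finally show ?case using insert by (simp add: algebra_simps)
  qed
  from this[OF fE] show ?thesis unfolding S_def v_def by simp
qed

section \<open>From quasirandom graphs to types\<close>

lemma sum_of_bool_eq_card: "finite A \<Longrightarrow> (\<Sum>x\<in>A. of_bool (Q x)) = real (card {x\<in>A. Q x})"
  by (simp add: of_bool_def sum.inter_filter[symmetric])

text \<open>Here \<open>b\<close> is the quasirandom colouring, \<open>c\<close> the colouring that
  was partitioned, and \<phi> keeps the colours of density at least \<tau> in \<open>c\<close>. If
  \<rho> is missing on a pair of cells, its weight there is, up to \<open>d\<close>, the number of
  pairs that \<open>b\<close> colours \<rho>. Such a pair is an edit, or \<open>c\<close> gives it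
  the missing colour \<rho> as well, and the latter pairs make up less than the fraction \<tau> of
  the pair of cells.\<close>

lemma reduced_type_cost:
  fixes b c :: "'v \<times> 'v \<Rightarrow> nat" and p :: "nat \<Rightarrow> real"
  assumes V: "finite V" and R: "finite R" and p: "(\<Sum>\<rho>\<in>R. p \<rho>) = 1"
    and P: "P \<in> V \<rightarrow> L" and L: "finite L" "card L \<le> T"
    and b: "\<And>z. z \<in> V \<times> V \<Longrightarrow> b z \<in> R" and c: "\<And>z. z \<in> V \<times> V \<Longrightarrow> c z \<in> R"
    and qr: "\<And>\<rho> A B. \<rho> \<in> R \<Longrightarrow> A \<subseteq> V \<Longrightarrow> B \<subseteq> V \<Longrightarrow>
      p \<rho> * real (card (A \<times> B)) \<le> real (card {z\<in>A \<times> B. b z = \<rho>}) + d"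
    and d: "0 \<le> d" and \<tau>: "0 \<le> \<tau>"
    and D: "\<And>\<rho>. D \<rho> = cond_mean (V \<times> V) (pair_label P) (\<lambda>z. of_bool (c z = \<rho>))"
    and \<phi>: "\<And>z. \<phi> z = {\<rho>\<in>R. \<tau> \<le> D \<rho> z}"
  shows "(\<Sum>z\<in>V \<times> V. 1 - (\<Sum>\<rho>\<in>\<phi> z. p \<rho>))
    \<le> real (card {z\<in>V \<times> V. b z \<noteq> c z}) + real (card R) * (\<tau> * real (card V ^ 2) + real (T ^ 2) * d)"
proof -
  define Z where "Z = V \<times> V"
  have Z: "finite Z" "card Z = card V ^ 2" using V by (auto simp: Z_def card_cartesian_product power2_eq_square)
  have D_label: "D \<rho> z = D \<rho> z'" if "pair_label P z = pair_label P z'" for \<rho> z z'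
    unfolding D using that by (rule cond_mean_label)
  have \<phi>_label: "\<phi> z = \<phi> z'" if "pair_label P z = pair_label P z'" for z z'
    unfolding \<phi> using D_label[OF that] by simp
  have \<phi>R: "\<phi> z \<subseteq> R" for z using \<phi> by auto
  have 1: "1 - (\<Sum>\<rho>\<in>\<phi> z. p \<rho>) = (\<Sum>\<rho>\<in>R. p \<rho> * of_bool (\<rho> \<notin> \<phi> z))" for z
  proof -
    have "(\<Sum>\<rho>\<in>R. p \<rho> * of_bool (\<rho> \<notin> \<phi> z)) = (\<Sum>\<rho>\<in>R - \<phi> z. p \<rho>)"
      by (rule sum.mono_neutral_cong_right) (use R in auto)
    then show ?thesis using sum.subset_diff[OF \<phi>R[of z] R, of p] p by simp
  qed
  have cell: "(\<Sum>z\<in>{z\<in>Z. pair_label P z = q}. p \<rho> * of_bool (\<rho> \<notin> \<phi> z))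
      \<le> (\<Sum>z\<in>{z\<in>Z. pair_label P z = q}. of_bool (b z = \<rho> \<and> \<rho> \<notin> \<phi> z)) + d" if \<rho>: "\<rho> \<in> R" for q \<rho>
  proof (cases "\<exists>z0\<in>Z. pair_label P z0 = q \<and> \<rho> \<notin> \<phi> z0")
    case True
    define A where "A = {x\<in>V. P x = fst q}"
    define B where "B = {x\<in>V. P x = snd q}"
    have AB: "{z\<in>Z. pair_label P z = q} = A \<times> B" 
      by (auto simp: A_def B_def Z_def pair_label_def)
    have all: "\<rho> \<notin> \<phi> z" if "z \<in> A \<times> B" for z
      using True that \<phi>_label AB by blast
    have fin: "finite (A \<times> B)" using V by (auto simp: A_def B_def)
    have "(\<Sum>z\<in>A \<times> B. p \<rho> * of_bool (\<rho> \<notin> \<phi> z)) = p \<rho> * real (card (A \<times> B))"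
      using all by simp
    also have "\<dots> \<le> real (card {z\<in>A \<times> B. b z = \<rho>}) + d" using \<rho> by (intro qr) (auto simp: A_def B_def)
    also have "real (card {z\<in>A \<times> B. b z = \<rho>}) = (\<Sum>z\<in>A \<times> B. of_bool (b z = \<rho> \<and> \<rho> \<notin> \<phi> z))"
      unfolding sum_of_bool_eq_card[OF fin] using all by (intro arg_cong[of _ _ "\<lambda>A. real (card A)"]) auto
    finally show ?thesis unfolding AB .
  next
    case False
    have "(\<Sum>z\<in>{z\<in>Z. pair_label P z = q}. p \<rho> * of_bool (\<rho> \<notin> \<phi> z)) = 0"
      by (rule sum.neutral) (use False in auto)
    moreover have "0 \<le> (\<Sum>z\<in>{z\<in>Z. pair_label P z = q}. of_bool (b z = \<rho> \<and> \<rho> \<notin> \<phi> z) :: real)"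
      by (intro sum_nonneg) auto
    ultimately show ?thesis using d by simp
  qed
  have grp: "(\<Sum>z\<in>Z. h z) = (\<Sum>q\<in>L \<times> L. \<Sum>z\<in>{z\<in>Z. pair_label P z = q}. h z)" for h :: "'v \<times> 'v \<Rightarrow> real"
    by (rule sum.group[symmetric]) (use Z L P in \<open>auto simp: Z_def pair_label_def\<close>)
  have "(\<Sum>z\<in>Z. 1 - (\<Sum>\<rho>\<in>\<phi> z. p \<rho>)) = (\<Sum>\<rho>\<in>R. \<Sum>z\<in>Z. p \<rho> * of_bool (\<rho> \<notin> \<phi> z))"
    unfolding 1 by (rule sum.swap)
  also have "\<dots> \<le> (\<Sum>\<rho>\<in>R. (\<Sum>z\<in>Z. of_bool (b z = \<rho> \<and> \<rho> \<notin> \<phi> z)) + real (T ^ 2) * d)"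
  proof (rule sum_mono)
    fix \<rho> assume \<rho>: "\<rho> \<in> R"
    have "(\<Sum>z\<in>Z. p \<rho> * of_bool (\<rho> \<notin> \<phi> z)) \<le>
      (\<Sum>q\<in>L \<times> L. (\<Sum>z\<in>{z\<in>Z. pair_label P z = q}. of_bool (b z = \<rho> \<and> \<rho> \<notin> \<phi> z)) + d)"
      unfolding grp by (intro sum_mono cell[OF \<rho>])
    also have "\<dots> = (\<Sum>z\<in>Z. of_bool (b z = \<rho> \<and> \<rho> \<notin> \<phi> z)) + real (card L ^ 2) * d"
      unfolding sum.distrib grp[symmetric] by (simp add: card_cartesian_product power2_eq_square)
    also have "\<dots> \<le> (\<Sum>z\<in>Z. of_bool (b z = \<rho> \<and> \<rho> \<notin> \<phi> z)) + real (T ^ 2) * d"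
      using d L by (intro add_left_mono mult_right_mono of_nat_mono power_mono) auto
    finally show "(\<Sum>z\<in>Z. p \<rho> * of_bool (\<rho> \<notin> \<phi> z)) \<le> (\<Sum>z\<in>Z. of_bool (b z = \<rho> \<and> \<rho> \<notin> \<phi> z)) + real (T ^ 2) * d" .
  qed
  also have "\<dots> = (\<Sum>z\<in>Z. \<Sum>\<rho>\<in>R. of_bool (b z = \<rho> \<and> \<rho> \<notin> \<phi> z)) + real (card R) * (real (T ^ 2) * d)"
    unfolding sum.distrib by (subst sum.swap) simp
  also have "(\<Sum>z\<in>Z. \<Sum>\<rho>\<in>R. of_bool (b z = \<rho> \<and> \<rho> \<notin> \<phi> z) :: real)
     \<le> (\<Sum>z\<in>Z. of_bool (b z \<noteq> c z) + (\<Sum>\<rho>\<in>R. of_bool (c z = \<rho>) * of_bool (\<rho> \<notin> \<phi> z)))"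
  proof (rule sum_mono)
    fix z assume z: "z \<in> Z"
    have s: "(\<Sum>\<rho>\<in>R. of_bool (y = \<rho> \<and> \<rho> \<notin> \<phi> z)) = (of_bool (y \<notin> \<phi> z) :: real)" if "y \<in> R" for y
    proof -
      have "(\<Sum>\<rho>\<in>R. of_bool (y = \<rho> \<and> \<rho> \<notin> \<phi> z)) = (\<Sum>\<rho>\<in>R. if y = \<rho> then of_bool (\<rho> \<notin> \<phi> z) else (0::real))"
        by (rule sum.cong) auto
      then show ?thesis using R that by (simp add: sum.delta)
    qed
    have "b z \<in> R" "c z \<in> R" using z b c by (auto simp: Z_def)
    then show "(\<Sum>\<rho>\<in>R. of_bool (b z = \<rho> \<and> \<rho> \<notin> \<phi> z)) \<le>
      of_bool (b z \<noteq> c z) + (\<Sum>\<rho>\<in>R. of_bool (c z = \<rho>) * of_bool (\<rho> \<notin> \<phi> z) :: real)"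
      unfolding of_bool_conj[symmetric] by (simp add: s)
  qed
  also have "\<dots> = real (card {z\<in>Z. b z \<noteq> c z}) + (\<Sum>\<rho>\<in>R. \<Sum>z\<in>Z. of_bool (c z = \<rho>) * of_bool (\<rho> \<notin> \<phi> z))"
    unfolding sum.distrib sum_of_bool_eq_card[OF Z(1)] by (subst sum.swap) (rule refl)
  also have "(\<Sum>\<rho>\<in>R. \<Sum>z\<in>Z. of_bool (c z = \<rho>) * of_bool (\<rho> \<notin> \<phi> z)) \<le> (\<Sum>\<rho>\<in>R. \<tau> * real (card Z))"
  proof (rule sum_mono)
    fix \<rho> assume \<rho>: "\<rho> \<in> R"
    \<comment> \<open>Being missing is constant on pairs of cells, so the indicator of the colour
      may be replaced by its density, which is below \<tau> wherever the colour is missing.\<close>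
    have "(\<Sum>z\<in>Z. of_bool (c z = \<rho>) * of_bool (\<rho> \<notin> \<phi> z)) = (\<Sum>z\<in>Z. D \<rho> z * of_bool (\<rho> \<notin> \<phi> z))"
      unfolding D Z_def[symmetric] by (rule sum_cond_mean[symmetric, OF Z(1)]) (use \<phi>_label in metis)
    also have "\<dots> \<le> (\<Sum>z\<in>Z. \<tau>)"
      by (rule sum_mono) (use \<tau> \<rho> in \<open>auto simp: \<phi>\<close>)
    finally show "(\<Sum>z\<in>Z. of_bool (c z = \<rho>) * of_bool (\<rho> \<notin> \<phi> z)) \<le> \<tau> * real (card Z)" by (simp add: mult.commute)
  qed
  finally show ?thesis unfolding Z(2) Z_def[symmetric] by (simp add: algebra_simps)
qed

text \<open>On a tuple whose colour sets admit \<sigma>, every density of a selected colour is at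
  least \<tau>, so their product is at least \<tau> to the number of edges. By the counting lemma
  the sum of these products is close to the number of tuples that \<open>c\<close> really colours by
  \<sigma>.\<close>

lemma selection_count:
  fixes c :: "'v \<times> 'v \<Rightarrow> nat"
  assumes V: "finite V" and I: "finite I"
    and cut: "\<And>\<rho>. \<rho> \<in> R \<Longrightarrow> cut_bounded V (\<eta> * real (card V) ^ 2) (\<lambda>z. of_bool (c z = \<rho>) - D \<rho> z)"
    and D: "\<And>\<rho> z. 0 \<le> D \<rho> z" "\<And>\<rho> z. D \<rho> z \<le> 1" and \<tau>: "0 \<le> \<tau>"
    and \<phi>: "\<And>z. \<phi> z = {\<rho>\<in>R. \<tau> \<le> D \<rho> z}" and \<sigma>: "\<And>e. e \<in> index_pairs I \<Longrightarrow> \<sigma> e \<in> R"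
  defines "E \<equiv> index_pairs I"
  shows "\<tau> ^ card E * real (card {x\<in>PiE I (\<lambda>_. V). \<forall>e\<in>E. \<sigma> e \<in> \<phi> (pair_at x e)})
    \<le> real (card {x\<in>PiE I (\<lambda>_. V). \<forall>e\<in>E. c (pair_at x e) = \<sigma> e})
        + real (card E) * \<eta> * real (card V) ^ card I"
proof -
  define X where "X = PiE I (\<lambda>_. V)"
  have X: "finite X" unfolding X_def using V I by (auto intro: finite_PiE)
  have fE: "finite E" unfolding E_def by (rule finite_index_pairs[OF I])
  have "\<tau> ^ card E * real (card {x\<in>X. \<forall>e\<in>E. \<sigma> e \<in> \<phi> (pair_at x e)})
     = (\<Sum>x\<in>X. \<tau> ^ card E * of_bool (\<forall>e\<in>E. \<sigma> e \<in> \<phi> (pair_at x e)))"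
    by (simp only: sum_of_bool_eq_card[OF X] sum_distrib_left[symmetric])
  also have "\<dots> \<le> (\<Sum>x\<in>X. \<Prod>e\<in>E. D (\<sigma> e) (pair_at x e))"
  proof (rule sum_mono)
    fix x assume "x \<in> X"
    show "\<tau> ^ card E * of_bool (\<forall>e\<in>E. \<sigma> e \<in> \<phi> (pair_at x e))
      \<le> (\<Prod>e\<in>E. D (\<sigma> e) (pair_at x e))"
    proof (cases "\<forall>e\<in>E. \<sigma> e \<in> \<phi> (pair_at x e)")
      case True
      have "(\<Prod>e\<in>E. \<tau>) \<le> (\<Prod>e\<in>E. D (\<sigma> e) (pair_at x e))"
        by (rule prod_mono) (use True \<tau> in \<open>auto simp: \<phi>\<close>)
      then show ?thesis using True by simp
    next
      case False
      then have zero: "of_bool (\<forall>e\<in>E. \<sigma> e \<in> \<phi> (pair_at x e)) = (0::real)" by simp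
      show ?thesis unfolding zero using D by (simp add: prod_nonneg)
    qed
  qed
  also have "\<dots> \<le> (\<Sum>x\<in>X. \<Prod>e\<in>E. of_bool (c (pair_at x e) = \<sigma> e))
     + real (card E) * (\<eta> * real (card V) ^ 2 * real (card V) ^ (card I - 2))"
    using counting_lemma[OF V I, of E "\<eta> * real (card V) ^ 2" "\<lambda>e z. of_bool (c z = \<sigma> e)" "\<lambda>e. D (\<sigma> e)"]
      cut \<sigma> D unfolding X_def[symmetric] by (auto simp: E_def abs_le_iff)
  also have "(\<Sum>x\<in>X. \<Prod>e\<in>E. of_bool (c (pair_at x e) = \<sigma> e) :: real)
      = (\<Sum>x\<in>X. of_bool (\<forall>e\<in>E. c (pair_at x e) = \<sigma> e))"
    using fE by (intro sum.cong refl) (auto simp: prod_zero_iff of_bool_def)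
  also have "\<dots> = real (card {x\<in>X. \<forall>e\<in>E. c (pair_at x e) = \<sigma> e})"
    by (rule sum_of_bool_eq_card[OF X])
  \<comment> \<open>The subtraction in \<open>card I - 2\<close> truncates only if there are fewer
    than two indices; then there is no edge and the factor \<open>card E\<close> vanishes.\<close>
  also have "real (card E) * (\<eta> * real (card V) ^ 2 * real (card V) ^ (card I - 2))
     = real (card E) * \<eta> * real (card V) ^ card I"
  proof (cases "E = {}")
    case False
    then obtain i j where "i \<in> I" "j \<in> I" "i < j" by (auto simp: E_def index_pairs_def)
    then have "card {i, j} \<le> card I" using I by (intro card_mono) auto
    then have "2 \<le> card I" using \<open>i < j\<close> by simp
    then obtain N where "card I = 2 + N" using le_Suc_ex by blast
    then show ?thesis by (simp add: power_add power2_eq_square)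
  qed simp
  finally show ?thesis unfolding X_def .
qed

section \<open>Random tuples: collisions, popular patterns, blow-ups\<close>

lemma card_collision:
  assumes V: "finite V" and I: "finite I" and ij: "i \<in> I" "j \<in> I" "i \<noteq> j"
  shows "card {x\<in>PiE I (\<lambda>_. V). x i = x j} = card V ^ (card I - 1)"
proof -
  define I' where "I' = I - {i}"
  have I': "I = insert i I'" "i \<notin> I'" "finite I'" "j \<in> I'" using ij I by (auto simp: I'_def)
  have X: "finite (PiE I (\<lambda>_. V))" using V I by (auto intro: finite_PiE)
  have "card {x\<in>PiE I (\<lambda>_. V). x i = x j} = (\<Sum>x\<in>PiE I (\<lambda>_. V). if x i = x j then 1 else 0)"
    using X by (simp add: sum.inter_filter[symmetric])
  also have "\<dots> = (\<Sum>z\<in>PiE I' (\<lambda>_. V). \<Sum>a\<in>V. if a = z j then 1 else 0)"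
    unfolding I'(1) sum.PiE_insert[OF I'(2)] using ij by (intro sum.cong refl) auto
  also have "\<dots> = (\<Sum>z\<in>PiE I' (\<lambda>_. V). 1)"
    using V I' by (intro sum.cong refl) (auto simp: sum.delta)
  also have "\<dots> = card V ^ (card I - 1)" using I' by (simp add: card_PiE)
  finally show ?thesis .
qed

lemma card_not_inj:
  assumes V: "finite V" and I: "finite I"
  shows "card {x\<in>PiE I (\<lambda>_. V). \<not> inj_on x I} \<le> card (index_pairs I) * card V ^ (card I - 1)"
proof -
  have X: "finite (PiE I (\<lambda>_. V))" using V I by (auto intro: finite_PiE)
  have "{x\<in>PiE I (\<lambda>_. V). \<not> inj_on x I} \<subseteq> (\<Union>e\<in>index_pairs I. {x\<in>PiE I (\<lambda>_. V). x (fst e) = x (snd e)})"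
  proof
    fix x assume "x \<in> {x\<in>PiE I (\<lambda>_. V). \<not> inj_on x I}"
    then obtain i j where "i \<in> I" "j \<in> I" "i \<noteq> j" "x i = x j" and x: "x \<in> PiE I (\<lambda>_. V)"
      by (auto simp: inj_on_def)
    then have "(min i j, max i j) \<in> index_pairs I" "x (min i j) = x (max i j)"
      by (auto simp: index_pairs_def min_def max_def)
    then show "x \<in> (\<Union>e\<in>index_pairs I. {x\<in>PiE I (\<lambda>_. V). x (fst e) = x (snd e)})" using x by force
  qed
  then have "card {x\<in>PiE I (\<lambda>_. V). \<not> inj_on x I} \<le> card (\<Union>e\<in>index_pairs I. {x\<in>PiE I (\<lambda>_. V). x (fst e) = x (snd e)})"
    using X finite_index_pairs[OF I] by (intro card_mono) auto
  also have "\<dots> \<le> (\<Sum>e\<in>index_pairs I. card {x\<in>PiE I (\<lambda>_. V). x (fst e) = x (snd e)})"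
    by (rule card_UN_le[OF finite_index_pairs[OF I]])
  also have "\<dots> = (\<Sum>e\<in>index_pairs I. card V ^ (card I - 1))"
    by (intro sum.cong refl card_collision V I) (auto simp: index_pairs_def)
  finally show ?thesis by simp
qed

lemma mean_pair:
  assumes V: "finite V" "V \<noteq> {}" and I: "finite I" and ij: "i \<in> I" "j \<in> I" "i \<noteq> j"
  shows "mean (PiE I (\<lambda>_. V)) (\<lambda>x. h (x i, x j)) = mean (V \<times> V) h"
proof -
  define I' where "I' = I - {i, j}"
  have I': "I = insert i (insert j I')" "i \<notin> insert j I'" "j \<notin> I'" "finite I'"
    using ij I by (auto simp: I'_def)
  have ne: "finite (PiE I' (\<lambda>_. V))" "PiE I' (\<lambda>_. V) \<noteq> {}" using V I' by (auto simp: PiE_eq_empty_iff intro!: finite_PiE)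
  have "mean (PiE I (\<lambda>_. V)) (\<lambda>x. h (x i, x j))
     = mean (PiE I' (\<lambda>_. V)) (\<lambda>z. mean V (\<lambda>b. mean V (\<lambda>a. h (a, b))))"
    unfolding I'(1) using ij I' by (subst mean_PiE_insert, simp, simp, subst mean_PiE_insert) auto
  also have "\<dots> = mean V (\<lambda>b. mean V (\<lambda>a. h (a, b)))"
    using ne by (simp add: mean_def)
  also have "\<dots> = mean V (\<lambda>a. mean V (\<lambda>b. h (a, b)))" by (rule mean_swap)
  also have "\<dots> = mean (V \<times> V) h"
    by (simp add: mean_def sum_divide_distrib[symmetric] card_cartesian_product sum.cartesian_product)
  finally show ?thesis .
qed

text \<open>Markov's inequality. If every value of cost at most m + \<epsilon> were rare, all of
  them together would have probability at most \<alpha> times \<open>card Y\<close>, and the rest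
  alone would push the mean above m.\<close>

lemma popular_cheap_value:
  fixes cost :: "'b \<Rightarrow> real"
  assumes X: "finite X" "X \<noteq> {}" and Y: "finite Y" "f ` X \<subseteq> Y" 
    and cost: "\<And>y. y \<in> Y \<Longrightarrow> 0 \<le> cost y" and m: "mean X (\<lambda>x. cost (f x)) \<le> m"
    and \<alpha>: "\<alpha> * real (card Y) * (m + \<epsilon>) < \<epsilon>" "0 \<le> \<alpha>" "0 \<le> m + \<epsilon>"
  shows "\<exists>y\<in>Y. cost y \<le> m + \<epsilon> \<and> \<alpha> * real (card X) \<le> real (card {x\<in>X. f x = y})"
proof (rule ccontr)
  assume neg: "\<not> ?thesis"
  define B where "B = {x\<in>X. cost (f x) \<le> m + \<epsilon>}"
  define Y' where "Y' = {y\<in>Y. cost y \<le> m + \<epsilon>}"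
  have "B = (\<Union>y\<in>Y'. {x\<in>X. f x = y})" using Y by (auto simp: B_def Y'_def)
  then have "card B \<le> (\<Sum>y\<in>Y'. card {x\<in>X. f x = y})"
    using card_UN_le[of Y' "\<lambda>y. {x\<in>X. f x = y}"] Y by (simp add: Y'_def)
  then have "real (card B) \<le> real (\<Sum>y\<in>Y'. card {x\<in>X. f x = y})" by (rule of_nat_mono)
  also have "\<dots> \<le> (\<Sum>y\<in>Y'. \<alpha> * real (card X))"
    unfolding of_nat_sum by (rule sum_mono) (use neg in \<open>auto simp: Y'_def\<close>)
  also have "\<dots> = real (card Y') * (\<alpha> * real (card X))" by simp
  also have "\<dots> \<le> real (card Y) * (\<alpha> * real (card X))"
    using Y \<alpha> by (intro mult_right_mono of_nat_mono card_mono) (auto simp: Y'_def)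
  finally have cB: "real (card B) \<le> real (card Y) * (\<alpha> * real (card X))" .
  have "(m + \<epsilon>) * (real (card X) - real (card B)) = (\<Sum>x\<in>X - B. m + \<epsilon>)"
    using X by (simp add: card_Diff_subset B_def of_nat_diff card_mono mult.commute)
  also have "\<dots> \<le> (\<Sum>x\<in>X - B. cost (f x))" by (rule sum_mono) (auto simp: B_def)
  also have "\<dots> \<le> (\<Sum>x\<in>X. cost (f x))" using X Y cost by (intro sum_mono2) auto
  also have "\<dots> \<le> m * real (card X)"
    using m X by (simp add: mean_def divide_le_eq card_gt_0_iff)
  finally have "\<epsilon> * real (card X) \<le> (m + \<epsilon>) * real (card B)" by (simp add: algebra_simps)
  also have "\<dots> \<le> (m + \<epsilon>) * (real (card Y) * (\<alpha> * real (card X)))" using cB \<alpha> by (intro mult_left_mono)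
  also have "\<dots> = (\<alpha> * real (card Y) * (m + \<epsilon>)) * real (card X)" by simp
  also have "\<dots> < \<epsilon> * real (card X)" using \<alpha> X by (intro mult_strict_right_mono) (auto simp: card_gt_0_iff)
  finally show False by simp
qed

text \<open>Index \<open>t\<close> stands for copy \<open>t mod M\<close> of vertex
  \<open>t div M\<close>. A tuple of \<open>k * M\<close> vertices is counted by
  \<open>mean_blowup\<close> if each of its \<open>M ^ k\<close> transversals shows the pattern,
  which fixes the colour sets between different blocks and leaves those inside a block open.\<close>

lemma blowup_count:
  fixes \<phi> :: "'v \<times> 'v \<Rightarrow> 'b"
  assumes V: "finite V" "V \<noteq> {}" and M: "M > 0" and \<alpha>: "0 \<le> \<alpha>"
    and pop: "\<alpha> * real (card V) ^ k \<le> real (card {x\<in>PiE {..<k} (\<lambda>_. V).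
        \<forall>e\<in>index_pairs {..<k}. \<phi> (pair_at x e) = \<kappa> e})"
  shows "\<alpha> ^ (M ^ k) * real (card V) ^ (k * M) \<le> real (card {x\<in>PiE {..<k * M} (\<lambda>_. V).
        \<forall>s<k * M. \<forall>t<k * M. s div M < t div M \<longrightarrow> \<phi> (x s, x t) = \<kappa> (s div M, t div M)})"
proof -
  define Q where "Q x \<longleftrightarrow> (\<forall>e\<in>index_pairs {..<k}. \<phi> (pair_at x e) = \<kappa> e)" for x
  define f where "f x = (of_bool (Q x) :: real)" for x
  define W where "W = PiE {..<M} (\<lambda>_. V)"
  define XX where "XX = PiE {..<k} (\<lambda>_. W)"
  define S where "S = PiE {..<k} (\<lambda>_. {..<M})"
  define n where "n = real (card V)"
  have n: "n > 0" using V by (simp add: n_def card_gt_0_iff)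
  have W: "finite W" "real (card W) = n ^ M" using V by (auto simp: W_def card_PiE n_def intro: finite_PiE)
  have XX: "finite XX" "real (card XX) = n ^ (k * M)"
    using W by (auto simp: XX_def card_PiE power_mult[symmetric] mult.commute intro: finite_PiE)
  have S: "finite S" by (simp add: S_def finite_PiE)
  have fX: "finite (PiE {..<k} (\<lambda>_. V))" using V by (auto intro: finite_PiE)
  have "\<alpha> \<le> mean (PiE {..<k} (\<lambda>_. V)) f"
    using pop n unfolding mean_def f_def sum_of_bool_eq_card[OF fX] Q_def
    by (simp add: card_PiE n_def le_divide_eq)
  then have "\<alpha> ^ (M ^ k) \<le> mean (PiE {..<k} (\<lambda>_. V)) f ^ (M ^ k)" using \<alpha> by (intro power_mono)
  also have "\<dots> \<le> mean XX (\<lambda>X. \<Prod>s\<in>S. f (\<lambda>i\<in>{..<k}. X i (s i)))"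
    unfolding XX_def W_def S_def by (rule mean_blowup[OF V]) (simp add: f_def)
  also have "\<dots> = real (card {X\<in>XX. \<forall>s\<in>S. Q (\<lambda>i\<in>{..<k}. X i (s i))}) / n ^ (k * M)"
  proof -
    have "(\<Prod>s\<in>S. f (\<lambda>i\<in>{..<k}. X i (s i))) = of_bool (\<forall>s\<in>S. Q (\<lambda>i\<in>{..<k}. X i (s i)))" for X
      using S by (auto simp: f_def of_bool_def prod_zero_iff)
    then show ?thesis unfolding mean_def by (simp only: sum_of_bool_eq_card[OF XX(1)] XX(2))
  qed
  finally have "\<alpha> ^ (M ^ k) * n ^ (k * M) \<le> real (card {X\<in>XX. \<forall>s\<in>S. Q (\<lambda>i\<in>{..<k}. X i (s i))})"
    using n by (simp add: le_divide_eq)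
  also have "card {X\<in>XX. \<forall>s\<in>S. Q (\<lambda>i\<in>{..<k}. X i (s i))} \<le> card {x\<in>PiE {..<k * M} (\<lambda>_. V).
        \<forall>s<k * M. \<forall>t<k * M. s div M < t div M \<longrightarrow> \<phi> (x s, x t) = \<kappa> (s div M, t div M)}"
  proof (rule card_inj_on_le)
    let ?F = "\<lambda>X. \<lambda>t\<in>{..<k * M}. X (t div M) (t mod M)"
    have lt: "t div M < k" "t mod M < M" if "t < k * M" for t
      using that M by (auto simp: less_mult_imp_div_less)
    show "inj_on ?F {X\<in>XX. \<forall>s\<in>S. Q (\<lambda>i\<in>{..<k}. X i (s i))}"
    proof (rule inj_onI)
      fix X Y assume X: "X \<in> {X\<in>XX. \<forall>s\<in>S. Q (\<lambda>i\<in>{..<k}. X i (s i))}"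
        and Y: "Y \<in> {X\<in>XX. \<forall>s\<in>S. Q (\<lambda>i\<in>{..<k}. X i (s i))}" and eq: "?F X = ?F Y"
      have XY: "X \<in> PiE {..<k} (\<lambda>_. W)" "Y \<in> PiE {..<k} (\<lambda>_. W)" using X Y by (auto simp: XX_def)
      show "X = Y"
      proof (rule PiE_ext[OF XY])
        fix i assume i: "i \<in> {..<k}"
        have XYi: "X i \<in> PiE {..<M} (\<lambda>_. V)" "Y i \<in> PiE {..<M} (\<lambda>_. V)"
          using XY i by (auto simp: W_def)
        show "X i = Y i"
        proof (rule PiE_ext[OF XYi])
          fix a assume a: "a \<in> {..<M}"
          have "i * M + a < Suc i * M" using a by simp
          also have "\<dots> \<le> k * M" using i by (intro mult_right_mono) auto
          finally have "i * M + a < k * M" .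
          then show "X i a = Y i a" using fun_cong[OF eq, of "i * M + a"] a by simp
        qed
      qed
    qed
    show "?F ` {X\<in>XX. \<forall>s\<in>S. Q (\<lambda>i\<in>{..<k}. X i (s i))} \<subseteq> {x\<in>PiE {..<k * M} (\<lambda>_. V).
        \<forall>s<k * M. \<forall>t<k * M. s div M < t div M \<longrightarrow> \<phi> (x s, x t) = \<kappa> (s div M, t div M)}"
    proof (rule image_subsetI, rule CollectI, intro conjI allI impI)
      fix X assume X: "X \<in> {X\<in>XX. \<forall>s\<in>S. Q (\<lambda>i\<in>{..<k}. X i (s i))}"
      have Xm: "X i a \<in> V" if "i < k" "a < M" for i a
        using X that by (auto simp: XX_def W_def PiE_iff)
      show "?F X \<in> PiE {..<k * M} (\<lambda>_. V)"
        using Xm lt by (simp add: PiE_iff)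
      fix s t assume st: "s < k * M" "t < k * M" "s div M < t div M"
      \<comment> \<open>A transversal through both \<open>s\<close> and \<open>t\<close>, which
        exists because they lie in different blocks; copy 0 elsewhere is arbitrary.\<close>
      define u where "u = (\<lambda>i\<in>{..<k}. if i = s div M then s mod M else if i = t div M then t mod M else 0)"
      have "u \<in> S" using lt[OF st(1)] lt[OF st(2)] M by (auto simp: S_def u_def)
      then have "Q (\<lambda>i\<in>{..<k}. X i (u i))" using X by auto
      moreover have "(s div M, t div M) \<in> index_pairs {..<k}"
        using lt[OF st(1)] lt[OF st(2)] st by (simp add: index_pairs_def)
      ultimately show "\<phi> (?F X s, ?F X t) = \<kappa> (s div M, t div M)"
        using lt[OF st(1)] lt[OF st(2)] st by (force simp: Q_def u_def)
    qed
    show "finite {x\<in>PiE {..<k * M} (\<lambda>_. V).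
        \<forall>s<k * M. \<forall>t<k * M. s div M < t div M \<longrightarrow> \<phi> (x s, x t) = \<kappa> (s div M, t div M)}"
      by (rule finite_subset[of _ "PiE {..<k * M} (\<lambda>_. V)"]) (use V in \<open>auto intro: finite_PiE\<close>)
  qed
  finally show ?thesis unfolding n_def by simp
qed

section \<open>Ordered pairs and edges, induced copies, Ramsey's theorem\<close>

lemma square_eq_diag_Un_index_pairs:
  "V \<times> V = (\<lambda>x. (x, x)) ` V \<union> index_pairs V \<union> prod.swap ` index_pairs V"
  by (force simp: index_pairs_def image_iff)

lemma sum_square_symmetric:
  fixes F :: "nat \<Rightarrow> nat \<Rightarrow> 'b::comm_semiring_1"
  assumes V: "finite V" and F: "\<And>x y. x \<in> V \<Longrightarrow> y \<in> V \<Longrightarrow> F x y = F y x"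
  shows "(\<Sum>x\<in>V. \<Sum>y\<in>V. F x y) = (\<Sum>x\<in>V. F x x) + 2 * (\<Sum>e\<in>index_pairs V. F (fst e) (snd e))"
proof -
  have f: "finite (index_pairs V)" by (rule finite_index_pairs[OF V])
  have "(\<Sum>x\<in>V. \<Sum>y\<in>V. F x y) = (\<Sum>z\<in>V \<times> V. F (fst z) (snd z))"
    by (simp add: sum.cartesian_product case_prod_beta)
  also have "\<dots> = (\<Sum>z\<in>(\<lambda>x. (x, x)) ` V. F (fst z) (snd z)) + (\<Sum>z\<in>index_pairs V. F (fst z) (snd z))
      + (\<Sum>z\<in>prod.swap ` index_pairs V. F (fst z) (snd z))"
    unfolding square_eq_diag_Un_index_pairs[of V] 
    by (subst sum.union_disjoint, use V f in \<open>force simp: index_pairs_def\<close>, use V f in \<open>force simp: index_pairs_def\<close>,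
        use V f in \<open>force simp: index_pairs_def\<close>, subst sum.union_disjoint,
        use V f in \<open>force simp: index_pairs_def\<close>, use V f in \<open>force simp: index_pairs_def\<close>,
        use V f in \<open>force simp: index_pairs_def\<close>, rule refl)
  also have "(\<Sum>z\<in>(\<lambda>x. (x, x)) ` V. F (fst z) (snd z)) = (\<Sum>x\<in>V. F x x)"
    by (subst sum.reindex) (auto simp: inj_on_def)
  also have "(\<Sum>z\<in>prod.swap ` index_pairs V. F (fst z) (snd z)) = (\<Sum>e\<in>index_pairs V. F (fst e) (snd e))"
    by (subst sum.reindex) (auto simp: index_pairs_def intro!: sum.cong F)
  finally show ?thesis by (simp add: mult_2 add.assoc)
qed

lemma bij_betw_index_pairs: "bij_betw (\<lambda>e. {fst e, snd e}) (index_pairs V) (nsets V 2)"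
  unfolding bij_betw_def
proof
  show "inj_on (\<lambda>e. {fst e, snd e}) (index_pairs V)"
    by (force simp: inj_on_def index_pairs_def doubleton_eq_iff)
  show "(\<lambda>e. {fst e, snd e}) ` index_pairs V = nsets V 2"
  proof (intro set_eqI iffI)
    fix d assume "d \<in> nsets V 2"
    then obtain x y where "d = {x, y}" "x \<in> V" "y \<in> V" "x < y" by (auto simp: ordered_nsets_2_eq)
    then show "d \<in> (\<lambda>e. {fst e, snd e}) ` index_pairs V"
      by (intro image_eqI[of _ _ "(x, y)"]) (auto simp: index_pairs_def)
  qed (auto simp: index_pairs_def)
qed

lemma sum_nsets_2: "(\<Sum>e\<in>nsets V 2. h e) = (\<Sum>e\<in>index_pairs V. h {fst e, snd e})"
  by (rule sum.reindex_bij_betw[symmetric, OF bij_betw_index_pairs])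

lemma card_index_pairs: "finite I \<Longrightarrow> card (index_pairs I) = card I choose 2"
  using bij_betw_same_card[OF bij_betw_index_pairs[of I]] by simp

lemma two_choose_two_le: "2 * real (n choose 2) \<le> real n ^ 2"
proof -
  have "2 * (n choose 2) \<le> n * (n - 1)" unfolding choose_two by simp
  also have "\<dots> \<le> n ^ 2" by (simp add: power2_eq_square)
  finally have "2 * (n choose 2) \<le> n ^ 2" .
  then show ?thesis by (metis of_nat_le_iff of_nat_mult of_nat_numeral of_nat_power)
qed

lemma card_offdiag:
  fixes V :: "nat set"
  assumes V: "finite V"
  shows "card {z\<in>V \<times> V. fst z \<noteq> snd z \<and> S {fst z, snd z}} = 2 * card {e\<in>nsets V 2. S e}"
proof -
  have "card {z\<in>V \<times> V. fst z \<noteq> snd z \<and> S {fst z, snd z}}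
    = (\<Sum>z\<in>V \<times> V. if fst z \<noteq> snd z \<and> S {fst z, snd z} then 1 else 0)"
    using V by (simp add: sum.inter_filter[symmetric])
  also have "\<dots> = (\<Sum>x\<in>V. \<Sum>y\<in>V. if x \<noteq> y \<and> S {x, y} then 1 else 0)"
    by (simp add: sum.cartesian_product case_prod_beta)
  also have "\<dots> = 2 * (\<Sum>e\<in>index_pairs V. if S {fst e, snd e} then 1 else 0)"
    by (subst sum_square_symmetric[OF V])
      (auto simp: insert_commute index_pairs_def intro!: sum.cong)
  also have "(\<Sum>e\<in>index_pairs V. if S {fst e, snd e} then 1 else 0) = (\<Sum>e\<in>nsets V 2. if S e then 1 else 0)"
    unfolding sum_nsets_2 by simp
  also have "\<dots> = card {e\<in>nsets V 2. S e}"
    using V by (simp add: sum.inter_filter[symmetric] finite_imp_finite_nsets)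
  finally show ?thesis .
qed

text \<open>Deleting everything outside the image of \<open>x\<close> leaves a member of the
  property, which the inverse of \<open>x\<close> maps isomorphically onto \<open>H\<close>.\<close>

lemma induced_copy_mem:
  assumes her: "hereditary r \<H>" and G: "G \<in> \<H>" and H: "H \<in> rgraphs r"
    and x: "inj_on x (verts H)" "x ` verts H \<subseteq> verts G"
    and col: "\<And>e. e \<in> nsets (verts H) 2 \<Longrightarrow> colour G (x ` e) = colour H e"
  shows "H \<in> \<H>"
proof -
  let ?W = "verts G - x ` verts H"
  let ?G' = "delete_verts G ?W"
  have v: "verts ?G' = x ` verts H" using x by (auto simp: delete_verts_def verts_def)
  let ?f = "the_inv_into (verts H) x"
  have "rgraph_iso ?G' H"
    unfolding rgraph_iso_def
  proof (intro exI[of _ ?f] conjI ballI)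
    show "bij_betw ?f (verts ?G') (verts H)"
      unfolding v using x by (simp add: bij_betw_the_inv_into bij_betw_imageI)
    fix e assume e: "e \<in> nsets (verts ?G') 2"
    then have e': "e \<subseteq> x ` verts H" unfolding v by (auto simp: nsets_def)
    have "?f ` e \<in> nsets (verts H) 2"
      using e bij_betw_nsets[OF \<open>bij_betw ?f (verts ?G') (verts H)\<close>] by (auto simp: bij_betw_def)
    then have "colour H (?f ` e) = colour G (x ` ?f ` e)" by (simp add: col)
    also have "x ` ?f ` e = e" 
      unfolding image_image using e' f_the_inv_into_f[OF x(1)] by force
    also have "colour G e = colour ?G' e"
      using e by (simp add: delete_verts_def colour_def verts_def)
    finally show "colour H (?f ` e) = colour ?G' e" .
  qed
  moreover have "?G' \<in> \<H>" using her G by (simp add: hereditary_def)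
  ultimately show ?thesis using her H by (auto simp: hereditary_def)
qed

text \<open>The set \<open>Q\<close> of Ramsey colours is arbitrary since it will consist of
  palettes, that is, of nonempty sets of edge colours.\<close>

lemma ramsey_palette:
  assumes Q: "finite Q" "Q \<noteq> {}"
  shows "\<exists>M>0. \<forall>f \<in> nsets {..<M::nat} 2 \<rightarrow> Q. \<exists>Y\<in>nsets {..<M} m. \<exists>q\<in>Q. \<forall>e\<in>nsets Y 2. f e = q"
proof -
  obtain h where h: "bij_betw h Q {0..<card Q}" using ex_bij_betw_finite_nat[OF Q(1)] by blast
  obtain M0 :: nat where "partn_lst {..<M0} (replicate (card Q) m) 2" using ramsey_full[of "replicate (card Q) m" 2] by blast
  \<comment> \<open>The successor makes the ground set nonempty, as later divisions by
    \<open>M\<close> require.\<close>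
  then have M: "partn_lst {..<Suc M0} (replicate (card Q) m) 2" 
    by (rule partn_lst_greater_resource) simp
  have "\<exists>Y\<in>nsets {..<Suc M0} m. \<exists>q\<in>Q. \<forall>e\<in>nsets Y 2. f e = q" if f: "f \<in> nsets {..<Suc M0} 2 \<rightarrow> Q" for f
  proof -
    have "h \<circ> f \<in> nsets {..<Suc M0} 2 \<rightarrow> {..<length (replicate (card Q) m)}"
      using f h by (auto simp: bij_betw_def Pi_iff)
    then obtain i Y where i: "i < card Q" and Y: "Y \<in> nsets {..<Suc M0} m" "(h \<circ> f) ` nsets Y 2 \<subseteq> {i}"
      using M by (force simp: partn_lst_def monochromatic_def)
    have "i \<in> h ` Q" using h i by (simp add: bij_betw_def)
    then obtain q where q: "q \<in> Q" "h q = i" by auto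
    have "f e = q" if e: "e \<in> nsets Y 2" for e
    proof -
      have "e \<in> nsets {..<Suc M0} 2" using e Y(1) by (auto simp: nsets_def)
      then have "f e \<in> Q" "h (f e) = h q" using f Y(2) e q by auto
      then show ?thesis using h q by (auto simp: bij_betw_def inj_on_def)
    qed
    then show ?thesis using Y(1) q(1) by (intro bexI[of _ Y] bexI[of _ q] ballI)
  qed
  then show ?thesis by (intro exI[of _ "Suc M0"] conjI ballI) simp_all
qed

text \<open>Tuples showing the blown-up pattern have proportion at least \<alpha>^(M^k). Discard
  those with a repeated vertex and, for each bad selection, those whose colour sets admit it. No
  injective tuple realises a bad selection, so \<open>selection_count\<close> makes the admitting
  tuples rare. By \<open>small\<close> something survives all at most \<open>card R ^ card E\<close>
  bad selections.\<close>

lemma exists_blowup_sample: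
  fixes c :: "'v \<times> 'v \<Rightarrow> nat"
  assumes V: "finite V" "V \<noteq> {}" and R: "finite R" and M: "M > 0" and \<alpha>: "0 \<le> \<alpha>"
    and cut: "\<And>\<rho>. \<rho> \<in> R \<Longrightarrow> cut_bounded V (\<eta> * real (card V) ^ 2) (\<lambda>z. of_bool (c z = \<rho>) - D \<rho> z)"
    and D: "\<And>\<rho> z. 0 \<le> D \<rho> z" "\<And>\<rho> z. D \<rho> z \<le> 1" and \<tau>: "0 < \<tau>" and \<eta>: "0 \<le> \<eta>"
    and \<phi>: "\<And>z. \<phi> z = {\<rho>\<in>R. \<tau> \<le> D \<rho> z}"
    and pop: "\<alpha> * real (card V) ^ k \<le> real (card {x\<in>PiE {..<k} (\<lambda>_. V).
        \<forall>e\<in>index_pairs {..<k}. \<phi> (pair_at x e) = \<kappa> e})"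
  defines "I \<equiv> {..<k * M}"
  defines "E \<equiv> index_pairs I"
  assumes noncopy: "\<And>\<sigma> x. \<sigma> \<in> PiE E (\<lambda>_. R) \<Longrightarrow> \<sigma> \<notin> Good \<Longrightarrow> x \<in> PiE I (\<lambda>_. V) \<Longrightarrow> inj_on x I \<Longrightarrow>
      \<not> (\<forall>e\<in>E. c (pair_at x e) = \<sigma> e)"
    and small: "real (card E) / real (card V)
        + (real (card R) / \<tau>) ^ card E * real (card E) * (1 / real (card V) + \<eta>) < \<alpha> ^ (M ^ k)"
  shows "\<exists>x\<in>PiE I (\<lambda>_. V). inj_on x I
      \<and> (\<forall>s<k * M. \<forall>t<k * M. s div M < t div M \<longrightarrow> \<phi> (x s, x t) = \<kappa> (s div M, t div M))
      \<and> (\<forall>\<sigma>\<in>PiE E (\<lambda>_. R). (\<forall>e\<in>E. \<sigma> e \<in> \<phi> (pair_at x e)) \<longrightarrow> \<sigma> \<in> Good)"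
proof (rule ccontr)
  assume neg: "\<not> ?thesis"
  define n where "n = real (card V)"
  define N where "N = k * M"
  define ce where "ce = real (card E)"
  have n: "n > 0" using V by (simp add: n_def card_gt_0_iff)
  have I: "finite I" "card I = N" by (auto simp: I_def N_def)
  have fE: "finite E" unfolding E_def by (rule finite_index_pairs[OF I(1)])
  define block where "block x \<longleftrightarrow>
    (\<forall>s<k * M. \<forall>t<k * M. s div M < t div M \<longrightarrow> \<phi> (x s, x t) = \<kappa> (s div M, t div M))" for x
  define Bl where "Bl = {x\<in>PiE I (\<lambda>_. V). block x}"
  define NI where "NI = {x\<in>PiE I (\<lambda>_. V). \<not> inj_on x I}"
  define S where "S \<sigma> = {x\<in>PiE I (\<lambda>_. V). \<forall>e\<in>E. \<sigma> e \<in> \<phi> (pair_at x e)}" for \<sigma>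
  define Sel where "Sel = PiE E (\<lambda>_. R) - Good"
  have fX: "finite (PiE I (\<lambda>_. V))" using V I by (auto intro: finite_PiE)
  have fP: "finite (PiE E (\<lambda>_. R))" using R fE by (auto intro: finite_PiE)
  have ceN: "ce * n ^ (N - 1) = ce / n * n ^ N"
  proof (cases N)
    case 0
    then have "ce = 0" using I by (simp add: ce_def E_def card_index_pairs)
    then show ?thesis by simp
  qed (use n in simp)
  have NI: "real (card NI) \<le> ce / n * n ^ N"
    unfolding ceN[symmetric] using card_not_inj[OF V(1) I(1)] unfolding I(2) NI_def ce_def n_def E_def
    by (metis of_nat_le_iff of_nat_mult of_nat_power)
  have S: "real (card (S \<sigma>)) \<le> (1 / \<tau>) ^ card E * (ce * (1 / n + \<eta>) * n ^ N)" if \<sigma>: "\<sigma> \<in> Sel" for \<sigma>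
  proof -
    have \<sigma>R: "\<sigma> e \<in> R" if "e \<in> index_pairs I" for e using \<sigma> that by (auto simp: Sel_def E_def)
    have "{x\<in>PiE I (\<lambda>_. V). \<forall>e\<in>E. c (pair_at x e) = \<sigma> e} \<subseteq> NI"
      using noncopy[of \<sigma>] \<sigma> by (auto simp: NI_def Sel_def)
    then have "real (card {x\<in>PiE I (\<lambda>_. V). \<forall>e\<in>E. c (pair_at x e) = \<sigma> e}) \<le> real (card NI)"
      using fX by (intro of_nat_mono card_mono) (auto simp: NI_def)
    then have "\<tau> ^ card E * real (card (S \<sigma>)) \<le> ce / n * n ^ N + ce * \<eta> * n ^ N"
      using selection_count[where \<sigma> = \<sigma>, OF V(1) I(1) cut D less_imp_le[OF \<tau>] \<phi> \<sigma>R, folded E_def, folded S_def] NI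
      unfolding I(2) ce_def n_def by simp
    also have "\<dots> = ce * (1 / n + \<eta>) * n ^ N" by (simp add: algebra_simps)
    finally show ?thesis using \<tau> by (simp add: field_simps)
  qed
  have "\<alpha> ^ (M ^ k) * n ^ N \<le> real (card Bl)"
    using blowup_count[OF V M \<alpha> pop] unfolding Bl_def block_def I_def n_def N_def .
  also have "\<dots> \<le> real (card (NI \<union> (\<Union>\<sigma>\<in>Sel. S \<sigma>)))"
  proof (intro of_nat_mono card_mono)
    show "finite (NI \<union> (\<Union>\<sigma>\<in>Sel. S \<sigma>))"
      using fX fP by (auto simp: NI_def S_def Sel_def)
    show "Bl \<subseteq> NI \<union> (\<Union>\<sigma>\<in>Sel. S \<sigma>)"
    proof
      fix x assume x: "x \<in> Bl"
      show "x \<in> NI \<union> (\<Union>\<sigma>\<in>Sel. S \<sigma>)"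
      proof (cases "inj_on x I")
        case False
        then show ?thesis using x by (simp add: NI_def Bl_def)
      next
        case True
        have "\<not> (\<forall>\<sigma>\<in>PiE E (\<lambda>_. R). (\<forall>e\<in>E. \<sigma> e \<in> \<phi> (pair_at x e)) \<longrightarrow> \<sigma> \<in> Good)"
        proof
          assume "\<forall>\<sigma>\<in>PiE E (\<lambda>_. R). (\<forall>e\<in>E. \<sigma> e \<in> \<phi> (pair_at x e)) \<longrightarrow> \<sigma> \<in> Good"
          moreover have "x \<in> PiE I (\<lambda>_. V)" "block x"
            using x unfolding Bl_def by simp_all
          ultimately show False using neg True unfolding block_def[symmetric]
            by (elim notE) (intro bexI[of _ x] conjI)
        qed
        then obtain \<sigma> where "\<sigma> \<in> PiE E (\<lambda>_. R)" "\<forall>e\<in>E. \<sigma> e \<in> \<phi> (pair_at x e)" "\<sigma> \<notin> Good" by meson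
        then have "\<sigma> \<in> Sel" "x \<in> S \<sigma>" using x unfolding Sel_def S_def Bl_def by (simp_all only: mem_Collect_eq Diff_iff simp_thms)
        then show ?thesis by (intro UnI2 UN_I)
      qed
    qed
  qed
  also have "\<dots> \<le> real (card NI) + (\<Sum>\<sigma>\<in>Sel. real (card (S \<sigma>)))"
  proof -
    have "card (NI \<union> (\<Union>\<sigma>\<in>Sel. S \<sigma>)) \<le> card NI + card (\<Union>\<sigma>\<in>Sel. S \<sigma>)" by (rule card_Un_le)
    also have "card (\<Union>\<sigma>\<in>Sel. S \<sigma>) \<le> (\<Sum>\<sigma>\<in>Sel. card (S \<sigma>))"
      by (rule card_UN_le) (use fP in \<open>auto simp: Sel_def\<close>)
    finally show ?thesis by (metis add_le_cancel_left of_nat_add of_nat_le_iff of_nat_sum)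
  qed
  also have "\<dots> \<le> ce / n * n ^ N + (\<Sum>\<sigma>\<in>Sel. (1 / \<tau>) ^ card E * (ce * (1 / n + \<eta>) * n ^ N))"
    by (intro add_mono NI sum_mono S)
  also have "\<dots> \<le> ce / n * n ^ N + (\<Sum>\<sigma>\<in>PiE E (\<lambda>_. R). (1 / \<tau>) ^ card E * (ce * (1 / n + \<eta>) * n ^ N))"
    using fP n \<eta> \<tau>
    by (intro add_left_mono sum_mono2) (auto simp: Sel_def ce_def)
  also have "\<dots> = (ce / n + (real (card R) / \<tau>) ^ card E * ce * (1 / n + \<eta>)) * n ^ N"
    using fE by (simp add: card_PiE algebra_simps power_divide add_divide_distrib)
  also have "\<dots> < \<alpha> ^ (M ^ k) * n ^ N"
    using small n unfolding n_def ce_def by (intro mult_strict_right_mono) auto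
  finally show False by simp
qed

text \<open>A pattern \<kappa> on increasing pairs is symmetrised, and each loop gets a single
  colour. For r at least 2 such a loop is never the full colour set, so the condition on loops of a
  type holds.\<close>

definition block_type :: "nat \<Rightarrow> (nat \<Rightarrow> nat) \<Rightarrow> (nat \<times> nat \<Rightarrow> nat set) \<Rightarrow> nat rtype" where
  "block_type k \<rho> \<kappa> = ({..<k}, \<lambda>z\<in>{..<k} \<times> {..<k}.
     if fst z = snd z then {\<rho> (fst z)} else \<kappa> (min (fst z) (snd z), max (fst z) (snd z)))"

lemma fst_block_type [simp]: "fst (block_type k \<rho> \<kappa>) = {..<k}"
  by (simp add: block_type_def)

text \<open>The \<open>k\<close> diagonal entries are estimated by 1, which among k^2 entries costs
  only \<open>1 / k\<close>.\<close>

lemma f_block_type_le: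
  assumes k: "k > 0" and p: "\<And>i. i < k \<Longrightarrow> 0 \<le> p (\<rho> i)"
  shows "f_type (block_type k \<rho> \<kappa>) p
    \<le> 2 / real k ^ 2 * (\<Sum>e\<in>index_pairs {..<k}. 1 - (\<Sum>\<rho>\<in>\<kappa> e. p \<rho>)) + 1 / real k"
proof -
  define F where "F x y = type_matrix (block_type k \<rho> \<kappa>) p x y" for x y
  have Fsym: "F x y = F y x" if "x \<in> {..<k}" "y \<in> {..<k}" for x y
    using that by (auto simp: F_def type_matrix_def block_type_def min.commute max.commute)
  have "f_type (block_type k \<rho> \<kappa>) p = (\<Sum>x<k. \<Sum>y<k. F x y) / real k ^ 2"
    unfolding f_type_def quad_form_def F_def by (simp add: sum_divide_distrib power2_eq_square)
  also have "(\<Sum>x<k. \<Sum>y<k. F x y) = (\<Sum>x<k. F x x) + 2 * (\<Sum>e\<in>index_pairs {..<k}. F (fst e) (snd e))"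
    by (rule sum_square_symmetric[OF _ Fsym]) auto
  also have "(\<Sum>e\<in>index_pairs {..<k}. F (fst e) (snd e)) = (\<Sum>e\<in>index_pairs {..<k}. 1 - (\<Sum>\<rho>\<in>\<kappa> e. p \<rho>))"
    by (rule sum.cong) (auto simp: F_def type_matrix_def block_type_def index_pairs_def min_def max_def)
  also have "(\<Sum>x<k. F x x) \<le> (\<Sum>x<k. 1)"
    by (rule sum_mono) (use p in \<open>auto simp: F_def type_matrix_def block_type_def\<close>)
  finally have "f_type (block_type k \<rho> \<kappa>) p
     \<le> (real k + 2 * (\<Sum>e\<in>index_pairs {..<k}. 1 - (\<Sum>\<rho>\<in>\<kappa> e. p \<rho>))) / real k ^ 2"
    using k by (simp add: divide_right_mono)
  also have "\<dots> = 2 / real k ^ 2 * (\<Sum>e\<in>index_pairs {..<k}. 1 - (\<Sum>\<rho>\<in>\<kappa> e. p \<rho>)) + 1 / real k"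
    using k by (simp add: add_divide_distrib power2_eq_square)
  finally show ?thesis .
qed

text \<open>Ramsey's theorem in each block finds \<open>m\<close> copies whose pairs share one
  palette, and any colour of it can serve as loop colour. An r-graph with at most \<open>m\<close>
  vertices that embeds in the type can then be laid out on distinct selected copies so that all its
  colours are available. Completed to a selection on the whole blow-up it becomes an induced copy
  inside a member of the property.\<close>

lemma block_type_of_blowup:
  fixes \<H> :: "nat rgraph set" and \<Phi> :: "nat \<Rightarrow> nat \<Rightarrow> nat set"
  assumes r: "r \<ge> 2" and her: "hereditary r \<H>" and M: "M > 0"
    and ram: "\<forall>f \<in> nsets {..<M} 2 \<rightarrow> Pow {1..r} - {{}}. \<exists>Y\<in>nsets {..<M} m. \<exists>q\<in>Pow {1..r} - {{}}. \<forall>e\<in>nsets Y 2. f e = q"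
    and \<Phi>: "\<And>s t. s < k * M \<Longrightarrow> t < k * M \<Longrightarrow> \<Phi> s t \<in> Pow {1..r} - {{}}"
    and pat: "\<And>s t. s < k * M \<Longrightarrow> t < k * M \<Longrightarrow> s div M < t div M \<Longrightarrow> \<Phi> s t = \<kappa> (s div M, t div M)"
    and sel: "\<And>\<sigma>. \<sigma> \<in> PiE (index_pairs {..<k * M}) (\<lambda>_. {1..r}) \<Longrightarrow>
      (\<And>e. e \<in> index_pairs {..<k * M} \<Longrightarrow> \<sigma> e \<in> \<Phi> (fst e) (snd e)) \<Longrightarrow>
      ({..<k * M}, \<lambda>d\<in>nsets {..<k * M} 2. \<sigma> (Min d, Max d)) \<in> \<H>"
    and k: "k > 0"
  shows "\<exists>\<rho>. (\<forall>i<k. \<rho> i \<in> {1..r}) \<and> block_type k \<rho> \<kappa> \<in> rtypes r \<and>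
    (\<forall>H\<in>rgraphs r. card (verts H) \<le> m \<longrightarrow> embeds H (block_type k \<rho> \<kappa>) \<longrightarrow> H \<in> \<H>)"
proof -
  define R where "R = {1..r}"
  have pos: "i * M + a < k * M" if "i < k" "a < M" for i a
  proof -
    have "i * M + a < Suc i * M" using that by simp
    also have "\<dots> \<le> k * M" using that by (intro mult_right_mono) auto
    finally show ?thesis .
  qed
  have \<kappa>: "\<kappa> (i, j) \<in> Pow R - {{}}" if "i < j" "j < k" for i j
    using \<Phi>[of "i * M" "j * M"] pat[of "i * M" "j * M"] pos[of i 0] pos[of j 0] that M by (simp add: R_def)
  have "\<exists>Y\<in>nsets {..<M} m. \<exists>q\<in>Pow R - {{}}. \<forall>e\<in>nsets Y 2. \<Phi> (i * M + Min e) (i * M + Max e) = q" if i: "i < k" for i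
  proof -
    have "(\<lambda>e. \<Phi> (i * M + Min e) (i * M + Max e)) \<in> nsets {..<M} 2 \<rightarrow> Pow R - {{}}"
    proof
      fix e assume "e \<in> nsets {..<M} 2"
      then obtain a b where "e = {a, b}" "a < M" "b < M" by (auto elim: nsets2_E)
      then have "Min e < M" "Max e < M" by auto
      then show "\<Phi> (i * M + Min e) (i * M + Max e) \<in> Pow R - {{}}"
        unfolding R_def by (intro \<Phi> pos i)
    qed
    then show ?thesis using ram by (simp add: R_def)
  qed
  then obtain Y q where Y: "\<And>i. i < k \<Longrightarrow> Y i \<in> nsets {..<M} m" and q: "\<And>i. i < k \<Longrightarrow> q i \<in> Pow R - {{}}"
    and Yq: "\<And>i e. i < k \<Longrightarrow> e \<in> nsets (Y i) 2 \<Longrightarrow> \<Phi> (i * M + Min e) (i * M + Max e) = q i"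
    by metis
  have "\<exists>\<rho>. \<forall>i. i < k \<longrightarrow> \<rho> i \<in> q i"
    by (rule choice) (use q in blast)
  then obtain \<rho> where \<rho>: "\<And>i. i < k \<Longrightarrow> \<rho> i \<in> q i" by blast
  have \<rho>R: "\<rho> i \<in> R" if "i < k" for i using \<rho>[OF that] q[OF that] by blast
  have "\<exists>y. \<forall>i. i < k \<longrightarrow> bij_betw (y i) {..<m} (Y i)"
  proof (rule choice, intro allI)
    fix i
    show "\<exists>y. i < k \<longrightarrow> bij_betw y {..<m} (Y i)"
    proof (cases "i < k")
      case True
      then have "finite (Y i)" "card (Y i) = m" using Y[OF True] by (auto simp: nsets_def)
      then show ?thesis using ex_bij_betw_nat_finite[of "Y i"] by (auto simp: atLeast0LessThan)
    qed simp
  qed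
  then obtain y where y: "\<And>i. i < k \<Longrightarrow> bij_betw (y i) {..<m} (Y i)" by blast
  have yM: "y i a < M" "y i a \<in> Y i" if "i < k" "a < m" for i a
  proof -
    show "y i a \<in> Y i" using y[OF that(1)] that(2) by (auto simp: bij_betw_def)
    then show "y i a < M" using Y[OF that(1)] by (auto simp: nsets_def)
  qed
  let ?K = "block_type k \<rho> \<kappa>"
  have K: "?K \<in> rtypes r"
  proof -
    have "snd ?K (x, y) = snd ?K (y, x)" if "x < k" "y < k" for x y
      using that by (auto simp: block_type_def min.commute max.commute)
    moreover have "snd ?K \<in> {..<k} \<times> {..<k} \<rightarrow>\<^sub>E Pow {1..r} - {{}}"
    proof (rule PiE_I)
      fix z assume "z \<in> {..<k} \<times> {..<k}"
      then obtain i j where z: "z = (i, j)" "i < k" "j < k" by auto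
      show "snd ?K z \<in> Pow {1..r} - {{}}"
      proof (cases "i = j")
        case True
        then show ?thesis using z \<rho>R[of i] by (simp add: block_type_def R_def)
      next
        case False
        then have "snd ?K z = \<kappa> (min i j, max i j)" using z by (simp add: block_type_def)
        then show ?thesis using \<kappa>[of "min i j" "max i j"] False z unfolding R_def by simp
      qed
    qed (auto simp: block_type_def)
    moreover have "{\<rho> x} \<noteq> {1..r}" for x
    proof
      assume "{\<rho> x} = {1..r}"
      then have "card {1..r} = 1" by (metis card.empty card.insert empty_iff finite.emptyI One_nat_def)
      then show False using r by simp
    qed
    then have "snd ?K (x, x) \<noteq> {1..r}" if "x < k" for x using that by (simp add: block_type_def)
    ultimately show ?thesis using k unfolding rtypes_def
      by (auto simp: case_prod_beta)
  qed
  have "H \<in> \<H>" if H: "H \<in> rgraphs r" "card (verts H) \<le> m" "embeds H ?K" for H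
  proof -
    obtain \<gamma> where \<gamma>: "\<And>v. v \<in> verts H \<Longrightarrow> \<gamma> v < k"
      and col: "\<And>v v'. v \<in> verts H \<Longrightarrow> v' \<in> verts H \<Longrightarrow> v \<noteq> v' \<Longrightarrow> colour H {v, v'} \<in> snd ?K (\<gamma> v, \<gamma> v')"
      using H(3) unfolding embeds_def by auto
    have fH: "finite (verts H)" using H(1) by (auto simp: rgraphs_def verts_def)
    obtain \<iota> where \<iota>: "inj_on \<iota> (verts H)" "\<iota> ` verts H \<subseteq> {..<m}"
      using inj_on_iff_card_le[OF fH, of "{..<m}"] H(2) by auto
    \<comment> \<open>\<iota> numbers all vertices of \<open>H\<close> by distinct numbers below
      \<open>m\<close>, so two vertices in the same block occupy different selected copies.\<close>
    define pl where "pl v = \<gamma> v * M + y (\<gamma> v) (\<iota> v)" for v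
    have \<iota>m: "\<iota> v < m" if "v \<in> verts H" for v using \<iota> that by auto
    have pl_div: "pl v div M = \<gamma> v" and pl_mod: "pl v mod M = y (\<gamma> v) (\<iota> v)" if "v \<in> verts H" for v
      using yM(1)[OF \<gamma>[OF that] \<iota>m[OF that]] by (auto simp: pl_def)
    have pl_lt: "pl v < k * M" if "v \<in> verts H" for v
      unfolding pl_def using that \<gamma> \<iota>m yM by (intro pos) auto
    have pl_inj: "inj_on pl (verts H)"
    proof (rule inj_onI)
      fix v w assume v: "v \<in> verts H" and w: "w \<in> verts H" and eq: "pl v = pl w"
      then have g: "\<gamma> v = \<gamma> w" and "y (\<gamma> v) (\<iota> v) = y (\<gamma> w) (\<iota> w)"
        using pl_div pl_mod by metis+
      then have "\<iota> v = \<iota> w"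
        using y[OF \<gamma>[OF v]] \<iota>m v w by (auto simp: bij_betw_def inj_on_def)
      then show "v = w" using \<iota> v w by (auto simp: inj_on_def)
    qed
    define E where "E = index_pairs {..<k * M}"
    define ip where "ip = the_inv_into (verts H) pl"
    have ip: "ip (pl v) = v" if "v \<in> verts H" for v
      unfolding ip_def by (rule the_inv_into_f_f[OF pl_inj that])
    \<comment> \<open>Pairs outside the image of \<open>H\<close> take any available colour; this is
      possible because the colour sets are nonempty.\<close>
    define \<sigma> where "\<sigma> = (\<lambda>e\<in>E. if fst e \<in> pl ` verts H \<and> snd e \<in> pl ` verts H
      then colour H {ip (fst e), ip (snd e)} else SOME \<rho>. \<rho> \<in> \<Phi> (fst e) (snd e))"
    have sel1: "\<sigma> e \<in> \<Phi> (fst e) (snd e)" if e: "e \<in> E" for e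
    proof (cases "fst e \<in> pl ` verts H \<and> snd e \<in> pl ` verts H")
      case True
      then obtain v w where v: "v \<in> verts H" "fst e = pl v" and w: "w \<in> verts H" "snd e = pl w" by auto
      have lt: "pl v < pl w" using e v w by (simp add: E_def index_pairs_def)
      then have vw: "v \<noteq> w" by auto
      have \<sigma>e: "\<sigma> e = colour H {v, w}" using True e v w ip by (simp add: \<sigma>_def)
      have le: "\<gamma> v \<le> \<gamma> w" using div_le_mono[of "pl v" "pl w" M] lt v w by (simp add: pl_div)
      show ?thesis
      proof (cases "\<gamma> v = \<gamma> w")
        case True
        let ?a = "y (\<gamma> v) (\<iota> v)" and ?b = "y (\<gamma> v) (\<iota> w)"
        have ab: "?a < ?b" using lt True by (simp add: pl_def)
        have "colour H {v, w} = \<rho> (\<gamma> v)"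
          using col[OF v(1) w(1) vw] True \<gamma>[OF v(1)] by (simp add: block_type_def)
        also have "\<rho> (\<gamma> v) \<in> q (\<gamma> v)" by (rule \<rho>[OF \<gamma>[OF v(1)]])
        also have "q (\<gamma> v) = \<Phi> (\<gamma> v * M + Min {?a, ?b}) (\<gamma> v * M + Max {?a, ?b})"
          using yM(2)[OF \<gamma>[OF v(1)] \<iota>m[OF v(1)]] yM(2)[OF \<gamma>[OF v(1)] \<iota>m[OF w(1)]] ab
          by (intro Yq[symmetric] \<gamma> v) auto
        also have "\<dots> = \<Phi> (fst e) (snd e)" using ab v w True by (simp add: pl_def)
        finally show ?thesis unfolding \<sigma>e .
      next
        case False
        then have l: "\<gamma> v < \<gamma> w" using le by simp
        have "colour H {v, w} \<in> \<kappa> (\<gamma> v, \<gamma> w)"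
          using col[OF v(1) w(1) vw] l \<gamma>[OF v(1)] \<gamma>[OF w(1)] by (simp add: block_type_def)
        also have "\<kappa> (\<gamma> v, \<gamma> w) = \<Phi> (pl v) (pl w)"
          using pat[OF pl_lt[OF v(1)] pl_lt[OF w(1)]] l pl_div[OF v(1)] pl_div[OF w(1)] by simp
        finally show ?thesis unfolding \<sigma>e using v w by simp
      qed
    next
      case False
      have "fst e < k * M" "snd e < k * M" using e by (auto simp: E_def index_pairs_def)
      then have "\<Phi> (fst e) (snd e) \<noteq> {}" using \<Phi> by blast
      moreover have "\<sigma> e = (SOME \<rho>. \<rho> \<in> \<Phi> (fst e) (snd e))"
        unfolding \<sigma>_def restrict_apply'[OF e] by (rule if_not_P[OF False])
      ultimately show ?thesis by (simp add: some_in_eq)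
    qed
    have \<sigma>P: "\<sigma> \<in> PiE E (\<lambda>_. {1..r})"
    proof (rule PiE_I)
      fix e assume e: "e \<in> E"
      have "fst e < k * M" "snd e < k * M" using e by (auto simp: E_def index_pairs_def)
      then have "\<Phi> (fst e) (snd e) \<subseteq> {1..r}" using \<Phi> by blast
      then show "\<sigma> e \<in> {1..r}" using sel1[OF e] by blast
    qed (simp add: \<sigma>_def)
    define G where "G = ({..<k * M}, \<lambda>d\<in>nsets {..<k * M} 2. \<sigma> (Min d, Max d))"
    have G: "G \<in> \<H>" unfolding G_def by (rule sel) (use \<sigma>P sel1 in \<open>auto simp: E_def\<close>)
    show ?thesis
    proof (rule induced_copy_mem[OF her G H(1) pl_inj])
      show "pl ` verts H \<subseteq> verts G" using pl_lt by (auto simp: G_def verts_def)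
      fix d assume "d \<in> nsets (verts H) 2"
      then obtain v0 w0 where vw0: "d = {v0, w0}" "v0 \<in> verts H" "w0 \<in> verts H" "v0 \<noteq> w0" by (auto elim: nsets2_E)
      then have "pl v0 \<noteq> pl w0" using pl_inj by (auto simp: inj_on_def)
      then obtain v w where vw: "d = {v, w}" "v \<in> verts H" "w \<in> verts H" "pl v < pl w"
        using vw0 by (metis insert_commute linorder_neqE_nat)
      have "colour G (pl ` d) = \<sigma> (pl v, pl w)"
        using vw pl_lt by (simp add: G_def colour_def)
      also have "\<dots> = colour H d"
        using vw pl_lt ip by (auto simp: \<sigma>_def E_def index_pairs_def)
      finally show "colour G (pl ` d) = colour H d" .
    qed
  qed
  then show ?thesis using K \<rho>R unfolding R_def by blast
qed

text \<open>Pairs are ordered, so an edge inside both \<open>A\<close> and \<open>B\<close> counts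
  twice. The product of the two sizes also counts the diagonal, an error of order n that the
  tolerance absorbs for large n.\<close>

definition quasirandom :: "nat \<Rightarrow> (nat \<Rightarrow> real) \<Rightarrow> real \<Rightarrow> nat rgraph \<Rightarrow> bool" where
  "quasirandom r p \<delta> G \<longleftrightarrow> (\<forall>\<rho>\<in>{1..r}. \<forall>A B. A \<subseteq> verts G \<longrightarrow> B \<subseteq> verts G \<longrightarrow>
     \<bar>real (card {z\<in>A \<times> B. fst z \<noteq> snd z \<and> colour G {fst z, snd z} = \<rho>})
        - p \<rho> * real (card A) * real (card B)\<bar> \<le> \<delta> * real (card (verts G)) ^ 2)"

lemma density_vectorsD:
  assumes "p \<in> density_vectors r"
  shows "\<rho> \<in> {1..r} \<Longrightarrow> 0 \<le> p \<rho>" "(\<Sum>\<rho>\<in>{1..r}. p \<rho>) = 1" "\<rho> \<in> {1..r} \<Longrightarrow> p \<rho> \<le> 1"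
proof -
  show 1: "0 \<le> p \<rho>" if "\<rho> \<in> {1..r}" for \<rho> using assms that by (auto simp: density_vectors_def PiE_iff)
  show 2: "(\<Sum>\<rho>\<in>{1..r}. p \<rho>) = 1" using assms by (simp add: density_vectors_def)
  show "p \<rho> \<le> 1" if "\<rho> \<in> {1..r}"
    using member_le_sum[OF that, of p] 1 2 by auto
qed

lemma sum_density_subset_le_1:
  assumes "p \<in> density_vectors r" "A \<subseteq> {1..r}"
  shows "0 \<le> (\<Sum>\<rho>\<in>A. p \<rho>)" "(\<Sum>\<rho>\<in>A. p \<rho>) \<le> 1"
proof -
  show "0 \<le> (\<Sum>\<rho>\<in>A. p \<rho>)" using assms density_vectorsD(1)[OF assms(1)] by (intro sum_nonneg) auto
  have "(\<Sum>\<rho>\<in>A. p \<rho>) \<le> (\<Sum>\<rho>\<in>{1..r}. p \<rho>)"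
    using assms density_vectorsD(1)[OF assms(1)] by (intro sum_mono2) auto
  then show "(\<Sum>\<rho>\<in>A. p \<rho>) \<le> 1" using density_vectorsD(2)[OF assms(1)] by simp
qed

lemma card_edit_le:
  fixes G G' :: "nat rgraph"
  assumes "finite (verts G)"
  shows "real (card {e\<in>nsets (verts G) 2. colour G e \<noteq> colour G' e}) = edit_dist G G' * real (card (verts G) choose 2)"
proof (cases "card (verts G) choose 2 = 0")
  case True
  then have "nsets (verts G) 2 = {}" using assms by (simp add: nsets_eq_empty)
  then show ?thesis using True by simp
qed (simp add: edit_dist_def)

lemma edit_dist_nonneg: "0 \<le> edit_dist G G'"
  by (simp add: edit_dist_def)

text \<open>With e' = \<epsilon>/4, an error e' each is spent on the colours of density below
  \<tau>, on the discrepancy of \<open>G\<close> over all pairs of cells, and on passing from the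
  mean cost to a popular pattern. The diagonal adds \<open>1 / k\<close>.\<close>

lemma type_extraction:
  fixes \<H> :: "nat rgraph set"
  assumes r: "r \<ge> 2" and her: "hereditary r \<H>" and p: "p \<in> density_vectors r" and \<epsilon>: "\<epsilon> > 0" and k: "k > 0"
  shows "\<exists>\<delta>>0. \<exists>n0. \<forall>G\<in>rgraphs r. \<forall>G'\<in>\<H>. verts G' = verts G \<longrightarrow> n0 \<le> card (verts G) \<longrightarrow> quasirandom r p \<delta> G \<longrightarrow>
    (\<exists>\<rho> \<kappa>. block_type k \<rho> \<kappa> \<in> rtypes r
      \<and> (\<forall>H\<in>rgraphs r. card (verts H) \<le> m \<longrightarrow> embeds H (block_type k \<rho> \<kappa>) \<longrightarrow> H \<in> \<H>)
      \<and> f_type (block_type k \<rho> \<kappa>) p \<le> edit_dist G G' + \<epsilon> + 1 / real k)"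
proof -
  define R where "R = {1..r}"
  have R: "finite R" "card R = r" "1 \<in> R" using r by (auto simp: R_def)
  have PR: "finite (Pow R - {{}})" "Pow R - {{}} \<noteq> {}" using R by auto
  obtain M :: nat where M: "M > 0" and ram: "\<forall>f \<in> nsets {..<M} 2 \<rightarrow> Pow R - {{}}.
      \<exists>Y\<in>nsets {..<M} m. \<exists>q\<in>Pow R - {{}}. \<forall>e\<in>nsets Y 2. f e = q"
    using ramsey_palette[OF PR, of m] by blast
  define I where "I = {..<k * M}"
  define ce where "ce = card (index_pairs I)"
  define Ek where "Ek = index_pairs {..<k}"
  define Y where "Y = PiE Ek (\<lambda>_. Pow R)"
  have fEk: "finite Ek" by (simp add: Ek_def finite_index_pairs)
  have Y: "finite Y" "Y \<noteq> {}" unfolding Y_def using R fEk by (auto intro: finite_PiE simp: PiE_eq_empty_iff)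
  define q where "q = real (card Y)"
  have q: "q > 0" using Y by (simp add: q_def card_gt_0_iff)
  define e' where "e' = \<epsilon> / 4"
  \<comment> \<open>The first bound limits the loss from rare colours to e' in total. The second
    makes all colour sets nonempty: the r densities on a pair of cells sum to 1, so one of them is
    at least 1/r.\<close>
  define \<tau> where "\<tau> = min (e' / real r) (1 / real r)"
  have e': "e' > 0" and \<tau>: "\<tau> > 0" "\<tau> \<le> 1 / real r" "real r * \<tau> \<le> e'"
    using \<epsilon> r by (auto simp: e'_def \<tau>_def min_def field_simps)
  \<comment> \<open>Chosen so that \<alpha> q (1 + e') is e'/2, which is below e' as
    \<open>popular_cheap_value\<close> demands; the mean cost is at most 1.\<close>
  define \<alpha> where "\<alpha> = e' / (2 * q * (1 + e'))"
  have \<alpha>: "\<alpha> > 0" using e' q by (simp add: \<alpha>_def)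
  define \<beta> where "\<beta> = \<alpha> ^ (M ^ k)"
  have \<beta>: "\<beta> > 0" using \<alpha> by (simp add: \<beta>_def)
  define c0 where "c0 = (real r / \<tau>) ^ ce * real ce"
  have c0: "c0 \<ge> 0" using \<tau> by (simp add: c0_def)
  \<comment> \<open>\<open>c0\<close> collects the factors that the union over bad selections puts
    in front of \<open>1 / n + \<eta>\<close>. This \<eta> uses at most a quarter of \<beta>, and
    \<open>n0\<close> keeps the terms with \<open>1 / n\<close> below a half.\<close>
  define \<eta> where "\<eta> = \<beta> / (4 * (c0 + 1))"
  have \<eta>: "\<eta> > 0" "c0 * \<eta> \<le> \<beta> / 4" using \<beta> c0 by (auto simp: \<eta>_def field_simps)
  obtain s where s: "real r / \<eta>\<^sup>2 < real s" using reals_Archimedean2 by blast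
  then have s: "real s * \<eta>\<^sup>2 > real (card R)" using \<eta> R by (simp add: field_simps)
  \<comment> \<open>There are at most 2^(2s) = 4^s cells, two bits per refinement. Then \<delta> is
    such that the discrepancies of all T^2 pairs of cells and r colours add up to e'.\<close>
  define T :: nat where "T = 4 ^ s"
  have T: "T > 0" by (simp add: T_def)
  define \<delta> where "\<delta> = e' / (real r * real (T ^ 2))"
  have \<delta>: "\<delta> > 0" "real r * (real (T ^ 2) * \<delta>) = e'" using e' T r by (auto simp: \<delta>_def)
  obtain n0 where n0: "2 * (real ce + c0) / \<beta> < real n0" using reals_Archimedean2 by blast
  have main: "\<exists>\<rho> \<kappa>. block_type k \<rho> \<kappa> \<in> rtypes r
      \<and> (\<forall>H\<in>rgraphs r. card (verts H) \<le> m \<longrightarrow> embeds H (block_type k \<rho> \<kappa>) \<longrightarrow> H \<in> \<H>)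
      \<and> f_type (block_type k \<rho> \<kappa>) p \<le> edit_dist G G' + \<epsilon> + 1 / real k"
    if G: "G \<in> rgraphs r" and G': "G' \<in> \<H>" and VG: "verts G' = verts G" and n: "n0 \<le> card (verts G)"
      and qr: "quasirandom r p \<delta> G" for G G'
  proof -
    define V where "V = verts G"
    define n where "n = real (card V)"
    have "0 \<le> 2 * (real ce + c0) / \<beta>" using c0 \<beta> by simp
    then have n0': "0 < real n0" using n0 by linarith
    have nn: "real n0 \<le> n" using n by (simp add: n_def V_def)
    then have n: "n > 0" using n0' by linarith
    then have V: "finite V" "V \<noteq> {}" by (auto simp: n_def card_gt_0_iff)
    have G'r: "G' \<in> rgraphs r" using her G' by (auto simp: hereditary_def)
    have colR: "colour G e \<in> R" "colour G' e \<in> R" if "e \<in> nsets V 2" for e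
      using G G'r that VG by (auto simp: rgraphs_def colour_def verts_def R_def V_def PiE_iff)
    \<comment> \<open>Colouring the diagonal makes the colour densities of every pair of cells sum up to 1,
      also for the pairs of a cell with itself.\<close>
    define b where "b z = (if fst z = snd z then 1 else colour G {fst z, snd z})" for z
    define c where "c z = (if fst z = snd z then 1 else colour G' {fst z, snd z})" for z
    have b: "b z \<in> R" and c: "c z \<in> R" if "z \<in> V \<times> V" for z
      using colR[of "{fst z, snd z}"] that R by (auto simp: b_def c_def)
    obtain t P where t: "t \<le> s" and P: "P \<in> V \<rightarrow> {l :: bool list. length l = 2 * t}"
      and cut: "\<And>\<rho>. \<rho> \<in> R \<Longrightarrow> cut_bounded V (\<eta> * (real (card V))\<^sup>2)
        (\<lambda>z. of_bool (c z = \<rho>) - cond_mean (V \<times> V) (pair_label P) (\<lambda>z. of_bool (c z = \<rho>)) z)"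
      using weak_regularity[OF V(1) R(1) _ \<eta>(1) s V(2), of "\<lambda>\<rho> z. of_bool (c z = \<rho>)"] by auto
    define L where "L = {l :: bool list. length l = 2 * t}"
    have "L = {l. set l \<subseteq> UNIV \<and> length l = 2 * t}" by (simp add: L_def)
    then have L: "finite L" "card L = 2 ^ (2 * t)"
      using finite_lists_length_eq[of "UNIV :: bool set"] card_lists_length_eq[of "UNIV :: bool set"] by auto
    have LT: "card L \<le> T" unfolding L T_def power_mult using t by (simp add: power_increasing)
    define D where "D \<rho> = cond_mean (V \<times> V) (pair_label P) (\<lambda>z. of_bool (c z = \<rho>))" for \<rho>
    have D: "0 \<le> D \<rho> z" "D \<rho> z \<le> 1" for \<rho> z
      unfolding D_def using V by (auto intro!: cond_mean_bounds)
    define \<phi> where "\<phi> z = {\<rho>\<in>R. \<tau> \<le> D \<rho> z}" for z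
    have \<phi>: "\<phi> z \<in> Pow R - {{}}" if z: "z \<in> V \<times> V" for z
    proof -
      define C where "C = {z' \<in> V \<times> V. pair_label P z' = pair_label P z}"
      have C: "finite C" "card C > 0" using V z by (auto simp: C_def card_gt_0_iff)
      have "(\<Sum>\<rho>\<in>R. D \<rho> z) = (\<Sum>z'\<in>C. \<Sum>\<rho>\<in>R. of_bool (c z' = \<rho>)) / real (card C)"
        unfolding D_def cond_mean_def C_def[symmetric] sum_divide_distrib[symmetric] by (subst sum.swap) (rule refl)
      also have "(\<Sum>z'\<in>C. \<Sum>\<rho>\<in>R. of_bool (c z' = \<rho>)) = (\<Sum>z'\<in>C. 1::real)"
      proof (rule sum.cong[OF refl])
        fix z' assume "z' \<in> C"
        then have "c z' \<in> R" by (intro c) (simp add: C_def)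
        then show "(\<Sum>\<rho>\<in>R. of_bool (c z' = \<rho>)) = (1::real)" using R by (simp add: of_bool_def sum.delta)
      qed
      finally have S: "(\<Sum>\<rho>\<in>R. D \<rho> z) = 1" using C by auto
      have "\<phi> z \<noteq> {}"
      proof
        assume "\<phi> z = {}"
        then have "(\<Sum>\<rho>\<in>R. D \<rho> z) < (\<Sum>\<rho>\<in>R. 1 / real r)"
          using R \<tau> by (intro sum_strict_mono) (force simp: \<phi>_def)+
        then show False using S R r by simp
      qed
      then show ?thesis by (auto simp: \<phi>_def)
    qed
    define w where "w A = 1 - (\<Sum>\<rho>\<in>A. p \<rho>)" for A
    have w: "0 \<le> w A" "w A \<le> 1" if "A \<subseteq> R" for A
      using sum_density_subset_le_1[OF p] that by (auto simp: w_def R_def)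
    have \<phi>R: "\<phi> z \<subseteq> R" for z by (auto simp: \<phi>_def)
    have quasi: "p \<rho> * real (card (A \<times> B)) \<le> real (card {z\<in>A \<times> B. b z = \<rho>}) + \<delta> * n ^ 2"
      if \<rho>: "\<rho> \<in> R" and AB: "A \<subseteq> V" "B \<subseteq> V" for \<rho> A B
    proof -
      have fin: "finite (A \<times> B)" using AB V finite_subset by blast
      have "\<bar>real (card {z\<in>A \<times> B. fst z \<noteq> snd z \<and> colour G {fst z, snd z} = \<rho>})
          - p \<rho> * real (card A) * real (card B)\<bar> \<le> \<delta> * n ^ 2"
        using qr \<rho> AB unfolding quasirandom_def R_def V_def[symmetric] n_def[symmetric] by blast
      then have "p \<rho> * real (card (A \<times> B)) \<le> real (card {z\<in>A \<times> B. fst z \<noteq> snd z \<and> colour G {fst z, snd z} = \<rho>}) + \<delta> * n ^ 2"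
        by (simp add: card_cartesian_product abs_le_iff mult.assoc)
      also have "card {z\<in>A \<times> B. fst z \<noteq> snd z \<and> colour G {fst z, snd z} = \<rho>} \<le> card {z\<in>A \<times> B. b z = \<rho>}"
        using fin by (intro card_mono) (auto simp: b_def)
      finally show ?thesis by simp
    qed
    have "(\<Sum>z\<in>V \<times> V. w (\<phi> z)) \<le> real (card {z\<in>V \<times> V. b z \<noteq> c z})
        + real (card R) * (\<tau> * real (card V ^ 2) + real (T ^ 2) * (\<delta> * n ^ 2))"
      unfolding w_def
      by (rule reduced_type_cost[OF V(1) R(1) _ P[folded L_def] L(1) LT b c quasi _ _ D_def \<phi>_def])
        (use density_vectorsD(2)[OF p] \<delta> \<tau> n in \<open>auto simp: R_def\<close>)
    also have "card {z\<in>V \<times> V. b z \<noteq> c z} = 2 * card {e\<in>nsets V 2. colour G e \<noteq> colour G' e}"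
      unfolding card_offdiag[OF V(1), symmetric] by (rule arg_cong[of _ _ card]) (auto simp: b_def c_def)
    also have "real (2 * card {e\<in>nsets V 2. colour G e \<noteq> colour G' e}) \<le> edit_dist G G' * n ^ 2"
    proof -
      have "real (2 * card {e\<in>nsets V 2. colour G e \<noteq> colour G' e}) = edit_dist G G' * (2 * real (card V choose 2))"
        using card_edit_le[of G G'] V by (simp add: V_def)
      also have "\<dots> \<le> edit_dist G G' * n ^ 2"
        unfolding n_def by (intro mult_left_mono two_choose_two_le edit_dist_nonneg)
      finally show ?thesis .
    qed
    also have "edit_dist G G' * n ^ 2 + real (card R) * (\<tau> * real (card V ^ 2) + real (T ^ 2) * (\<delta> * n ^ 2))
       = (edit_dist G G' + real r * \<tau> + real r * (real (T ^ 2) * \<delta>)) * n ^ 2"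
      using R by (simp add: n_def algebra_simps)
    also have "\<dots> \<le> (edit_dist G G' + e' + e') * n ^ 2"
      using \<tau> \<delta> by (intro mult_right_mono) auto
    finally have "(\<Sum>z\<in>V \<times> V. w (\<phi> z)) \<le> (edit_dist G G' + 2 * e') * n ^ 2" by (simp add: add_ac)
    then have m1: "mean (V \<times> V) (\<lambda>z. w (\<phi> z)) \<le> edit_dist G G' + 2 * e'"
      using n by (simp add: mean_def card_cartesian_product n_def divide_le_eq power2_eq_square)
    define m1 where "m1 = mean (V \<times> V) (\<lambda>z. w (\<phi> z))"
    have m1': "0 \<le> m1" "m1 \<le> 1"
    proof -
      show "0 \<le> m1" unfolding m1_def by (intro mean_nonneg w \<phi>R)
      have "m1 \<le> mean (V \<times> V) (\<lambda>_. 1)" unfolding m1_def by (intro mean_mono w \<phi>R)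
      also have "\<dots> = 1" using V by (simp add: mean_def card_cartesian_product)
      finally show "m1 \<le> 1" .
    qed
    define X where "X = PiE {..<k} (\<lambda>_. V)"
    have X: "finite X" "X \<noteq> {}" "card X = card V ^ k"
      using V by (auto simp: X_def PiE_eq_empty_iff card_PiE intro!: finite_PiE)
    define pat where "pat x = (\<lambda>e\<in>Ek. \<phi> (pair_at x e))" for x :: "nat \<Rightarrow> nat"
    define cost where "cost \<kappa> = 2 / real k ^ 2 * (\<Sum>e\<in>Ek. w (\<kappa> e))" for \<kappa> :: "nat \<times> nat \<Rightarrow> nat set"
    have "mean X (\<lambda>x. cost (pat x)) = 2 / real k ^ 2 * (\<Sum>e\<in>Ek. mean X (\<lambda>x. w (\<phi> (pair_at x e))))"
      unfolding mean_def cost_def pat_def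
      by (simp add: sum_divide_distrib[symmetric] sum_distrib_left[symmetric] sum.swap[of _ X Ek])
    also have "(\<Sum>e\<in>Ek. mean X (\<lambda>x. w (\<phi> (pair_at x e)))) = (\<Sum>e\<in>Ek. m1)"
      unfolding X_def m1_def by (intro sum.cong refl mean_pair V) (auto simp: Ek_def index_pairs_def)
    also have "2 / real k ^ 2 * (\<Sum>e\<in>Ek. m1) = (2 * real (k choose 2) / real k ^ 2) * m1"
      by (simp add: Ek_def card_index_pairs)
    also have "\<dots> \<le> 1 * m1"
      using two_choose_two_le[of k] k m1' by (intro mult_right_mono) (auto simp: divide_le_eq)
    finally have mX: "mean X (\<lambda>x. cost (pat x)) \<le> m1" by simp
    have "\<alpha> * q * (m1 + e') \<le> \<alpha> * q * (1 + e')" using \<alpha> q m1' by (intro mult_left_mono) auto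
    also have "\<dots> = e' / 2"
    proof -
      have "2 * (q * (1 + e')) \<noteq> 0" using e' q by simp
      then have "\<alpha> * (2 * (q * (1 + e'))) = e'" by (simp add: \<alpha>_def)
      then show ?thesis by simp
    qed
    also have "\<dots> < e'" using e' by simp
    finally have \<alpha>q: "\<alpha> * q * (m1 + e') < e'" .
    have "\<exists>\<kappa>\<in>Y. cost \<kappa> \<le> m1 + e' \<and> \<alpha> * real (card X) \<le> real (card {x\<in>X. pat x = \<kappa>})"
    proof (rule popular_cheap_value[where f = pat and cost = cost, OF X(1,2) Y(1) _ _ mX])
      show "pat ` X \<subseteq> Y" by (auto simp: pat_def Y_def \<phi>_def)
      show "0 \<le> cost \<kappa>" if "\<kappa> \<in> Y" for \<kappa>
        unfolding cost_def using that by (intro mult_nonneg_nonneg sum_nonneg w) (auto simp: Y_def)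
    qed (use \<alpha>q \<alpha> m1' e' in \<open>auto simp: q_def\<close>)
    then obtain \<kappa> where \<kappa>: "\<kappa> \<in> Y" "cost \<kappa> \<le> m1 + e'" and pop: "\<alpha> * real (card X) \<le> real (card {x\<in>X. pat x = \<kappa>})"
      by blast
    have pop': "\<alpha> * real (card V) ^ k \<le> real (card {x\<in>PiE {..<k} (\<lambda>_. V).
        \<forall>e\<in>index_pairs {..<k}. \<phi> (pair_at x e) = \<kappa> e})"
    proof -
      have "card {x\<in>X. pat x = \<kappa>} \<le> card {x\<in>X. \<forall>e\<in>Ek. \<phi> (pair_at x e) = \<kappa> e}"
        using X by (intro card_mono) (auto simp: pat_def)
      then show ?thesis using pop X(3) unfolding X_def Ek_def by simp
    qed
    define Good where "Good = {\<sigma> :: nat \<times> nat \<Rightarrow> nat. (I, \<lambda>d\<in>nsets I 2. \<sigma> (Min d, Max d)) \<in> \<H>}"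
    have "\<exists>x\<in>PiE I (\<lambda>_. V). inj_on x I
      \<and> (\<forall>s<k * M. \<forall>t<k * M. s div M < t div M \<longrightarrow> \<phi> (x s, x t) = \<kappa> (s div M, t div M))
      \<and> (\<forall>\<sigma>\<in>PiE (index_pairs I) (\<lambda>_. R). (\<forall>e\<in>index_pairs I. \<sigma> e \<in> \<phi> (pair_at x e)) \<longrightarrow> \<sigma> \<in> Good)"
      unfolding I_def
    proof (rule exists_blowup_sample[OF V R(1) M less_imp_le[OF \<alpha>] cut[folded D_def] D \<tau>(1) less_imp_le[OF \<eta>(1)] \<phi>_def pop'],
        fold I_def)
      fix \<sigma> x assume \<sigma>: "\<sigma> \<in> PiE (index_pairs I) (\<lambda>_. R)" "\<sigma> \<notin> Good" and x: "x \<in> PiE I (\<lambda>_. V)" "inj_on x I"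
      \<comment> \<open>A selection realised by distinct vertices of \<open>G'\<close> describes an
        induced subgraph of \<open>G'\<close>, so it is good.\<close>
      show "\<not> (\<forall>e\<in>index_pairs I. c (pair_at x e) = \<sigma> e)"
      proof
        assume all: "\<forall>e\<in>index_pairs I. c (pair_at x e) = \<sigma> e"
        define H where "H = (I, \<lambda>d\<in>nsets I 2. \<sigma> (Min d, Max d))"
        have mm: "\<exists>i j. d = {i, j} \<and> i < j \<and> i \<in> I \<and> j \<in> I" if "d \<in> nsets I 2" for d
          using that by (auto simp: ordered_nsets_2_eq)
        have H: "H \<in> rgraphs r"
        proof -
          have "\<sigma> (Min d, Max d) \<in> R" if "d \<in> nsets I 2" for d
            using mm[OF that] \<sigma>(1) by (force simp: index_pairs_def PiE_iff)
          then show ?thesis by (auto simp: rgraphs_def H_def R_def I_def)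
        qed
        have "H \<in> \<H>"
        proof (rule induced_copy_mem[OF her G' H, of x])
          show "inj_on x (verts H)" "x ` verts H \<subseteq> verts G'"
            using x VG by (auto simp: H_def verts_def V_def)
          fix d assume "d \<in> nsets (verts H) 2"
          then have d: "d \<in> nsets I 2" by (simp add: H_def verts_def)
          then obtain i j where ij: "d = {i, j}" "i < j" "i \<in> I" "j \<in> I" using mm by blast
          then have "x i \<noteq> x j" using x by (auto simp: inj_on_def)
          then have "colour G' (x ` d) = c (x i, x j)" using ij by (simp add: c_def)
          also have "\<dots> = \<sigma> (i, j)" using all ij by (auto simp: index_pairs_def)
          also have "\<dots> = colour H d" using ij by (simp add: H_def colour_def)
          finally show "colour G' (x ` d) = colour H d" .
        qed
        then show False using \<sigma>(2) by (simp add: Good_def H_def)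
      qed
    next
      have "2 * (real ce + c0) / \<beta> < n" using n0 nn by linarith
      then have "(real ce + c0) / n < \<beta> / 2" using n \<beta> by (simp add: field_simps)
      then have "real ce / n + c0 * (1 / n + \<eta>) < \<beta>" using \<eta> \<beta> by (simp add: add_divide_distrib algebra_simps)
      then show "real (card (index_pairs I)) / real (card V)
        + (real (card R) / \<tau>) ^ card (index_pairs I) * real (card (index_pairs I)) * (1 / real (card V) + \<eta>) < \<alpha> ^ (M ^ k)"
        unfolding ce_def[symmetric] R(2) c0_def n_def \<beta>_def .
    qed
    then obtain x where x: "x \<in> PiE I (\<lambda>_. V)"
      and x1: "\<forall>s<k * M. \<forall>t<k * M. s div M < t div M \<longrightarrow> \<phi> (x s, x t) = \<kappa> (s div M, t div M)"
      and x2: "\<forall>\<sigma>\<in>PiE (index_pairs I) (\<lambda>_. R). (\<forall>e\<in>index_pairs I. \<sigma> e \<in> \<phi> (pair_at x e)) \<longrightarrow> \<sigma> \<in> Good"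
      by (elim bexE conjE) (rule that)
    note xpat = x1[rule_format] and xsel = x2[rule_format]
    have "\<exists>\<rho>. (\<forall>i<k. \<rho> i \<in> {1..r}) \<and> block_type k \<rho> \<kappa> \<in> rtypes r \<and>
      (\<forall>H\<in>rgraphs r. card (verts H) \<le> m \<longrightarrow> embeds H (block_type k \<rho> \<kappa>) \<longrightarrow> H \<in> \<H>)"
    proof (rule block_type_of_blowup[OF r her M ram[unfolded R_def], of _ "\<lambda>s t. \<phi> (x s, x t)"])
      show "\<phi> (x s, x t) \<in> Pow {1..r} - {{}}" if "s < k * M" "t < k * M" for s t
        using \<phi>[of "(x s, x t)"] x that by (auto simp: R_def I_def PiE_iff)
      show "\<phi> (x s, x t) = \<kappa> (s div M, t div M)" if "s < k * M" "t < k * M" "s div M < t div M" for s t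
        using xpat that .
      show "({..<k * M}, \<lambda>d\<in>nsets {..<k * M} 2. \<sigma> (Min d, Max d)) \<in> \<H>"
        if "\<sigma> \<in> PiE (index_pairs {..<k * M}) (\<lambda>_. {1..r})"
          "\<And>e. e \<in> index_pairs {..<k * M} \<Longrightarrow> \<sigma> e \<in> \<phi> (pair_at x e)" for \<sigma>
        using xsel[of \<sigma>] that by (simp add: Good_def I_def R_def)
    qed (rule k)
    then obtain \<rho> where \<rho>: "\<And>i. i < k \<Longrightarrow> \<rho> i \<in> {1..r}" "block_type k \<rho> \<kappa> \<in> rtypes r"
      "\<forall>H\<in>rgraphs r. card (verts H) \<le> m \<longrightarrow> embeds H (block_type k \<rho> \<kappa>) \<longrightarrow> H \<in> \<H>" by blast
    have "f_type (block_type k \<rho> \<kappa>) p \<le> cost \<kappa> + 1 / real k"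
      unfolding cost_def w_def Ek_def 
      by (rule f_block_type_le[OF k]) (rule density_vectorsD(1)[OF p \<rho>(1)])
    also have "\<dots> \<le> edit_dist G G' + \<epsilon> + 1 / real k" using \<kappa>(2) m1 e' by (simp add: m1_def e'_def)
    finally show ?thesis using \<rho> by blast
  qed
  show ?thesis using \<delta>(1) main by blast
qed

section \<open>Mapping a graph to a type\<close>

definition colour_density :: "nat rgraph \<Rightarrow> nat \<Rightarrow> real" where
  "colour_density G \<rho> = real (card (edges_of_colour G \<rho>)) / real (card (verts G) choose 2)"

lemma weighted_pair_marginal:
  fixes w :: "'u \<Rightarrow> real"
  assumes V: "finite V" and U: "finite U" and w: "(\<Sum>x\<in>U. w x) = 1" and ij: "i \<in> V" "j \<in> V" "i \<noteq> j"
  shows "(\<Sum>\<gamma>\<in>PiE V (\<lambda>_. U). (\<Prod>v\<in>V. w (\<gamma> v)) * h (\<gamma> i) (\<gamma> j)) = (\<Sum>x\<in>U. \<Sum>y\<in>U. w x * w y * h x y)"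
proof -
  define V' where "V' = V - {i, j}"
  have V': "V = insert i (insert j V')" "i \<notin> insert j V'" "j \<notin> V'" "finite V'"
    using ij V by (auto simp: V'_def)
  have pr: "(\<Prod>v\<in>V. w ((z(j := b, i := a)) v)) = w a * (w b * (\<Prod>v\<in>V'. w (z v)))" for z a b
  proof -
    have "(\<Prod>v\<in>V'. w ((z(j := b, i := a)) v)) = (\<Prod>v\<in>V'. w (z v))"
      using V' by (intro prod.cong) auto
    then show ?thesis using V' ij by (simp add: V'(1))
  qed
  have one: "(\<Sum>z\<in>PiE V' (\<lambda>_. U). \<Prod>v\<in>V'. w (z v)) = 1"
    using prod_sum_PiE[OF V'(4), of "\<lambda>_. U" "\<lambda>_. w"] U w by simp
  have "(\<Sum>\<gamma>\<in>PiE V (\<lambda>_. U). (\<Prod>v\<in>V. w (\<gamma> v)) * h (\<gamma> i) (\<gamma> j))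
    = (\<Sum>z\<in>PiE V' (\<lambda>_. U). \<Sum>b\<in>U. \<Sum>a\<in>U. (\<Prod>v\<in>V. w ((z(j := b, i := a)) v))
        * h ((z(j := b, i := a)) i) ((z(j := b, i := a)) j))"
    by (subst (1) V'(1)) (simp only: sum.PiE_insert[OF V'(2)] sum.PiE_insert[OF V'(3)])
  also have "\<dots> = (\<Sum>z\<in>PiE V' (\<lambda>_. U). (\<Prod>v\<in>V'. w (z v)) * (\<Sum>b\<in>U. \<Sum>a\<in>U. w a * w b * h a b))"
    unfolding pr using ij by (simp add: sum_distrib_left mult_ac)
  also have "\<dots> = (\<Sum>b\<in>U. \<Sum>a\<in>U. w a * w b * h a b)"
    unfolding sum_distrib_right[symmetric] one by simp
  also have "\<dots> = (\<Sum>x\<in>U. \<Sum>y\<in>U. w x * w y * h x y)" by (rule sum.swap)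
  finally show ?thesis .
qed

lemma exists_le_weighted_average:
  fixes W :: "'a \<Rightarrow> real"
  assumes "finite X" "\<And>x. x \<in> X \<Longrightarrow> 0 \<le> W x" "(\<Sum>x\<in>X. W x) = 1"
  shows "\<exists>x\<in>X. f x \<le> (\<Sum>x\<in>X. W x * f x)"
proof (rule ccontr)
  define A where "A = (\<Sum>x\<in>X. W x * f x)"
  assume "\<not> ?thesis"
  then have gt: "f x > A" if "x \<in> X" for x using that by (auto simp: A_def not_le)
  have "(\<Sum>x\<in>X. W x * (f x - A)) = 0"
    using assms(3) by (simp add: algebra_simps sum_subtractf A_def[symmetric] sum_distrib_left[symmetric])
  then have "\<forall>x\<in>X. W x * (f x - A) = 0"
    using assms gt by (subst (asm) sum_nonneg_eq_0_iff) (auto intro!: mult_nonneg_nonneg simp: less_imp_le)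
  then have "\<forall>x\<in>X. W x = 0" using gt by (metis less_irrefl mult_eq_0_iff right_minus_eq)
  then show False using assms(3) by simp
qed

text \<open>An induced copy of a forbidden r-graph in \<open>G\<close> would inherit an embedding
  into \<open>K\<close> by composition.\<close>

lemma mem_hereditary_if_maps_to_allowed:
  fixes G :: "nat rgraph" and K :: "nat rtype"
  assumes F: "forbidden_family r \<H> \<F>" and K: "K \<in> allowed_types r \<F>" and G: "G \<in> rgraphs r" and e: "embeds G K"
  shows "G \<in> \<H>"
proof -
  have "\<not> rgraph_iso (delete_verts G W) H" if H: "H \<in> \<F>" for H W
  proof
    assume "rgraph_iso (delete_verts G W) H"
    then obtain f where f: "bij_betw f (verts G - W) (verts H)"
      and col: "\<And>e. e \<in> nsets (verts G - W) 2 \<Longrightarrow> colour H (f ` e) = colour G e"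
      by (auto simp: rgraph_iso_def delete_verts_def verts_def colour_def)
    obtain \<gamma> where \<gamma>: "\<gamma> \<in> verts G \<rightarrow> fst K"
      and ge: "\<And>v v'. v \<in> verts G \<Longrightarrow> v' \<in> verts G \<Longrightarrow> v \<noteq> v' \<Longrightarrow> colour G {v, v'} \<in> snd K (\<gamma> v, \<gamma> v')"
      using e unfolding embeds_def by blast
    define g where "g = the_inv_into (verts G - W) f"
    have g: "bij_betw g (verts H) (verts G - W)" unfolding g_def using f by (rule bij_betw_the_inv_into)
    have fg: "f (g v) = v" if "v \<in> verts H" for v
      unfolding g_def using f that by (auto simp: bij_betw_def intro: f_the_inv_into_f)
    have "embeds H K"
      unfolding embeds_def
    proof (intro bexI[of _ "\<gamma> \<circ> g"] ballI impI)
      show "\<gamma> \<circ> g \<in> verts H \<rightarrow> fst K" using bij_betwE[OF g] \<gamma> by (auto simp: Pi_iff)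
      fix v v' assume v: "v \<in> verts H" "v' \<in> verts H" "v \<noteq> v'"
      have gv: "g v \<in> verts G - W" "g v' \<in> verts G - W" "g v \<noteq> g v'"
        using g v by (auto simp: bij_betw_def inj_on_def)
      then have "colour H (f ` {g v, g v'}) = colour G {g v, g v'}" by (intro col) auto
      then show "colour H {v, v'} \<in> snd K ((\<gamma> \<circ> g) v, (\<gamma> \<circ> g) v')"
        using ge[of "g v" "g v'"] gv fg v by simp
    qed
    then show False using K H by (auto simp: allowed_types_def)
  qed
  then show ?thesis using F G by (auto simp: forbidden_family_def Forb_def)
qed

text \<open>The mean number of misfits is exactly the quadratic form at the densities of
  \<open>G\<close>: the two ends of an edge are distinct vertices and are mapped independently, so
  the diagonal of the type needs no correction and the bound holds without an error term for every
  graph with at least two vertices.\<close>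

lemma edit_to_type:
  fixes G :: "nat rgraph" and K :: "nat rtype" and w :: "nat \<Rightarrow> real"
  assumes F: "forbidden_family r \<H> \<F>" and K: "K \<in> allowed_types r \<F>" and G: "G \<in> rgraphs r"
    and n: "card (verts G) \<ge> 2" and w: "(\<Sum>x\<in>fst K. w x) = 1" "\<forall>x\<in>fst K. 0 \<le> w x"
  shows "\<exists>G'\<in>\<H>. verts G' = verts G \<and> edit_dist G G' \<le> quad_form K (colour_density G) w"
proof -
  define V where "V = verts G"
  define U where "U = fst K"
  define \<phi> where "\<phi> x y = snd K (x, y)" for x y
  define N where "N = real (card V choose 2)"
  have V: "finite V" using G by (auto simp: V_def rgraphs_def verts_def)
  have N: "N > 0" using n by (simp add: N_def V_def)
  have Kr: "K \<in> rtypes r" using K by (simp add: allowed_types_def)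
  have U: "finite U" using Kr by (auto simp: U_def rtypes_def)
  have K': "snd K \<in> U \<times> U \<rightarrow>\<^sub>E Pow {1..r} - {{}}" "\<forall>x\<in>U. \<forall>y\<in>U. snd K (x, y) = snd K (y, x)"
    using Kr unfolding rtypes_def mem_Collect_eq case_prod_beta U_def by blast+
  have \<phi>: "\<phi> x y \<in> Pow {1..r} - {{}}" "\<phi> x y = \<phi> y x" if "x \<in> U" "y \<in> U" for x y
    unfolding \<phi>_def using PiE_mem[OF K'(1), of "(x, y)"] K'(2) that by simp_all
  have colR: "colour G e \<in> {1..r}" if "e \<in> nsets V 2" for e
    using G that by (auto simp: rgraphs_def colour_def verts_def V_def PiE_iff)
  define bad where "bad \<gamma> = {e\<in>nsets V 2. colour G e \<notin> \<phi> (\<gamma> (Min e)) (\<gamma> (Max e))}" for \<gamma> :: "nat \<Rightarrow> nat"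
  define \<Gamma> where "\<Gamma> = PiE V (\<lambda>_. U)"
  have f\<Gamma>: "finite \<Gamma>" using V U by (auto simp: \<Gamma>_def intro: finite_PiE)
  have fE: "finite (nsets V 2)" using V by (rule finite_imp_finite_nsets)
  define W where "W \<gamma> = (\<Prod>v\<in>V. w (\<gamma> v))" for \<gamma>
  have W: "0 \<le> W \<gamma>" if "\<gamma> \<in> \<Gamma>" for \<gamma>
    unfolding W_def using that w by (intro prod_nonneg) (auto simp: \<Gamma>_def U_def)
  have W1: "(\<Sum>\<gamma>\<in>\<Gamma>. W \<gamma>) = 1"
    unfolding W_def \<Gamma>_def using prod_sum_PiE[OF V, of "\<lambda>_. U" "\<lambda>_. w"] U w by (simp add: U_def)
  obtain \<gamma> where \<gamma>: "\<gamma> \<in> \<Gamma>" and le: "real (card (bad \<gamma>)) \<le> (\<Sum>\<gamma>\<in>\<Gamma>. W \<gamma> * real (card (bad \<gamma>)))"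
    using exists_le_weighted_average[OF f\<Gamma> W W1, of "\<lambda>\<gamma>. real (card (bad \<gamma>))"] by blast
  have cnt: "(\<Sum>e\<in>nsets V 2. of_bool (colour G e \<notin> \<phi> x y)) = N * type_matrix K (colour_density G) x y"
    if xy: "x \<in> U" "y \<in> U" for x y
  proof -
    have fp: "finite (\<phi> x y)" using \<phi>[OF xy] finite_subset by blast
    have "(\<Sum>e\<in>nsets V 2. of_bool (colour G e \<notin> \<phi> x y)) = (\<Sum>e\<in>nsets V 2. 1 - (\<Sum>\<rho>\<in>\<phi> x y. of_bool (colour G e = \<rho>)) :: real)"
      using fp by (intro sum.cong refl) (auto simp: of_bool_def sum.delta)
    also have "\<dots> = N - (\<Sum>\<rho>\<in>\<phi> x y. \<Sum>e\<in>nsets V 2. of_bool (colour G e = \<rho>))"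
      unfolding sum_subtractf by (subst sum.swap) (simp add: N_def)
    also have "(\<Sum>\<rho>\<in>\<phi> x y. \<Sum>e\<in>nsets V 2. of_bool (colour G e = \<rho>)) = (\<Sum>\<rho>\<in>\<phi> x y. N * colour_density G \<rho>)"
      unfolding sum_of_bool_eq_card[OF fE] using N
      by (intro sum.cong refl) (simp add: colour_density_def edges_of_colour_def V_def N_def)
    finally show ?thesis by (simp add: type_matrix_def \<phi>_def sum_distrib_left right_diff_distrib)
  qed
  have "(\<Sum>\<gamma>\<in>\<Gamma>. W \<gamma> * real (card (bad \<gamma>)))
    = (\<Sum>\<gamma>\<in>\<Gamma>. \<Sum>e\<in>nsets V 2. W \<gamma> * of_bool (colour G e \<notin> \<phi> (\<gamma> (Min e)) (\<gamma> (Max e))))"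
    unfolding bad_def sum_of_bool_eq_card[OF fE, symmetric] sum_distrib_left ..
  also have "\<dots> = (\<Sum>e\<in>nsets V 2. \<Sum>\<gamma>\<in>\<Gamma>. W \<gamma> * of_bool (colour G e \<notin> \<phi> (\<gamma> (Min e)) (\<gamma> (Max e))))"
    by (rule sum.swap)
  also have "\<dots> = (\<Sum>e\<in>nsets V 2. \<Sum>x\<in>U. \<Sum>y\<in>U. w x * w y * of_bool (colour G e \<notin> \<phi> x y))"
  proof (rule sum.cong[OF refl])
    fix e assume "e \<in> nsets V 2"
    then obtain i j where "e = {i, j}" "i \<in> V" "j \<in> V" "i < j" by (auto simp: ordered_nsets_2_eq)
    then have "Min e \<in> V" "Max e \<in> V" "Min e \<noteq> Max e" by auto
    then show "(\<Sum>\<gamma>\<in>\<Gamma>. W \<gamma> * of_bool (colour G e \<notin> \<phi> (\<gamma> (Min e)) (\<gamma> (Max e))))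
      = (\<Sum>x\<in>U. \<Sum>y\<in>U. w x * w y * of_bool (colour G e \<notin> \<phi> x y))"
      unfolding W_def \<Gamma>_def using w by (intro weighted_pair_marginal V U) (auto simp: U_def)
  qed
  also have "\<dots> = (\<Sum>x\<in>U. \<Sum>e\<in>nsets V 2. \<Sum>y\<in>U. w x * w y * of_bool (colour G e \<notin> \<phi> x y))"
    by (rule sum.swap)
  also have "\<dots> = (\<Sum>x\<in>U. \<Sum>y\<in>U. \<Sum>e\<in>nsets V 2. w x * w y * of_bool (colour G e \<notin> \<phi> x y))"
    by (intro sum.cong refl sum.swap)
  also have "\<dots> = (\<Sum>x\<in>U. \<Sum>y\<in>U. N * (w x * type_matrix K (colour_density G) x y * w y))"
  proof (intro sum.cong refl)
    fix x y assume xy: "x \<in> U" "y \<in> U"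
    have "(\<Sum>e\<in>nsets V 2. w x * w y * of_bool (colour G e \<notin> \<phi> x y))
      = w x * w y * (N * type_matrix K (colour_density G) x y)"
      unfolding cnt[OF xy, symmetric] sum_distrib_left ..
    then show "(\<Sum>e\<in>nsets V 2. w x * w y * of_bool (colour G e \<notin> \<phi> x y))
      = N * (w x * type_matrix K (colour_density G) x y * w y)" by (simp only: mult_ac)
  qed
  also have "\<dots> = N * quad_form K (colour_density G) w"
    by (simp add: quad_form_def U_def sum_distrib_left)
  finally have le': "real (card (bad \<gamma>)) \<le> N * quad_form K (colour_density G) w" using le by simp
  define \<psi> where "\<psi> e = \<phi> (\<gamma> (Min e)) (\<gamma> (Max e))" for e
  define G' where "G' = (V, \<lambda>e\<in>nsets V 2. if colour G e \<in> \<psi> e then colour G e else SOME \<rho>. \<rho> \<in> \<psi> e)"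
  have vG': "verts G' = V" by (simp add: G'_def verts_def)
  have \<gamma>U: "\<gamma> v \<in> U" if "v \<in> V" for v using \<gamma> that by (auto simp: \<Gamma>_def)
  have \<psi>: "\<psi> {i, j} = \<phi> (\<gamma> i) (\<gamma> j)" "\<psi> {i, j} \<in> Pow {1..r} - {{}}" if "i \<in> V" "j \<in> V" for i j
  proof -
    show "\<psi> {i, j} = \<phi> (\<gamma> i) (\<gamma> j)" unfolding \<psi>_def using \<phi>(2) \<gamma>U that by (cases "i \<le> j") auto
    then show "\<psi> {i, j} \<in> Pow {1..r} - {{}}" using \<phi>(1) \<gamma>U that by simp
  qed
  have col: "colour G' e \<in> \<psi> e" "\<psi> e \<subseteq> {1..r}" if e: "e \<in> nsets V 2" for e
  proof -
    have ne: "\<psi> e \<in> Pow {1..r} - {{}}" using e \<psi>(2) by (auto elim!: nsets2_E)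
    show "colour G' e \<in> \<psi> e" using e ne by (auto simp: G'_def colour_def some_in_eq)
    show "\<psi> e \<subseteq> {1..r}" using ne by simp
  qed
  have G'r: "G' \<in> rgraphs r"
    using col V unfolding rgraphs_def by (auto simp: G'_def colour_def)
  have "embeds G' K"
    unfolding embeds_def vG'
  proof (intro bexI[of _ \<gamma>] ballI impI)
    show "\<gamma> \<in> V \<rightarrow> fst K" using \<gamma>U by (simp add: U_def)
    fix v v' assume "v \<in> V" "v' \<in> V" "v \<noteq> v'"
    then show "colour G' {v, v'} \<in> snd K (\<gamma> v, \<gamma> v')" using col(1)[of "{v, v'}"] \<psi>(1) by (simp add: \<phi>_def)
  qed
  then have "G' \<in> \<H>" by (rule mem_hereditary_if_maps_to_allowed[OF F K G'r])
  moreover have "edit_dist G G' \<le> quad_form K (colour_density G) w"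
  proof -
    have "{e\<in>nsets V 2. colour G e \<noteq> colour G' e} \<subseteq> bad \<gamma>"
      by (auto simp: bad_def G'_def colour_def \<psi>_def)
    then have "card {e\<in>nsets V 2. colour G e \<noteq> colour G' e} \<le> card (bad \<gamma>)"
      using fE by (intro card_mono) (auto simp: bad_def)
    then have "real (card {e\<in>nsets V 2. colour G e \<noteq> colour G' e}) \<le> N * quad_form K (colour_density G) w"
      using le' by linarith
    then show ?thesis using N by (simp add: edit_dist_def N_def V_def field_simps)
  qed
  ultimately show ?thesis using vG' by (auto simp: V_def)
qed

section \<open>Random graphs are quasirandom\<close>

lemma pmf_colour_pmf:
  assumes p: "p \<in> density_vectors r"
  shows "pmf (colour_pmf r p) \<rho> = (if \<rho> \<in> {1..r} then p \<rho> else 0)"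
  unfolding colour_pmf_def
proof (rule pmf_embed_pmf)
  show "0 \<le> (if \<rho> \<in> {1..r} then p \<rho> else 0)" for \<rho> using density_vectorsD(1)[OF p] by simp
  have "(\<integral>\<^sup>+\<rho>. ennreal (if \<rho> \<in> {1..r} then p \<rho> else 0) \<partial>count_space UNIV)
    = (\<Sum>\<rho>\<in>{1..r}. ennreal (if \<rho> \<in> {1..r} then p \<rho> else 0))"
    by (rule nn_integral_count_space') auto
  also have "\<dots> = (\<Sum>\<rho>\<in>{1..r}. ennreal (p \<rho>))" by (rule sum.cong) auto
  also have "\<dots> = ennreal (\<Sum>\<rho>\<in>{1..r}. p \<rho>)" using density_vectorsD(1)[OF p] by (intro sum_ennreal) auto
  also have "\<dots> = 1" using density_vectorsD(2)[OF p] by simp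
  finally show "(\<integral>\<^sup>+\<rho>. ennreal (if \<rho> \<in> {1..r} then p \<rho> else 0) \<partial>count_space UNIV) = 1" .
qed

lemma set_random_rgraph:
  assumes p: "p \<in> density_vectors r" and G: "G \<in> set_pmf (random_rgraph r n p)"
  shows "G \<in> rgraphs r" "verts G = {..<n}"
proof -
  have f: "finite (nsets {..<n} 2)" by (simp add: finite_imp_finite_nsets)
  obtain c where c: "G = ({..<n}, c)" "c \<in> set_pmf (Pi_pmf (nsets {..<n} 2) undefined (\<lambda>_. colour_pmf r p))"
    using G by (auto simp: random_rgraph_def)
  have s: "set_pmf (colour_pmf r p) \<subseteq> {1..r}"
    using pmf_colour_pmf[OF p] by (auto simp: set_pmf_eq split: if_splits)
  have "c \<in> nsets {..<n} 2 \<rightarrow>\<^sub>E {1..r}"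
    using c(2) set_Pi_pmf_subset'[OF f, of undefined "\<lambda>_. colour_pmf r p"] s
    by (fastforce simp: PiE_dflt_def PiE_iff extensional_def)
  then show "G \<in> rgraphs r" by (simp add: rgraphs_def c)
  show "verts G = {..<n}" by (simp add: c verts_def)
qed

abbreviation random_prob :: "nat \<Rightarrow> nat \<Rightarrow> (nat \<Rightarrow> real) \<Rightarrow> nat rgraph set \<Rightarrow> real" where
  "random_prob r n p \<equiv> measure_pmf.prob (random_rgraph r n p)"

text \<open>The count is a sum over edges of independent variables with values in [0, 2], as an edge
  occurs at most twice among the ordered pairs of \<open>A \<times> B\<close>. Hoeffding's exponent
  2 t^2 / (4 (n choose 2)) is at least t^2 / n^2.\<close>

lemma colour_count_concentration:
  assumes p: "p \<in> density_vectors r" and \<rho>: "\<rho> \<in> {1..r}" and AB: "A \<subseteq> {..<n}" "B \<subseteq> {..<n}"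
    and n: "n \<ge> 2" and t: "t \<ge> 0"
  shows "random_prob r n p
      {G. t \<le> \<bar>real (card {z\<in>A \<times> B. fst z \<noteq> snd z \<and> colour G {fst z, snd z} = \<rho>})
          - p \<rho> * real (card {z\<in>A \<times> B. fst z \<noteq> snd z})\<bar>} \<le> 2 * exp (- (t\<^sup>2 / (real n)\<^sup>2))"
proof -
  define E where "E = nsets {..<n} 2"
  define Z where "Z = {z\<in>A \<times> B. fst z \<noteq> snd z}"
  define h where "h z = {fst z, snd z}" for z :: "nat \<times> nat"
  define m where "m e = real (card {z\<in>Z. h z = e})" for e
  define M where "M = Pi_pmf E undefined (\<lambda>_. colour_pmf r p)"
  define X where "X e c = m e * of_bool (c e = \<rho>)" for e and c :: "nat set \<Rightarrow> nat"
  have E: "finite E" "E \<noteq> {}" "real (card E) = real (n choose 2)"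
    using n by (auto simp: E_def finite_imp_finite_nsets nsets_eq_empty_iff)
  have "finite A" "finite B" using AB finite_subset by blast+
  then have Z: "finite Z" by (auto simp: Z_def)
  have hE: "h ` Z \<subseteq> E" using AB by (auto simp: h_def Z_def E_def)
  have m2: "m e \<le> 2" if e: "e \<in> E" for e
  proof -
    obtain x y where e: "e = {x, y}" using e by (auto simp: E_def ordered_nsets_2_eq)
    have "{z\<in>Z. h z = e} \<subseteq> {(x, y), (y, x)}"
      by (auto simp: e h_def Z_def doubleton_eq_iff)
    then have "card {z\<in>Z. h z = e} \<le> card {(x, y), (y, x)}" by (intro card_mono) auto
    also have "\<dots> \<le> 2" by (intro card_insert_le_m1) auto
    finally show ?thesis by (simp add: m_def)
  qed
  have m0: "0 \<le> m e" for e by (simp add: m_def)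
  have mZ: "(\<Sum>e\<in>E. m e * g e) = (\<Sum>z\<in>Z. g (h z))" for g
  proof -
    have "(\<Sum>z\<in>Z. g (h z)) = (\<Sum>e\<in>E. \<Sum>z\<in>{z\<in>Z. h z = e}. g (h z))"
      by (rule sum.group[symmetric, OF Z E(1) hE])
    also have "\<dots> = (\<Sum>e\<in>E. m e * g e)" by (rule sum.cong) (auto simp: m_def)
    finally show ?thesis by simp
  qed
  have count: "(\<Sum>e\<in>E. X e c) = real (card {z\<in>A \<times> B. fst z \<noteq> snd z \<and> c {fst z, snd z} = \<rho>})" for c
  proof -
    have "(\<Sum>e\<in>E. X e c) = real (card {z\<in>Z. c (h z) = \<rho>})"
      unfolding X_def mZ sum_of_bool_eq_card[OF Z] ..
    also have "{z\<in>Z. c (h z) = \<rho>} = {z\<in>A \<times> B. fst z \<noteq> snd z \<and> c {fst z, snd z} = \<rho>}"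
      by (auto simp: Z_def h_def)
    finally show ?thesis .
  qed
  have expX: "measure_pmf.expectation M (X e) = m e * p \<rho>" if e: "e \<in> E" for e
  proof -
    have "measure_pmf.expectation M (X e)
      = measure_pmf.expectation (map_pmf (\<lambda>c. c e) M) (\<lambda>x. m e * indicator {\<rho>} x)"
    proof -
      have "X e = (\<lambda>c. m e * indicator {\<rho>} (c e))" by (auto simp: X_def indicator_def fun_eq_iff)
      then show ?thesis by (simp only: integral_map_pmf)
    qed
    also have "map_pmf (\<lambda>c. c e) M = colour_pmf r p"
      unfolding M_def using e by (simp add: Pi_pmf_component E)
    also have "measure_pmf.expectation (colour_pmf r p) (\<lambda>x. m e * indicator {\<rho>} x) = m e * pmf (colour_pmf r p) \<rho>"
      by (simp add: measure_pmf_single)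
    also have "\<dots> = m e * p \<rho>" using \<rho> by (simp add: pmf_colour_pmf[OF p])
    finally show ?thesis .
  qed
  have ind: "prob_space.indep_vars (measure_pmf M) (\<lambda>_. borel) X E"
    unfolding M_def X_def
    by (rule prob_space.indep_vars_compose2[OF measure_pmf.prob_space_axioms, where M' = "\<lambda>_. count_space UNIV"
          and X = "\<lambda>x f. f x" and Y = "\<lambda>e x. m e * of_bool (x = \<rho>)"]) (auto intro: indep_vars_Pi_pmf E(1))
  interpret H: Hoeffding_ineq "measure_pmf M" E X "\<lambda>_. 0" "\<lambda>_. 2" "\<Sum>e\<in>E. measure_pmf.expectation M (X e)"
  proof unfold_locales
    show "AE c in measure_pmf M. X e c \<in> {0..2}" if "e \<in> E" for e
      using m0 m2[OF that] by (intro AE_pmfI) (auto simp: X_def)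
  qed (use E ind in auto)
  have mu: "(\<Sum>e\<in>E. measure_pmf.expectation M (X e)) = p \<rho> * real (card Z)"
    using mZ[of "\<lambda>_. p \<rho>"] expX by simp
  have den: "(\<Sum>e\<in>E. (2 - 0 :: real)\<^sup>2) = 4 * real (n choose 2)" using E by simp
  have ch: "real (n choose 2) > 0" using n by simp
  have "random_prob r n p
      {G. t \<le> \<bar>real (card {z\<in>A \<times> B. fst z \<noteq> snd z \<and> colour G {fst z, snd z} = \<rho>}) - p \<rho> * real (card Z)\<bar>}
    = measure_pmf.prob M {c. t \<le> \<bar>(\<Sum>e\<in>E. X e c) - p \<rho> * real (card Z)\<bar>}"
    by (simp add: random_rgraph_def measure_map_pmf vimage_def M_def E_def colour_def count[unfolded E_def])
  also have "\<dots> \<le> 2 * exp (- 2 * t\<^sup>2 / (4 * real (n choose 2)))"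
    using H.Hoeffding_ineq_abs_ge[OF t] ch unfolding mu den by simp
  also have "\<dots> \<le> 2 * exp (- (t\<^sup>2 / (real n)\<^sup>2))"
  proof -
    have "t\<^sup>2 / (real n)\<^sup>2 \<le> t\<^sup>2 / (2 * real (n choose 2))"
      using two_choose_two_le[of n] ch by (intro divide_left_mono) auto
    then show ?thesis by simp
  qed
  finally show ?thesis unfolding Z_def .
qed

text \<open>There are only r 4^n triples of a colour and two vertex sets, while each fails with
  probability exponentially small in n^2.\<close>

lemma quasirandom_whp:
  assumes p: "p \<in> density_vectors r" and \<delta>: "\<delta> > 0"
  shows "(\<lambda>n. random_prob r n p
      {G. G \<in> rgraphs r \<and> verts G = {..<n} \<and> quasirandom r p \<delta> G}) \<longlonglongrightarrow> 1"
proof -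
  define good where "good n = {G. G \<in> rgraphs r \<and> verts G = {..<n} \<and> quasirandom r p \<delta> G}" for n
  define bd where "bd n = 2 * real r * exp (-1) ^ n" for n :: nat
  \<comment> \<open>For n above 2/\<delta> the diagonal is at most \<open>t\<close>. For n above
    16/\<delta>^2 the exponent is at least 4n, and 4^n exp(-4n) is at most exp(-n) because 4 is at
    most exp 3.\<close>
  obtain N :: nat where N: "2 + 2 / \<delta> + 16 / \<delta>\<^sup>2 < real N" using reals_Archimedean2 by blast
  have key: "1 - bd n \<le> random_prob r n p (good n)" if nN: "n \<ge> N" for n
  proof -
    define Q where "Q = random_rgraph r n p"
    have pos: "0 < 2 / \<delta>" "0 < 16 / \<delta>\<^sup>2" using \<delta> by auto
    have "2 + 2 / \<delta> + 16 / \<delta>\<^sup>2 < real n" using N nN by linarith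
    then have n: "2 < real n" "2 / \<delta> < real n" "16 / \<delta>\<^sup>2 < real n" using pos by linarith+
    \<comment> \<open>Half of the tolerance goes to the random fluctuation, the other half to the
      diagonal pairs, which \<open>colour_count_concentration\<close> leaves out.\<close>
    define t where "t = \<delta> / 2 * (real n)\<^sup>2"
    have nt: "real n \<le> t"
    proof -
      have "1 \<le> \<delta> / 2 * real n" using n(2) \<delta> by (simp add: field_simps)
      then have "1 * real n \<le> \<delta> / 2 * real n * real n" by (intro mult_right_mono) auto
      then show ?thesis by (simp add: t_def power2_eq_square)
    qed
    define bad where "bad a = (case a of (\<rho>, A, B) \<Rightarrow> {G :: nat rgraph. t \<le> \<bar>real (card {z\<in>A \<times> B. fst z \<noteq> snd z \<and> colour G {fst z, snd z} = \<rho>})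
          - p \<rho> * real (card {z\<in>A \<times> B. fst z \<noteq> snd z})\<bar>})" for a :: "nat \<times> nat set \<times> nat set"
    define J where "J = {1..r} \<times> Pow {..<n} \<times> Pow {..<n}"
    have J: "finite J" "real (card J) = real r * 4 ^ n"
    proof -
      show "finite J" by (simp add: J_def)
      have "card J = r * (2 ^ n * 2 ^ n)" by (simp add: J_def card_cartesian_product card_Pow)
      also have "\<dots> = r * 4 ^ n" by (simp add: power_mult_distrib[symmetric])
      finally show "real (card J) = real r * 4 ^ n" by simp
    qed
    have sub: "- good n \<inter> set_pmf Q \<subseteq> (\<Union>a\<in>J. bad a)"
    proof
      fix G assume G: "G \<in> - good n \<inter> set_pmf Q"
      then have "G \<in> rgraphs r" "verts G = {..<n}" using set_random_rgraph[OF p, of G n] by (auto simp: Q_def)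
      then have "\<not> quasirandom r p \<delta> G" using G by (auto simp: good_def)
      then obtain \<rho> A B where \<rho>: "\<rho> \<in> {1..r}" and AB: "A \<subseteq> {..<n}" "B \<subseteq> {..<n}"
        and gt: "\<bar>real (card {z\<in>A \<times> B. fst z \<noteq> snd z \<and> colour G {fst z, snd z} = \<rho>})
          - p \<rho> * real (card A) * real (card B)\<bar> > \<delta> * (real n)\<^sup>2"
        unfolding quasirandom_def \<open>verts G = {..<n}\<close> by (auto simp: not_le)
      define Z where "Z = {z\<in>A \<times> B. fst z \<noteq> snd z}"
      have fin: "finite A" "finite B" using AB finite_subset by blast+
      have "card A * card B = card (A \<times> B)" by (simp add: card_cartesian_product)
      also have "A \<times> B = Z \<union> (\<lambda>x. (x, x)) ` (A \<inter> B)" by (auto simp: Z_def)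
      also have "card \<dots> = card Z + card ((\<lambda>x. (x, x)) ` (A \<inter> B))"
        using fin by (intro card_Un_disjoint) (auto simp: Z_def)
      also have "card ((\<lambda>x. (x, x)) ` (A \<inter> B)) = card (A \<inter> B)" by (rule card_image) (auto simp: inj_on_def)
      finally have cZ: "real (card A) * real (card B) = real (card Z) + real (card (A \<inter> B))"
        by (metis of_nat_add of_nat_mult)
      have "card (A \<inter> B) \<le> card {..<n}" using AB by (intro card_mono) auto
      then have "real (card (A \<inter> B)) \<le> real n" by simp
      then have "p \<rho> * real (card (A \<inter> B)) \<le> 1 * real n"
        using density_vectorsD[OF p] \<rho> by (intro mult_mono) auto
      moreover have "0 \<le> p \<rho> * real (card (A \<inter> B))" using density_vectorsD[OF p] \<rho> by simp
      moreover have "p \<rho> * real (card A) * real (card B) = p \<rho> * real (card Z) + p \<rho> * real (card (A \<inter> B))"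
        using cZ by (simp add: mult.assoc distrib_left)
      ultimately have "t \<le> \<bar>real (card {z\<in>A \<times> B. fst z \<noteq> snd z \<and> colour G {fst z, snd z} = \<rho>}) - p \<rho> * real (card Z)\<bar>"
        using gt nt unfolding t_def by linarith
      then show "G \<in> (\<Union>a\<in>J. bad a)" using \<rho> AB unfolding Z_def
        by (intro UN_I[of "(\<rho>, A, B)"]) (auto simp: J_def bad_def)
    qed
    have "measure_pmf.prob Q (- good n) = measure_pmf.prob Q (- good n \<inter> set_pmf Q)"
      by (rule measure_Int_set_pmf[symmetric])
    also have "\<dots> \<le> measure_pmf.prob Q (\<Union>a\<in>J. bad a)"
      by (rule measure_pmf.finite_measure_mono[OF sub]) simp
    also have "\<dots> \<le> (\<Sum>a\<in>J. measure_pmf.prob Q (bad a))"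
      by (rule measure_pmf.finite_measure_subadditive_finite[OF J(1)]) simp
    also have "\<dots> \<le> (\<Sum>a\<in>J. 2 * exp (- (t\<^sup>2 / (real n)\<^sup>2)))"
    proof (rule sum_mono)
      fix a assume "a \<in> J"
      then obtain \<rho> A B where a: "a = (\<rho>, A, B)" "\<rho> \<in> {1..r}" "A \<subseteq> {..<n}" "B \<subseteq> {..<n}" by (auto simp: J_def)
      show "measure_pmf.prob Q (bad a) \<le> 2 * exp (- (t\<^sup>2 / (real n)\<^sup>2))"
        unfolding a bad_def Q_def prod.case using n nt
        by (intro colour_count_concentration p a) linarith+
    qed
    also have "\<dots> = 2 * real r * (4 ^ n * exp (- (t\<^sup>2 / (real n)\<^sup>2)))" using J by simp
    also have "\<dots> \<le> 2 * real r * (exp (-1) ^ n)"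
    proof (rule mult_left_mono)
      have "t\<^sup>2 / (real n)\<^sup>2 = \<delta>\<^sup>2 / 4 * real n * real n"
        using n by (simp add: t_def power2_eq_square field_simps)
      also have "\<dots> \<ge> 4 * real n"
        using n(3) \<delta> by (intro mult_right_mono) (auto simp: field_simps)
      finally have "4 * real n \<le> t\<^sup>2 / (real n)\<^sup>2" .
      then have "exp (- (t\<^sup>2 / (real n)\<^sup>2)) \<le> exp (- (4 * real n))" by simp
      moreover have "(4::real) \<le> exp 3"
        using exp_ge_add_one_self[of "3::real"] by simp
      then have "(4::real) ^ n \<le> exp 3 ^ n" by (intro power_mono) auto
      ultimately have "4 ^ n * exp (- (t\<^sup>2 / (real n)\<^sup>2)) \<le> exp 3 ^ n * exp (- (4 * real n))"
        by (intro mult_mono) auto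
      also have "\<dots> = exp (-1) ^ n"
        by (simp add: exp_of_nat_mult[symmetric] exp_add[symmetric])
      finally show "4 ^ n * exp (- (t\<^sup>2 / (real n)\<^sup>2)) \<le> exp (-1) ^ n" .
    qed simp
    finally have "measure_pmf.prob Q (- good n) \<le> bd n" by (simp add: bd_def)
    moreover have "measure_pmf.prob Q (- good n) = 1 - measure_pmf.prob Q (good n)"
      using measure_pmf.prob_compl[of "good n" Q] by (simp add: Compl_eq_Diff_UNIV)
    ultimately show ?thesis by (simp add: Q_def)
  qed
  have lim: "(\<lambda>n. exp (-1::real) ^ n) \<longlonglongrightarrow> 0" by (rule LIMSEQ_realpow_zero) auto
  have "(\<lambda>n. 1 - bd n) \<longlonglongrightarrow> 1 - 2 * real r * 0"
    unfolding bd_def by (rule tendsto_diff[OF tendsto_const tendsto_mult[OF tendsto_const lim]])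
  then have "(\<lambda>n. 1 - bd n) \<longlonglongrightarrow> 1" by simp
  then show ?thesis unfolding good_def[symmetric]
  proof (rule tendsto_sandwich[rotated 2, OF _ tendsto_const])
    show "\<forall>\<^sub>F n in sequentially. 1 - bd n \<le> random_prob r n p (good n)"
      using key by (auto simp: eventually_sequentially)
    show "\<forall>\<^sub>F n in sequentially. random_prob r n p (good n) \<le> 1" by simp
  qed
qed

section \<open>The limit as an infimum over types\<close>

abbreviation l1_dist :: "nat \<Rightarrow> (nat \<Rightarrow> real) \<Rightarrow> (nat \<Rightarrow> real) \<Rightarrow> real" where
  "l1_dist r p q \<equiv> \<Sum>\<rho>\<in>{1..r}. \<bar>p \<rho> - q \<rho>\<bar>"

definition weightings :: "'u set \<Rightarrow> ('u \<Rightarrow> real) set" where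
  "weightings U = {w. (\<Sum>x\<in>U. w x) = 1 \<and> (\<forall>x\<in>U. w x \<ge> 0)}"

lemma g_type_alt: "g_type K p = (INF w\<in>weightings (fst K). quad_form K p w)"
  unfolding g_type_def weightings_def by (rule arg_cong[of _ _ Inf]) auto

lemma uniform_in_weightings: "finite U \<Longrightarrow> U \<noteq> {} \<Longrightarrow> (\<lambda>_. 1 / real (card U)) \<in> weightings U"
  by (simp add: weightings_def)

lemma rtypesD:
  assumes "K \<in> rtypes r"
  shows "finite (fst K)" "fst K \<noteq> {}" "x \<in> fst K \<Longrightarrow> y \<in> fst K \<Longrightarrow> snd K (x, y) \<subseteq> {1..r}"
    "snd K \<in> fst K \<times> fst K \<rightarrow>\<^sub>E Pow {1..r} - {{}}"
proof -
  show "finite (fst K)" "fst K \<noteq> {}" using assms by (auto simp: rtypes_def)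
  show "snd K \<in> fst K \<times> fst K \<rightarrow>\<^sub>E Pow {1..r} - {{}}"
    using assms unfolding rtypes_def mem_Collect_eq case_prod_beta by (elim conjE)
  then show "x \<in> fst K \<Longrightarrow> y \<in> fst K \<Longrightarrow> snd K (x, y) \<subseteq> {1..r}"
    using PiE_mem[of "snd K" "fst K \<times> fst K" _ "(x, y)"] by auto
qed

lemma type_matrix_bounds:
  assumes "K \<in> rtypes r" "p \<in> density_vectors r" "x \<in> fst K" "y \<in> fst K"
  shows "0 \<le> type_matrix K p x y" "type_matrix K p x y \<le> 1"
  using sum_density_subset_le_1[OF assms(2) rtypesD(3)[OF assms(1,3,4)]] by (auto simp: type_matrix_def)

lemma quad_form_nonneg:
  assumes "K \<in> rtypes r" "p \<in> density_vectors r" "w \<in> weightings (fst K)"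
  shows "0 \<le> quad_form K p w"
  unfolding quad_form_def using assms
  by (intro sum_nonneg mult_nonneg_nonneg type_matrix_bounds(1)[OF assms(1,2)]) (auto simp: weightings_def)

lemma g_type_le:
  assumes "K \<in> rtypes r" "p \<in> density_vectors r" "w \<in> weightings (fst K)"
  shows "g_type K p \<le> quad_form K p w"
  unfolding g_type_alt
  by (rule cINF_lower[OF bdd_belowI2[of _ 0] assms(3)]) (rule quad_form_nonneg[OF assms(1,2)])

lemma g_type_greatest:
  assumes "K \<in> rtypes r" "\<And>w. w \<in> weightings (fst K) \<Longrightarrow> m \<le> quad_form K p w"
  shows "m \<le> g_type K p"
  unfolding g_type_alt
  using uniform_in_weightings[OF rtypesD(1,2)[OF assms(1)]] by (intro cINF_greatest assms(2)) auto

lemma g_type_nonneg: "K \<in> rtypes r \<Longrightarrow> p \<in> density_vectors r \<Longrightarrow> 0 \<le> g_type K p"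
  by (rule g_type_greatest) (auto intro: quad_form_nonneg)

lemma g_type_le_f_type: "K \<in> rtypes r \<Longrightarrow> p \<in> density_vectors r \<Longrightarrow> g_type K p \<le> f_type K p"
  unfolding f_type_def by (intro g_type_le uniform_in_weightings rtypesD) auto

lemma weightings_weights: "w \<in> weightings U \<Longrightarrow> (\<Sum>x\<in>U. \<Sum>y\<in>U. w x * c * w y) = c"
  by (simp add: weightings_def sum_distrib_left[symmetric] sum_distrib_right[symmetric])

text \<open>The constant 1 does not depend on the type or the weighting, because the weights sum to
  1; thus the estimate survives the infimum over all of them.\<close>

lemma quad_form_lipschitz:
  assumes "K \<in> rtypes r" "w \<in> weightings (fst K)"
  shows "quad_form K p w \<le> quad_form K q w + l1_dist r p q"
proof -
  let ?d = "l1_dist r p q"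
  have "quad_form K p w \<le> (\<Sum>x\<in>fst K. \<Sum>y\<in>fst K. w x * type_matrix K q x y * w y + w x * ?d * w y)"
    unfolding quad_form_def
  proof (intro sum_mono)
    fix x y assume xy: "x \<in> fst K" "y \<in> fst K"
    have "type_matrix K p x y - type_matrix K q x y = (\<Sum>\<rho>\<in>snd K (x, y). q \<rho> - p \<rho>)"
      by (simp add: type_matrix_def sum_subtractf)
    also have "\<dots> \<le> (\<Sum>\<rho>\<in>snd K (x, y). \<bar>p \<rho> - q \<rho>\<bar>)" by (intro sum_mono) auto
    also have "\<dots> \<le> ?d" using rtypesD(3)[OF assms(1) xy] by (intro sum_mono2) auto
    finally have "type_matrix K p x y \<le> type_matrix K q x y + ?d" by simp
    then have "w x * type_matrix K p x y * w y \<le> w x * (type_matrix K q x y + ?d) * w y"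
      using assms(2) xy by (intro mult_right_mono mult_left_mono) (auto simp: weightings_def)
    then show "w x * type_matrix K p x y * w y \<le> w x * type_matrix K q x y * w y + w x * ?d * w y"
      by (simp add: algebra_simps)
  qed
  also have "\<dots> = quad_form K q w + ?d"
    unfolding sum.distrib weightings_weights[OF assms(2)] by (simp add: quad_form_def)
  finally show ?thesis .
qed

text \<open>The colour densities made extensional, as membership in \<open>density_vectors\<close>
  requires.\<close>

definition graph_density :: "nat \<Rightarrow> nat rgraph \<Rightarrow> nat \<Rightarrow> real" where
  "graph_density r G = (\<lambda>\<rho>\<in>{1..r}. colour_density G \<rho>)"

lemma sum_edges_of_colour:
  assumes "G \<in> rgraphs r"
  shows "(\<Sum>\<rho>\<in>{1..r}. card (edges_of_colour G \<rho>)) = card (verts G) choose 2"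
proof -
  have f: "finite (nsets (verts G) 2)" using assms by (auto simp: rgraphs_def verts_def finite_imp_finite_nsets)
  have im: "colour G ` nsets (verts G) 2 \<subseteq> {1..r}" using assms by (auto simp: rgraphs_def verts_def colour_def)
  have "card (nsets (verts G) 2) = (\<Sum>\<rho>\<in>{1..r}. card (edges_of_colour G \<rho>))"
    using sum.group[OF f finite_atLeastAtMost im, of "\<lambda>_. 1::nat"] by (simp add: edges_of_colour_def)
  then show ?thesis by simp
qed

lemma density_in_density_vectors:
  assumes "G \<in> rgraphs r" "card (verts G) \<ge> 2"
  shows "graph_density r G \<in> density_vectors r"
proof -
  have "(\<Sum>\<rho>\<in>{1..r}. graph_density r G \<rho>) = real (\<Sum>\<rho>\<in>{1..r}. card (edges_of_colour G \<rho>)) / real (card (verts G) choose 2)"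
    by (simp add: graph_density_def colour_density_def sum_divide_distrib)
  also have "\<dots> = 1" unfolding sum_edges_of_colour[OF assms(1)] using assms(2) by simp
  finally show ?thesis by (simp add: density_vectors_def graph_density_def colour_density_def PiE_iff)
qed

lemma quad_form_density:
  assumes "K \<in> rtypes r"
  shows "quad_form K (colour_density G) w = quad_form K (graph_density r G) w"
proof -
  have "type_matrix K (colour_density G) x y = type_matrix K (graph_density r G) x y" if "x \<in> fst K" "y \<in> fst K" for x y
    unfolding type_matrix_def using rtypesD(3)[OF assms that]
    by (intro arg_cong[of _ _ "\<lambda>s. 1 - s"] sum.cong) (auto simp: graph_density_def)
  then show ?thesis by (simp add: quad_form_def)
qed

text \<open>Quasirandomness is used for the whole vertex set on both sides. The diagonal adds an
  error of at most n, and passing from n^2 to n (n - 1) costs at most the factor 2.\<close>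

lemma quasirandom_density:
  assumes p: "p \<in> density_vectors r" and qr: "quasirandom r p \<delta> G" and G: "G \<in> rgraphs r"
    and n: "card (verts G) \<ge> 2" and \<rho>: "\<rho> \<in> {1..r}"
  shows "\<bar>graph_density r G \<rho> - p \<rho>\<bar> \<le> 2 * \<delta> + 2 / real (card (verts G))"
proof -
  define V where "V = verts G"
  define n where "n = real (card V)"
  define e where "e = real (card (edges_of_colour G \<rho>))"
  have V: "finite V" using G by (auto simp: V_def rgraphs_def verts_def)
  have n2: "n \<ge> 2" using n by (simp add: n_def V_def)
  have "2 * (card V choose 2) = card V * (card V - 1)" unfolding choose_two
    by (intro dvd_mult_div_cancel) auto
  then have N: "2 * real (card V choose 2) = n * (n - 1)"
    using n by (metis V_def n_def Suc_1 Suc_leD of_nat_1 of_nat_diff of_nat_mult of_nat_numeral One_nat_def)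
  have "\<bar>2 * e - p \<rho> * n * n\<bar> \<le> \<delta> * n ^ 2"
    using qr \<rho> card_offdiag[OF V, of "\<lambda>d. colour G d = \<rho>"]
    unfolding quasirandom_def e_def n_def V_def edges_of_colour_def by fastforce
  moreover have "0 \<le> p \<rho> * n" "p \<rho> * n \<le> n"
    using density_vectorsD[OF p] \<rho> n2 by (auto intro: mult_left_le_one_le)
  moreover have "2 * e - p \<rho> * (n * (n - 1)) = (2 * e - p \<rho> * n * n) + p \<rho> * n" by (simp add: algebra_simps)
  ultimately have *: "\<bar>2 * e - p \<rho> * (n * (n - 1))\<bar> \<le> \<delta> * n ^ 2 + n" by linarith
  have d: "graph_density r G \<rho> = 2 * e / (n * (n - 1))"
    using \<rho> unfolding N[symmetric] by (simp add: graph_density_def colour_density_def e_def V_def)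
  have nn: "n * (n - 1) > 0" "n * (n - 1) \<noteq> 0" using n2 by simp_all
  have "graph_density r G \<rho> - p \<rho> = (2 * e - p \<rho> * (n * (n - 1))) / (n * (n - 1))"
    unfolding d diff_divide_distrib nonzero_mult_div_cancel_right[OF nn(2)] ..
  then have "\<bar>graph_density r G \<rho> - p \<rho>\<bar> = \<bar>2 * e - p \<rho> * (n * (n - 1))\<bar> / (n * (n - 1))"
    using nn by (simp add: abs_divide)
  also have "\<dots> \<le> (\<delta> * n ^ 2 + n) / (n * (n - 1))" using * nn by (intro divide_right_mono) auto
  also have "\<dots> \<le> (2 * \<delta> + 2 / n) * (n * (n - 1)) / (n * (n - 1))"
  proof (rule divide_right_mono)
    have "0 \<le> \<delta> * n ^ 2" using \<open>\<bar>2 * e - p \<rho> * n * n\<bar> \<le> \<delta> * n ^ 2\<close> by linarith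
    then have "0 \<le> \<delta>" using n2 by (simp add: zero_le_mult_iff)
    then have "\<delta> * (n * (n - 2)) \<ge> 0" using n2 by simp
    moreover have "(2 * \<delta> + 2 / n) * (n * (n - 1)) = 2 * \<delta> * n * (n - 1) + 2 * (n - 1)"
      using n2 by (simp add: field_simps)
    ultimately show "\<delta> * n ^ 2 + n \<le> (2 * \<delta> + 2 / n) * (n * (n - 1))"
      using n2 by (simp add: algebra_simps power2_eq_square)
  qed (use nn in auto)
  also have "\<dots> = 2 * \<delta> + 2 / n" by (rule nonzero_mult_div_cancel_right[OF nn(2)])
  finally show ?thesis by (simp add: n_def V_def)
qed

lemma quasirandom_mono: "quasirandom r p \<delta> G \<Longrightarrow> \<delta> \<le> \<delta>' \<Longrightarrow> quasirandom r p \<delta>' G"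
  unfolding quasirandom_def by (meson mult_right_mono order_trans zero_le_power2 of_nat_0_le_iff)

section \<open>The limit distance of a fixed hereditary property\<close>

locale full_hereditary_property =
  fixes r :: nat and \<H> \<F> :: "nat rgraph set"
  assumes r2: "r \<ge> 2" and her: "hereditary r \<H>" and full: "\<exists>G\<in>\<H>. card (verts G) = n"
    and forb: "forbidden_family r \<H> \<F>"
begin

text \<open>A member of the right size is transported along a bijection. This makes the set whose
  minimum is \<open>edit_dist_to\<close> nonempty.\<close>

lemma member_on:
  assumes V: "finite V"
  shows "\<exists>G\<in>\<H>. verts G = V"
proof -
  obtain G0 where G0: "G0 \<in> \<H>" "card (verts G0) = card V" using full by blast
  have G0r: "G0 \<in> rgraphs r" using her G0 by (auto simp: hereditary_def)
  then have fG: "finite (verts G0)" by (auto simp: rgraphs_def verts_def)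
  obtain f where f: "bij_betw f V (verts G0)"
    using finite_same_card_bij[OF V fG] G0(2) by auto
  define H where "H = (V, \<lambda>e\<in>nsets V 2. colour G0 (f ` e))"
  have im: "f ` e \<in> nsets (verts G0) 2" if "e \<in> nsets V 2" for e
    using bij_betw_nsets[OF f] that by (auto simp: bij_betw_def)
  have "colour G0 e \<in> {1..r}" if "e \<in> nsets (verts G0) 2" for e
    using G0r that by (auto simp: rgraphs_def colour_def verts_def PiE_iff)
  then have Hr: "H \<in> rgraphs r" using im V by (auto simp: rgraphs_def H_def)
  have "H \<in> \<H>"
    by (rule induced_copy_mem[OF her G0(1) Hr, of f])
      (use f in \<open>auto simp: H_def verts_def colour_def bij_betw_def\<close>)
  then show ?thesis by (intro bexI[of _ H]) (simp_all add: H_def verts_def)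
qed

lemma finite_edit_dists:
  assumes "finite (verts G)"
  shows "finite {edit_dist G G' | G'. verts G' = verts G \<and> G' \<in> \<H>}"
proof (rule finite_subset)
  have f: "finite (nsets (verts G) 2)" using assms by (rule finite_imp_finite_nsets)
  show "{edit_dist G G' | G'. verts G' = verts G \<and> G' \<in> \<H>}
    \<subseteq> (\<lambda>j. real j / real (card (verts G) choose 2)) ` {..card (nsets (verts G) 2)}"
  proof
    fix d assume "d \<in> {edit_dist G G' | G'. verts G' = verts G \<and> G' \<in> \<H>}"
    then obtain G' where d: "d = edit_dist G G'" by blast
    have "card {e \<in> nsets (verts G) 2. colour G e \<noteq> colour G' e} \<le> card (nsets (verts G) 2)"
      using f by (intro card_mono) auto
    then show "d \<in> (\<lambda>j. real j / real (card (verts G) choose 2)) ` {..card (nsets (verts G) 2)}"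
      unfolding d edit_dist_def by (intro image_eqI[OF refl]) simp
  qed
qed simp

lemma edit_dist_to_le:
  assumes "finite (verts G)" "G' \<in> \<H>" "verts G' = verts G"
  shows "edit_dist_to G \<H> \<le> edit_dist G G'"
  unfolding edit_dist_to_def by (intro Min_le finite_edit_dists assms(1)) (use assms in blast)

lemma edit_dist_to_attained:
  assumes "finite (verts G)"
  shows "\<exists>G'\<in>\<H>. verts G' = verts G \<and> edit_dist_to G \<H> = edit_dist G G'"
proof -
  have "{edit_dist G G' | G'. verts G' = verts G \<and> G' \<in> \<H>} \<noteq> {}" using member_on[OF assms] by blast
  then have "edit_dist_to G \<H> \<in> {edit_dist G G' | G'. verts G' = verts G \<and> G' \<in> \<H>}"
    unfolding edit_dist_to_def by (intro Min_in finite_edit_dists assms)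
  then show ?thesis by auto
qed

lemma edit_dist_to_bounds:
  assumes "finite (verts G)"
  shows "0 \<le> edit_dist_to G \<H>" "edit_dist_to G \<H> \<le> 1"
proof -
  obtain G' where G': "edit_dist_to G \<H> = edit_dist G G'" using edit_dist_to_attained[OF assms] by blast
  show "0 \<le> edit_dist_to G \<H>" by (simp add: G' edit_dist_nonneg)
  have "card {e \<in> nsets (verts G) 2. colour G e \<noteq> colour G' e} \<le> card (nsets (verts G) 2)"
    using finite_imp_finite_nsets[OF assms] by (intro card_mono) auto
  then show "edit_dist_to G \<H> \<le> 1" unfolding G' edit_dist_def by (auto simp: divide_le_eq_1)
qed

lemma edit_dist_to_triangle:
  assumes "finite (verts G)" "verts G2 = verts G"
  shows "edit_dist_to G \<H> \<le> edit_dist G G2 + edit_dist_to G2 \<H>"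
proof -
  obtain G' where G': "G' \<in> \<H>" "verts G' = verts G2" "edit_dist_to G2 \<H> = edit_dist G2 G'"
    using edit_dist_to_attained[of G2] assms by auto
  have f: "finite (nsets (verts G) 2)" using finite_imp_finite_nsets[OF assms(1)] .
  have "card {e \<in> nsets (verts G) 2. colour G e \<noteq> colour G' e}
    \<le> card ({e \<in> nsets (verts G) 2. colour G e \<noteq> colour G2 e} \<union> {e \<in> nsets (verts G) 2. colour G2 e \<noteq> colour G' e})"
    using f by (intro card_mono) auto
  also have "\<dots> \<le> card {e \<in> nsets (verts G) 2. colour G e \<noteq> colour G2 e} + card {e \<in> nsets (verts G) 2. colour G2 e \<noteq> colour G' e}"
    by (rule card_Un_le)
  finally have "edit_dist G G' \<le> edit_dist G G2 + edit_dist G2 G'"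
    unfolding edit_dist_def assms(2) add_divide_distrib[symmetric] by (intro divide_right_mono) auto
  then show ?thesis using edit_dist_to_le[of G G'] G' assms by auto
qed

lemma forbidden_not_member:
  assumes "H \<in> \<F>"
  shows "H \<notin> \<H>" "H \<in> rgraphs r"
proof -
  show Hr: "H \<in> rgraphs r" using assms forb by (auto simp: forbidden_family_def)
  have "rgraph_iso (delete_verts H {}) H"
    unfolding rgraph_iso_def by (rule exI[of _ id]) (auto simp: delete_verts_def verts_def colour_def)
  then have "H \<notin> Forb r H" by (auto simp: Forb_def)
  then show "H \<notin> \<H>" using assms forb by (auto simp: forbidden_family_def)
qed

abbreviation types :: "nat rtype set" where "types \<equiv> allowed_types r \<F>"

text \<open>The candidate for the limit. As an infimum it has its continuity and concavity before
  any convergence is known, and the Lipschitz bound is used in proving convergence.\<close>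

definition limit_dist :: "(nat \<Rightarrow> real) \<Rightarrow> real" where
  "limit_dist p = (INF K\<in>types. g_type K p)"

lemma types_rtypes: "K \<in> types \<Longrightarrow> K \<in> rtypes r"
  by (simp add: allowed_types_def)

text \<open>Half of \<epsilon> covers the diagonal through the choice of \<open>k\<close>, the other
  half the extraction. The bound \<open>m\<close> on the refuting graphs depends only on
  \<open>k\<close> and the forbidden family, so it is at hand before \<delta> and \<open>n0\<close>
  are chosen.\<close>

lemma exists_cheap_type:
  assumes p: "p \<in> density_vectors r" and \<epsilon>: "\<epsilon> > 0"
  shows "\<exists>\<delta>>0. \<exists>n0. \<forall>G\<in>rgraphs r. n0 \<le> card (verts G) \<longrightarrow> quasirandom r p \<delta> G \<longrightarrow>
    (\<exists>K\<in>types. f_type K p \<le> edit_dist_to G \<H> + \<epsilon>)"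
proof -
  obtain k :: nat where k: "2 / \<epsilon> < real k" using reals_Archimedean2 by blast
  have "0 < 2 / \<epsilon>" using \<epsilon> by simp
  then have k0: "k > 0" using k by (metis less_trans of_nat_0_less_iff)
  then have k1: "1 / real k \<le> \<epsilon> / 2" using k \<epsilon> by (simp add: field_simps)
  \<comment> \<open>Among the finitely many types on \<open>k\<close> vertices, those that are not allowed are refuted
    by forbidden graphs with at most \<open>m\<close> vertices.\<close>
  define T where "T = {K \<in> rtypes r. fst K = {..<k}}"
  have "finite T"
  proof (rule finite_subset)
    show "T \<subseteq> {{..<k}} \<times> PiE ({..<k} \<times> {..<k}) (\<lambda>_. Pow {1..r} - {{}})"
    proof
      fix K assume "K \<in> T"
      then show "K \<in> {{..<k}} \<times> PiE ({..<k} \<times> {..<k}) (\<lambda>_. Pow {1..r} - {{}})"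
        using rtypesD(4)[of K r] by (simp add: T_def mem_Times_iff)
    qed
    show "finite ({{..<k}} \<times> PiE ({..<k} \<times> {..<k}) (\<lambda>_. Pow {1..r} - {{}}))"
      by (intro finite_cartesian_product finite_PiE) auto
  qed
  have "\<forall>K\<in>T. \<exists>H. K \<notin> types \<longrightarrow> H \<in> \<F> \<and> embeds H K"
    by (auto simp: T_def allowed_types_def)
  then obtain h where h: "\<And>K. K \<in> T \<Longrightarrow> K \<notin> types \<Longrightarrow> h K \<in> \<F> \<and> embeds (h K) K"
    by metis
  define m where "m = Max (insert 0 ((\<lambda>K. card (verts (h K))) ` T))"
  have m: "card (verts (h K)) \<le> m" if "K \<in> T" for K
    unfolding m_def using that \<open>finite T\<close> by (intro Max_ge) auto
  obtain \<delta> n0 where \<delta>: "\<delta> > 0" and ex: "\<forall>G\<in>rgraphs r. \<forall>G'\<in>\<H>. verts G' = verts G \<longrightarrow> n0 \<le> card (verts G) \<longrightarrow> quasirandom r p \<delta> G \<longrightarrow>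
    (\<exists>\<rho> \<kappa>. block_type k \<rho> \<kappa> \<in> rtypes r
      \<and> (\<forall>H\<in>rgraphs r. card (verts H) \<le> m \<longrightarrow> embeds H (block_type k \<rho> \<kappa>) \<longrightarrow> H \<in> \<H>)
      \<and> f_type (block_type k \<rho> \<kappa>) p \<le> edit_dist G G' + \<epsilon> / 2 + 1 / real k)"
    using type_extraction[OF r2 her p _ k0, of "\<epsilon> / 2" m] \<epsilon> by auto
  have "\<exists>K\<in>types. f_type K p \<le> edit_dist_to G \<H> + \<epsilon>"
    if G: "G \<in> rgraphs r" and n: "n0 \<le> card (verts G)" and qr: "quasirandom r p \<delta> G" for G
  proof -
    have "finite (verts G)" using G by (auto simp: rgraphs_def verts_def)
    then obtain G' where G': "G' \<in> \<H>" "verts G' = verts G" "edit_dist_to G \<H> = edit_dist G G'"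
      using edit_dist_to_attained by blast
    obtain \<rho> \<kappa> where K: "block_type k \<rho> \<kappa> \<in> rtypes r"
      and good: "\<forall>H\<in>rgraphs r. card (verts H) \<le> m \<longrightarrow> embeds H (block_type k \<rho> \<kappa>) \<longrightarrow> H \<in> \<H>"
      and f: "f_type (block_type k \<rho> \<kappa>) p \<le> edit_dist G G' + \<epsilon> / 2 + 1 / real k"
      using ex[rule_format, OF G G'(1,2) n qr] by blast
    have T: "block_type k \<rho> \<kappa> \<in> T" using K by (simp add: T_def)
    have "block_type k \<rho> \<kappa> \<in> types"
    proof (rule ccontr)
      assume "block_type k \<rho> \<kappa> \<notin> types"
      then have "h (block_type k \<rho> \<kappa>) \<in> \<F>" "embeds (h (block_type k \<rho> \<kappa>)) (block_type k \<rho> \<kappa>)"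
        using h[OF T] by auto
      then show False using good m[OF T] forbidden_not_member by blast
    qed
    then show ?thesis using f k1 G'(3) by (intro bexI[of _ "block_type k \<rho> \<kappa>"]) auto
  qed
  then show ?thesis using \<delta> by blast
qed

lemma exists_quasirandom:
  assumes p: "p \<in> density_vectors r" and \<delta>: "\<delta> > 0"
  shows "\<exists>n0. \<forall>n\<ge>n0. \<exists>G\<in>rgraphs r. verts G = {..<n} \<and> quasirandom r p \<delta> G"
proof -
  have "\<forall>\<^sub>F n in sequentially. random_prob r n p
      {G. G \<in> rgraphs r \<and> verts G = {..<n} \<and> quasirandom r p \<delta> G} > 0"
    using quasirandom_whp[OF p \<delta>] by (rule order_tendstoD) simp
  then obtain n0 where n0: "\<And>n. n \<ge> n0 \<Longrightarrow> random_prob r n p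
      {G. G \<in> rgraphs r \<and> verts G = {..<n} \<and> quasirandom r p \<delta> G} > 0"
    by (auto simp: eventually_sequentially)
  have "\<exists>G\<in>rgraphs r. verts G = {..<n} \<and> quasirandom r p \<delta> G" if "n \<ge> n0" for n
  proof (rule ccontr)
    assume "\<not> ?thesis"
    then have "{G. G \<in> rgraphs r \<and> verts G = {..<n} \<and> quasirandom r p \<delta> G} = {}" by blast
    then show False using n0[OF that] by (simp only: measure_empty less_irrefl)
  qed
  then show ?thesis by blast
qed

text \<open>The extraction itself supplies an allowed type; the vector concentrated on colour 1 and
  the tolerance 1 are arbitrary choices.\<close>

lemma types_nonempty: "types \<noteq> {}"
proof -
  define p where "p = (\<lambda>\<rho>\<in>{1..r}. if \<rho> = 1 then 1 else 0 :: real)"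
  have "(\<Sum>\<rho>\<in>{1..r}. p \<rho>) = (\<Sum>\<rho>\<in>{1..r}. if \<rho> = 1 then 1 else 0)" by (simp add: p_def)
  also have "\<dots> = 1" using r2 by (simp add: sum.delta)
  finally have p: "p \<in> density_vectors r" by (auto simp: density_vectors_def p_def)
  obtain \<delta> n0 where \<delta>: "\<delta> > 0" and ex: "\<forall>G\<in>rgraphs r. n0 \<le> card (verts G) \<longrightarrow> quasirandom r p \<delta> G \<longrightarrow>
    (\<exists>K\<in>types. f_type K p \<le> edit_dist_to G \<H> + 1)"
    using exists_cheap_type[OF p, of 1] by auto
  obtain n1 where "\<forall>n\<ge>n1. \<exists>G\<in>rgraphs r. verts G = {..<n} \<and> quasirandom r p \<delta> G"
    using exists_quasirandom[OF p \<delta>] by blast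
  then obtain G where G: "G \<in> rgraphs r" "verts G = {..<max n0 n1}" "quasirandom r p \<delta> G" by (meson max.cobounded2)
  then show ?thesis using ex by fastforce
qed

lemma limit_dist_le: "p \<in> density_vectors r \<Longrightarrow> K \<in> types \<Longrightarrow> limit_dist p \<le> g_type K p"
  unfolding limit_dist_def by (intro cINF_lower bdd_belowI2[of _ 0] g_type_nonneg) (auto intro: types_rtypes)

lemma limit_dist_greatest: "(\<And>K. K \<in> types \<Longrightarrow> m \<le> g_type K p) \<Longrightarrow> m \<le> limit_dist p"
  unfolding limit_dist_def using types_nonempty by (intro cINF_greatest) auto

lemma limit_dist_nonneg: "p \<in> density_vectors r \<Longrightarrow> 0 \<le> limit_dist p"
  by (intro limit_dist_greatest g_type_nonneg) (auto intro: types_rtypes)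

lemma limit_dist_le_1:
  assumes p: "p \<in> density_vectors r"
  shows "limit_dist p \<le> 1"
proof -
  obtain K where K: "K \<in> types" using types_nonempty by blast
  define w where "w = (\<lambda>_ :: nat. 1 / real (card (fst K)))"
  have w: "w \<in> weightings (fst K)" unfolding w_def using rtypesD[OF types_rtypes[OF K]] by (intro uniform_in_weightings)
  have "limit_dist p \<le> g_type K p" by (rule limit_dist_le[OF p K])
  also have "\<dots> \<le> quad_form K p w" by (rule g_type_le[OF types_rtypes[OF K] p w])
  also have "\<dots> \<le> (\<Sum>x\<in>fst K. \<Sum>y\<in>fst K. w x * 1 * w y)"
    unfolding quad_form_def
    using type_matrix_bounds(2)[OF types_rtypes[OF K] p] w
    by (intro sum_mono mult_right_mono mult_left_mono) (auto simp: weightings_def)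
  also have "\<dots> = 1" by (rule weightings_weights[OF w])
  finally show ?thesis .
qed

lemma edit_dist_to_le_limit_dist:
  assumes G: "G \<in> rgraphs r" "card (verts G) \<ge> 2"
  shows "edit_dist_to G \<H> \<le> limit_dist (graph_density r G)"
proof (intro limit_dist_greatest g_type_greatest)
  fix K w assume K: "K \<in> types" and w: "w \<in> weightings (fst K)"
  obtain G' where "G' \<in> \<H>" "verts G' = verts G" "edit_dist G G' \<le> quad_form K (colour_density G) w"
    using edit_to_type[OF forb K G, of w] w unfolding weightings_def by blast
  moreover have "finite (verts G)" using G by (auto simp: rgraphs_def verts_def)
  ultimately show "edit_dist_to G \<H> \<le> quad_form K (graph_density r G) w"
    using edit_dist_to_le[of G G'] quad_form_density[OF types_rtypes[OF K], of G w] by simp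
qed (rule types_rtypes)

lemma limit_dist_lipschitz:
  assumes p: "p \<in> density_vectors r"
  shows "limit_dist p \<le> limit_dist q + l1_dist r p q"
proof -
  let ?d = "l1_dist r p q"
  have "limit_dist p - ?d \<le> limit_dist q"
  proof (intro limit_dist_greatest g_type_greatest)
    fix K w assume K: "K \<in> types" and w: "w \<in> weightings (fst K)"
    have "limit_dist p \<le> quad_form K p w"
      using limit_dist_le[OF p K] g_type_le[OF types_rtypes[OF K] p w] by linarith
    then show "limit_dist p - ?d \<le> quad_form K q w"
      using quad_form_lipschitz[OF types_rtypes[OF K] w, of p q] by linarith
  qed (rule types_rtypes)
  then show ?thesis by simp
qed

lemma mix_in_density_vectors:
  assumes p: "p \<in> density_vectors r" and q: "q \<in> density_vectors r" and t: "t \<in> {0..1}"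
  shows "(\<lambda>\<rho>\<in>{1..r}. t * p \<rho> + (1 - t) * q \<rho>) \<in> density_vectors r"
proof -
  have "(\<Sum>\<rho>\<in>{1..r}. (\<lambda>\<rho>\<in>{1..r}. t * p \<rho> + (1 - t) * q \<rho>) \<rho>) = (\<Sum>\<rho>\<in>{1..r}. t * p \<rho> + (1 - t) * q \<rho>)"
    by (rule sum.cong) auto
  also have "\<dots> = 1"
    using density_vectorsD(2)[OF p] density_vectorsD(2)[OF q]
    by (simp add: sum.distrib sum_distrib_left[symmetric])
  finally show ?thesis
    using density_vectorsD(1)[OF p] density_vectorsD(1)[OF q] t
    by (auto simp: density_vectors_def)
qed

lemma limit_dist_concave:
  assumes p: "p \<in> density_vectors r" and q: "q \<in> density_vectors r" and t: "t \<in> {0..1}"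
  shows "t * limit_dist p + (1 - t) * limit_dist q \<le> limit_dist (\<lambda>\<rho>\<in>{1..r}. t * p \<rho> + (1 - t) * q \<rho>)"
proof (intro limit_dist_greatest g_type_greatest)
  fix K w assume K: "K \<in> types" and w: "w \<in> weightings (fst K)"
  let ?m = "\<lambda>\<rho>\<in>{1..r}. t * p \<rho> + (1 - t) * q \<rho>"
  have tm: "type_matrix K ?m x y = t * type_matrix K p x y + (1 - t) * type_matrix K q x y"
    if "x \<in> fst K" "y \<in> fst K" for x y
  proof -
    have "(\<Sum>\<rho>\<in>snd K (x, y). ?m \<rho>) = (\<Sum>\<rho>\<in>snd K (x, y). t * p \<rho> + (1 - t) * q \<rho>)"
      by (rule sum.cong) (use rtypesD(3)[OF types_rtypes[OF K] that] in auto)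
    also have "\<dots> = t * (\<Sum>\<rho>\<in>snd K (x, y). p \<rho>) + (1 - t) * (\<Sum>\<rho>\<in>snd K (x, y). q \<rho>)"
      by (simp only: sum.distrib sum_distrib_left)
    finally show ?thesis unfolding type_matrix_def by (simp only:) (simp add: algebra_simps)
  qed
  have "quad_form K ?m w = (\<Sum>x\<in>fst K. \<Sum>y\<in>fst K. t * (w x * type_matrix K p x y * w y)
      + (1 - t) * (w x * type_matrix K q x y * w y))"
    unfolding quad_form_def
  proof (intro sum.cong refl)
    fix x y assume "x \<in> fst K" "y \<in> fst K"
    from tm[OF this] show "w x * type_matrix K ?m x y * w y
      = t * (w x * type_matrix K p x y * w y) + (1 - t) * (w x * type_matrix K q x y * w y)"
      by (simp only:) (simp add: algebra_simps)
  qed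
  also have "\<dots> = t * quad_form K p w + (1 - t) * quad_form K q w"
    unfolding quad_form_def sum.distrib sum_distrib_left ..
  also have "\<dots> \<ge> t * limit_dist p + (1 - t) * limit_dist q"
    using limit_dist_le[OF p K] g_type_le[OF types_rtypes[OF K] p w]
      limit_dist_le[OF q K] g_type_le[OF types_rtypes[OF K] q w] t
    by (intro add_mono mult_left_mono) auto
  finally show "t * limit_dist p + (1 - t) * limit_dist q \<le> quad_form K ?m w" .
qed (rule types_rtypes)

text \<open>Here the bounds meet. From above, the distance is at most the value at the densities of
  \<open>G\<close>, which are close to \<open>p\<close>; from below, it is nearly
  \<open>f_type K p\<close> for an allowed type, which is at least the infimum. The type is handed
  on in order to compare the infima of \<open>f_type\<close> and \<open>g_type\<close>.\<close>

lemma quasirandom_edit_dist: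
  assumes p: "p \<in> density_vectors r" and \<epsilon>: "\<epsilon> > 0"
  shows "\<exists>\<delta>>0. \<exists>n0. \<forall>G\<in>rgraphs r. n0 \<le> card (verts G) \<longrightarrow> quasirandom r p \<delta> G \<longrightarrow>
    \<bar>edit_dist_to G \<H> - limit_dist p\<bar> \<le> \<epsilon> \<and> l1_dist r (graph_density r G) p \<le> \<epsilon>
    \<and> (\<exists>K\<in>types. f_type K p \<le> limit_dist p + \<epsilon>)"
proof -
  define e where "e = \<epsilon> / 2"
  have e: "e > 0" using \<epsilon> by (simp add: e_def)
  obtain \<delta>1 n1 where \<delta>1: "\<delta>1 > 0" and ex: "\<forall>G\<in>rgraphs r. n1 \<le> card (verts G) \<longrightarrow> quasirandom r p \<delta>1 G \<longrightarrow>
    (\<exists>K\<in>types. f_type K p \<le> edit_dist_to G \<H> + e)"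
    using exists_cheap_type[OF p e] by blast
  \<comment> \<open>Over the r colours the deviation 2\<delta> of each density sums to at most e/2;
    \<open>n2\<close> takes care of the remaining 2/n.\<close>
  define \<delta> where "\<delta> = min \<delta>1 (e / (4 * real r))"
  have \<delta>: "\<delta> > 0" "\<delta> \<le> \<delta>1" "2 * \<delta> * real r \<le> e / 2" using \<delta>1 e r2 by (auto simp: \<delta>_def min_def field_simps)
  obtain n2 :: nat where n2: "4 * real r / e < real n2" using reals_Archimedean2 by blast
  have main: "\<bar>edit_dist_to G \<H> - limit_dist p\<bar> \<le> \<epsilon> \<and> l1_dist r (graph_density r G) p \<le> \<epsilon>
    \<and> (\<exists>K\<in>types. f_type K p \<le> limit_dist p + \<epsilon>)"
    if G: "G \<in> rgraphs r" and n: "max 2 (max n1 n2) \<le> card (verts G)" and qr: "quasirandom r p \<delta> G" for G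
  proof -
    define n where "n = real (card (verts G))"
    have nn: "card (verts G) \<ge> 2" "n \<ge> 2" "4 * real r / e < n" "n1 \<le> card (verts G)" using n n2 by (auto simp: n_def)
    have "l1_dist r (graph_density r G) p \<le> (\<Sum>\<rho>\<in>{1..r}. 2 * \<delta> + 2 / n)"
      unfolding n_def by (intro sum_mono quasirandom_density[OF p qr G nn(1)])
    also have "\<dots> = 2 * \<delta> * real r + 2 * real r / n" by (simp add: algebra_simps)
    also have "2 * real r / n \<le> e / 2" using nn(2,3) e by (simp add: field_simps)
    finally have d: "l1_dist r (graph_density r G) p \<le> e" using \<delta> by linarith
    have "edit_dist_to G \<H> \<le> limit_dist (graph_density r G)" by (rule edit_dist_to_le_limit_dist[OF G nn(1)])
    also have "\<dots> \<le> limit_dist p + l1_dist r (graph_density r G) p"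
      by (rule limit_dist_lipschitz[OF density_in_density_vectors[OF G nn(1)]])
    finally have up: "edit_dist_to G \<H> \<le> limit_dist p + e" using d by simp
    obtain K where K: "K \<in> types" "f_type K p \<le> edit_dist_to G \<H> + e"
      using ex G nn(4) quasirandom_mono[OF qr \<delta>(2)] by blast
    have "limit_dist p \<le> f_type K p"
      using limit_dist_le[OF p K(1)] g_type_le_f_type[OF types_rtypes[OF K(1)] p] by linarith
    then have "\<bar>edit_dist_to G \<H> - limit_dist p\<bar> \<le> \<epsilon>" "f_type K p \<le> limit_dist p + \<epsilon>"
      using up K(2) e by (auto simp: e_def abs_le_iff)
    then show ?thesis using K(1) d e by (auto simp: e_def)
  qed
  show ?thesis using \<delta>(1) main by blast
qed

text \<open>The nontrivial direction comes from quasirandom graphs, which exist with positive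
  probability and force allowed types whose uniform weighting is nearly optimal.\<close>

lemma limit_dist_eq_INF_f_type:
  assumes p: "p \<in> density_vectors r"
  shows "limit_dist p = (INF K\<in>types. f_type K p)"
proof (rule antisym)
  show "limit_dist p \<le> (INF K\<in>types. f_type K p)"
  proof (intro cINF_greatest types_nonempty)
    fix K assume K: "K \<in> types"
    show "limit_dist p \<le> f_type K p"
      using limit_dist_le[OF p K] g_type_le_f_type[OF types_rtypes[OF K] p] by linarith
  qed
  have bdd: "bdd_below ((\<lambda>K. f_type K p) ` types)"
    by (rule bdd_belowI2[of _ 0]) (use g_type_nonneg g_type_le_f_type types_rtypes p in \<open>meson order_trans\<close>)
  show "(INF K\<in>types. f_type K p) \<le> limit_dist p"
  proof (rule field_le_epsilon)
    fix \<epsilon> :: real assume \<epsilon>: "\<epsilon> > 0"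
    obtain \<delta> n0 where \<delta>: "\<delta> > 0" and ex: "\<forall>G\<in>rgraphs r. n0 \<le> card (verts G) \<longrightarrow> quasirandom r p \<delta> G \<longrightarrow>
      \<bar>edit_dist_to G \<H> - limit_dist p\<bar> \<le> \<epsilon> \<and> l1_dist r (graph_density r G) p \<le> \<epsilon>
      \<and> (\<exists>K\<in>types. f_type K p \<le> limit_dist p + \<epsilon>)"
      using quasirandom_edit_dist[OF p \<epsilon>] by blast
    obtain n1 where "\<forall>n\<ge>n1. \<exists>G\<in>rgraphs r. verts G = {..<n} \<and> quasirandom r p \<delta> G"
      using exists_quasirandom[OF p \<delta>] by blast
    then obtain G where "G \<in> rgraphs r" "verts G = {..<max n0 n1}" "quasirandom r p \<delta> G" by (meson max.cobounded2)
    then obtain K where "K \<in> types" "f_type K p \<le> limit_dist p + \<epsilon>" using ex by fastforce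
    then show "(INF K\<in>types. f_type K p) \<le> limit_dist p + \<epsilon>" using cINF_lower[OF bdd, of K] by linarith
  qed
qed

lemma random_edit_dist_whp:
  assumes p: "p \<in> density_vectors r" and \<epsilon>: "\<epsilon> > 0"
  shows "(\<lambda>n. random_prob r n p
      {G. finite (verts G) \<and> \<bar>edit_dist_to G \<H> - limit_dist p\<bar> \<le> \<epsilon>}) \<longlonglongrightarrow> 1"
proof -
  obtain \<delta> n0 where \<delta>: "\<delta> > 0" and ex: "\<forall>G\<in>rgraphs r. n0 \<le> card (verts G) \<longrightarrow> quasirandom r p \<delta> G \<longrightarrow>
      \<bar>edit_dist_to G \<H> - limit_dist p\<bar> \<le> \<epsilon> \<and> l1_dist r (graph_density r G) p \<le> \<epsilon>
      \<and> (\<exists>K\<in>types. f_type K p \<le> limit_dist p + \<epsilon>)"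
    using quasirandom_edit_dist[OF p \<epsilon>] by blast
  show ?thesis
  proof (rule tendsto_sandwich[OF _ _ quasirandom_whp[OF p \<delta>] tendsto_const])
    show "\<forall>\<^sub>F n in sequentially. random_prob r n p
        {G. G \<in> rgraphs r \<and> verts G = {..<n} \<and> quasirandom r p \<delta> G}
      \<le> random_prob r n p {G. finite (verts G) \<and> \<bar>edit_dist_to G \<H> - limit_dist p\<bar> \<le> \<epsilon>}"
    proof (rule eventually_sequentiallyI[of n0], rule measure_pmf.finite_measure_mono, rule subsetI)
      fix n G assume "n0 \<le> n" "G \<in> {G. G \<in> rgraphs r \<and> verts G = {..<n} \<and> quasirandom r p \<delta> G}"
      then have "G \<in> rgraphs r" "n0 \<le> card (verts G)" "quasirandom r p \<delta> G" "finite (verts G)" by auto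
      then show "G \<in> {G. finite (verts G) \<and> \<bar>edit_dist_to G \<H> - limit_dist p\<bar> \<le> \<epsilon>}" using ex by blast
    qed simp
    show "\<forall>\<^sub>F n in sequentially. random_prob r n p
      {G. finite (verts G) \<and> \<bar>edit_dist_to G \<H> - limit_dist p\<bar> \<le> \<epsilon>} \<le> 1" by simp
  qed
qed

text \<open>The deviation is at most 1, so outside the likely event \<open>S\<close> it contributes
  no more than the probability of that complement.\<close>

lemma expectation_edit_dist:
  assumes p: "p \<in> density_vectors r"
  shows "(\<lambda>n. measure_pmf.expectation (random_rgraph r n p) (\<lambda>G. edit_dist_to G \<H>)) \<longlonglongrightarrow> limit_dist p"
proof (rule LIMSEQ_I)
  fix \<epsilon> :: real assume \<epsilon>: "\<epsilon> > 0"
  define X where "X G = edit_dist_to G \<H> - limit_dist p" for G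
  define S where "S = {G. finite (verts G) \<and> \<bar>X G\<bar> \<le> \<epsilon> / 3}"
  have "\<forall>\<^sub>F n in sequentially. random_prob r n p S > 1 - \<epsilon> / 3"
    unfolding S_def X_def using random_edit_dist_whp[OF p, of "\<epsilon> / 3"] \<epsilon> by (intro order_tendstoD(1)) auto
  then obtain n0 where n0: "\<And>n. n \<ge> n0 \<Longrightarrow> random_prob r n p S > 1 - \<epsilon> / 3"
    by (auto simp: eventually_sequentially)
  have "norm (measure_pmf.expectation (random_rgraph r n p) (\<lambda>G. edit_dist_to G \<H>) - limit_dist p) < \<epsilon>" if n: "n \<ge> n0" for n
  proof -
    define Q where "Q = random_rgraph r n p"
    have fin: "finite (verts G)" if "G \<in> set_pmf Q" for G using set_random_rgraph[OF p] that by (simp add: Q_def)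
    have X1: "\<bar>X G\<bar> \<le> 1" if "G \<in> set_pmf Q" for G
      using edit_dist_to_bounds[OF fin[OF that]] limit_dist_nonneg[OF p] limit_dist_le_1[OF p] by (auto simp: X_def)
    have iX: "integrable (measure_pmf Q) X"
      by (rule measure_pmf.integrable_const_bound[of _ 1]) (auto intro!: AE_pmfI X1)
    have i1: "integrable (measure_pmf Q) (\<lambda>G. edit_dist_to G \<H>)"
    proof (rule measure_pmf.integrable_const_bound[of _ 1])
      show "AE G in measure_pmf Q. norm (edit_dist_to G \<H>) \<le> 1"
        using edit_dist_to_bounds[OF fin] by (intro AE_pmfI) simp
    qed simp
    have iI: "integrable (measure_pmf Q) (indicator (- S) :: nat rgraph \<Rightarrow> real)"
      by (rule measure_pmf.integrable_const_bound[of _ 1]) (auto split: split_indicator)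
    have iS: "integrable (measure_pmf Q) (\<lambda>G. \<epsilon> / 3 + indicator (- S) G :: real)"
      by (rule measure_pmf.integrable_const_bound[of _ "\<epsilon> / 3 + 1"]) (use \<epsilon> in \<open>auto split: split_indicator\<close>)
    have "measure_pmf.expectation Q (\<lambda>G. edit_dist_to G \<H>) - limit_dist p = measure_pmf.expectation Q X"
      unfolding X_def using i1 by simp
    also have "\<bar>\<dots>\<bar> \<le> measure_pmf.expectation Q (\<lambda>G. \<bar>X G\<bar>)" by (rule integral_abs_bound)
    also have "\<dots> \<le> measure_pmf.expectation Q (\<lambda>G. \<epsilon> / 3 + indicator (- S) G)"
    proof (rule integral_mono_AE)
      show "AE G in measure_pmf Q. \<bar>X G\<bar> \<le> \<epsilon> / 3 + indicator (- S) G"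
      proof (rule AE_pmfI)
        fix G assume G: "G \<in> set_pmf Q"
        then show "\<bar>X G\<bar> \<le> \<epsilon> / 3 + indicator (- S) G"
          using X1[OF G] \<epsilon> fin[OF G] by (cases "G \<in> S") (auto simp: S_def)
      qed
    qed (use iX iS in auto)
    also have "\<dots> = \<epsilon> / 3 + measure_pmf.prob Q (- S)" 
      by (subst Bochner_Integration.integral_add) (use iI in auto)
    also have "measure_pmf.prob Q (- S) = 1 - measure_pmf.prob Q S"
      using measure_pmf.prob_compl[of S Q] by (simp add: Compl_eq_Diff_UNIV)
    finally show ?thesis using n0[OF n] \<epsilon> by (simp add: Q_def)
  qed
  then show "\<exists>n0. \<forall>n\<ge>n0. norm (measure_pmf.expectation (random_rgraph r n p) (\<lambda>G. edit_dist_to G \<H>) - limit_dist p) < \<epsilon>"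
    by blast
qed

end

section \<open>Prescribed colour counts\<close>

text \<open>Induction on the total surplus; truncated subtraction ignores deficits. Equal totals
  ensure that a colour in surplus is matched by one in deficit, and moving one element between them
  lowers the surplus by one at the price of one change.\<close>

lemma recolour_to_counts:
  fixes c :: "'e \<Rightarrow> 'c" and t :: "'c \<Rightarrow> nat"
  assumes E: "finite E" and R: "finite R" and t: "(\<Sum>\<rho>\<in>R. t \<rho>) = card E"
  shows "c \<in> E \<rightarrow> R \<Longrightarrow> \<exists>c'\<in>E \<rightarrow> R. (\<forall>\<rho>\<in>R. card {e\<in>E. c' e = \<rho>} = t \<rho>)
    \<and> card {e\<in>E. c e \<noteq> c' e} \<le> (\<Sum>\<rho>\<in>R. card {e\<in>E. c e = \<rho>} - t \<rho>)"
proof (induction "\<Sum>\<rho>\<in>R. card {e\<in>E. c e = \<rho>} - t \<rho>" arbitrary: c)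
  case 0
  have tot: "(\<Sum>\<rho>\<in>R. card {e\<in>E. c e = \<rho>}) = card E"
    using sum.group[OF E R, of c "\<lambda>_. 1::nat"] 0(2) by (simp add: image_subset_iff_funcset)
  have le: "card {e\<in>E. c e = \<rho>} \<le> t \<rho>" if "\<rho> \<in> R" for \<rho>
    using 0(1) R that by auto
  have "card {e\<in>E. c e = \<rho>} = t \<rho>" if "\<rho> \<in> R" for \<rho>
    using sum_mono_inv[of "\<lambda>\<rho>. card {e\<in>E. c e = \<rho>}" R t \<rho>] le tot t R that by auto
  then show ?case using 0(2) by (intro bexI[of _ c]) auto
next
  case (Suc k)
  define n where "n c \<rho> = card {e\<in>E. c e = \<rho>}" for c :: "'e \<Rightarrow> 'c" and \<rho>
  have tot: "(\<Sum>\<rho>\<in>R. n c \<rho>) = card E"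
    using sum.group[OF E R, of c "\<lambda>_. 1::nat"] Suc(3) by (simp add: image_subset_iff_funcset n_def)
  have "\<exists>a\<in>R. t a < n c a"
  proof (rule ccontr)
    assume "\<not> ?thesis"
    then have "(\<Sum>\<rho>\<in>R. n c \<rho> - t \<rho>) = 0" by (intro sum.neutral) (auto simp: not_less)
    then show False using Suc(2) by (simp add: n_def)
  qed
  then obtain a where a: "a \<in> R" "t a < n c a" by blast
  have "\<exists>b\<in>R. n c b < t b"
  proof (rule ccontr)
    assume "\<not> ?thesis"
    then have "(\<Sum>\<rho>\<in>R. t \<rho>) < (\<Sum>\<rho>\<in>R. n c \<rho>)"
      using a R by (intro sum_strict_mono_ex1) (auto simp: not_less)
    then show False using tot t by simp
  qed
  then obtain b where b: "b \<in> R" "n c b < t b" by blast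
  have ab: "a \<noteq> b" using a b by auto
  have "n c a \<noteq> 0" using a by simp
  then have "{e\<in>E. c e = a} \<noteq> {}" unfolding n_def by (metis card.empty)
  then obtain e0 where e0: "e0 \<in> E" "c e0 = a" by blast
  define c1 where "c1 = c(e0 := b)"
  have c1R: "c1 \<in> E \<rightarrow> R" using Suc(3) b by (auto simp: c1_def)
  have "{e\<in>E. c1 e = a} = {e\<in>E. c e = a} - {e0}" using ab e0 by (auto simp: c1_def)
  then have na: "n c1 a = n c a - 1" using e0 E by (simp add: n_def)
  have "{e\<in>E. c1 e = b} = insert e0 {e\<in>E. c e = b}" using e0 by (auto simp: c1_def)
  then have nb: "n c1 b = n c b + 1" using e0 E ab by (simp add: n_def)
  have no: "n c1 \<rho> = n c \<rho>" if "\<rho> \<noteq> a" "\<rho> \<noteq> b" for \<rho>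
    unfolding n_def using that e0 by (intro arg_cong[of _ _ card]) (auto simp: c1_def)
  have split: "(\<Sum>\<rho>\<in>R. f \<rho>) = f a + (f b + (\<Sum>\<rho>\<in>R - {a} - {b}. f \<rho>))" for f :: "'c \<Rightarrow> nat"
    using a b ab R by (simp add: sum.remove[of R a] sum.remove[of "R - {a}" b])
  have "(\<Sum>\<rho>\<in>R - {a} - {b}. n c1 \<rho> - t \<rho>) = (\<Sum>\<rho>\<in>R - {a} - {b}. n c \<rho> - t \<rho>)"
    by (rule sum.cong) (auto simp: no)
  then have k1: "Suc (\<Sum>\<rho>\<in>R. n c1 \<rho> - t \<rho>) = (\<Sum>\<rho>\<in>R. n c \<rho> - t \<rho>)"
    unfolding split using a b na nb by simp
  then have k: "k = (\<Sum>\<rho>\<in>R. card {e\<in>E. c1 e = \<rho>} - t \<rho>)" using Suc(2) by (simp add: n_def)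
  obtain c' where c': "c' \<in> E \<rightarrow> R" "\<forall>\<rho>\<in>R. card {e\<in>E. c' e = \<rho>} = t \<rho>"
    and le: "card {e\<in>E. c1 e \<noteq> c' e} \<le> (\<Sum>\<rho>\<in>R. card {e\<in>E. c1 e = \<rho>} - t \<rho>)"
    using Suc(1)[OF k c1R] by blast
  have "card {e\<in>E. c e \<noteq> c' e} \<le> card (insert e0 {e\<in>E. c1 e \<noteq> c' e})"
    using E by (intro card_mono) (auto simp: c1_def)
  also have "\<dots> \<le> Suc (card {e\<in>E. c1 e \<noteq> c' e})" by (rule card_insert_le_m1) auto
  also have "\<dots> \<le> (\<Sum>\<rho>\<in>R. card {e\<in>E. c e = \<rho>} - t \<rho>)" using le k1 by (simp add: n_def)
  finally show ?case using c' by blast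
qed

definition has_colour_counts :: "nat \<Rightarrow> (nat \<Rightarrow> real) \<Rightarrow> nat rgraph \<Rightarrow> bool" where
  "has_colour_counts r p G \<longleftrightarrow> (\<forall>\<rho>\<in>{1..<r}. int (card (edges_of_colour G \<rho>))
     = \<lfloor>p \<rho> * real (card (verts G) choose 2)\<rfloor>)"

lemma sum_last: "(r::nat) \<ge> 1 \<Longrightarrow> (\<Sum>\<rho>\<in>{1..r}. f \<rho>) = (\<Sum>\<rho>\<in>{1..<r}. f \<rho>) + (f r :: 'b::comm_monoid_add)"
proof -
  assume "r \<ge> 1"
  then have "{1..r} = insert r {1..<r}" by auto
  then show ?thesis by (simp add: add.commute)
qed

definition colour_target :: "nat \<Rightarrow> (nat \<Rightarrow> real) \<Rightarrow> nat \<Rightarrow> nat \<Rightarrow> nat" where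
  "colour_target r p N \<rho> = (if \<rho> < r then nat \<lfloor>p \<rho> * real N\<rfloor> else N - (\<Sum>\<rho>\<in>{1..<r}. nat \<lfloor>p \<rho> * real N\<rfloor>))"

text \<open>Each floor loses less than 1, and the last colour collects all these losses, which gives
  the error r. The floors sum to at most \<open>N\<close>, so the subtraction in
  \<open>colour_target\<close> does not truncate.\<close>

lemma colour_target:
  assumes p: "p \<in> density_vectors r" and r: "r \<ge> 2"
  shows "(\<Sum>\<rho>\<in>{1..r}. colour_target r p N \<rho>) = N"
    and "\<rho> \<in> {1..r} \<Longrightarrow> \<bar>real (colour_target r p N \<rho>) - p \<rho> * real N\<bar> \<le> real r"
proof -
  define S where "S = (\<Sum>\<rho>\<in>{1..<r}. nat \<lfloor>p \<rho> * real N\<rfloor>)"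
  have p0: "0 \<le> p \<rho> * real N" if "\<rho> \<in> {1..r}" for \<rho> using density_vectorsD(1)[OF p that] by simp
  have fl: "real (nat \<lfloor>p \<rho> * real N\<rfloor>) \<le> p \<rho> * real N" "p \<rho> * real N \<le> real (nat \<lfloor>p \<rho> * real N\<rfloor>) + 1"
    if "\<rho> \<in> {1..r}" for \<rho>
    using p0[OF that] by linarith+
  have "real S = (\<Sum>\<rho>\<in>{1..<r}. real (nat \<lfloor>p \<rho> * real N\<rfloor>))" by (simp add: S_def)
  moreover have "\<dots> \<le> (\<Sum>\<rho>\<in>{1..<r}. p \<rho> * real N)" by (intro sum_mono fl) auto
  moreover have "(\<Sum>\<rho>\<in>{1..<r}. p \<rho> * real N) \<le> (\<Sum>\<rho>\<in>{1..<r}. real (nat \<lfloor>p \<rho> * real N\<rfloor>) + 1)" by (intro sum_mono fl) auto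
  moreover have "(\<Sum>\<rho>\<in>{1..<r}. real (nat \<lfloor>p \<rho> * real N\<rfloor>) + 1) \<le> (\<Sum>\<rho>\<in>{1..<r}. real (nat \<lfloor>p \<rho> * real N\<rfloor>)) + real r"
    by (simp add: sum.distrib)
  moreover have "real N = (\<Sum>\<rho>\<in>{1..<r}. p \<rho> * real N) + p r * real N"
    using density_vectorsD(2)[OF p] sum_last[of r p] r by (simp add: sum_distrib_right[symmetric] distrib_right[symmetric])
  moreover have "0 \<le> p r * real N" using p0 r by simp
  ultimately have S: "real S \<le> real N" "\<bar>real N - real S - p r * real N\<bar> \<le> real r" by linarith+
  have tr: "colour_target r p N r = N - S" by (simp add: colour_target_def S_def)
  have "(\<Sum>\<rho>\<in>{1..r}. colour_target r p N \<rho>) = (\<Sum>\<rho>\<in>{1..<r}. colour_target r p N \<rho>) + colour_target r p N r"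
    using r by (intro sum_last) simp
  also have "(\<Sum>\<rho>\<in>{1..<r}. colour_target r p N \<rho>) = S" unfolding S_def by (rule sum.cong) (auto simp: colour_target_def)
  also note tr
  finally show "(\<Sum>\<rho>\<in>{1..r}. colour_target r p N \<rho>) = N" using S(1) by simp
  show "\<bar>real (colour_target r p N \<rho>) - p \<rho> * real N\<bar> \<le> real r" if "\<rho> \<in> {1..r}"
  proof (cases "\<rho> < r")
    case True
    then show ?thesis using fl[OF that] r by (simp add: colour_target_def) linarith
  next
    case False
    then have "\<rho> = r" using that by simp
    then show ?thesis using S tr by (simp add: of_nat_diff)
  qed
qed

lemma has_colour_counts_iff:
  assumes p: "p \<in> density_vectors r" and r: "r \<ge> 2" and G: "G \<in> rgraphs r"
  shows "has_colour_counts r p G \<longleftrightarrow>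
    (\<forall>\<rho>\<in>{1..r}. card (edges_of_colour G \<rho>) = colour_target r p (card (verts G) choose 2) \<rho>)"
proof -
  let ?N = "card (verts G) choose 2"
  let ?t = "colour_target r p ?N"
  have iff: "int (card (edges_of_colour G \<rho>)) = \<lfloor>p \<rho> * real ?N\<rfloor> \<longleftrightarrow> card (edges_of_colour G \<rho>) = ?t \<rho>"
    if "\<rho> \<in> {1..<r}" for \<rho>
  proof -
    have "0 \<le> \<lfloor>p \<rho> * real ?N\<rfloor>" using density_vectorsD(1)[OF p, of \<rho>] that by simp
    then show ?thesis using that by (auto simp: colour_target_def)
  qed
  have last: "card (edges_of_colour G r) = ?t r" if all: "\<forall>\<rho>\<in>{1..<r}. card (edges_of_colour G \<rho>) = ?t \<rho>"
  proof -
    have "(\<Sum>\<rho>\<in>{1..<r}. card (edges_of_colour G \<rho>)) + card (edges_of_colour G r) = (\<Sum>\<rho>\<in>{1..<r}. ?t \<rho>) + ?t r"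
    proof -
      have s: "(\<Sum>\<rho>\<in>{1..<r}. f \<rho>) + f r = (\<Sum>\<rho>\<in>{1..r}. f \<rho>)" for f :: "nat \<Rightarrow> nat"
        using r by (intro sum_last[symmetric]) simp
      show ?thesis unfolding s[of "\<lambda>\<rho>. card (edges_of_colour G \<rho>)"] s[of ?t]
        sum_edges_of_colour[OF G] colour_target(1)[OF p r] ..
    qed
    then show ?thesis using all by simp
  qed
  have R: "{1..r} = insert r {1..<r}" using r by auto
  have "has_colour_counts r p G \<longleftrightarrow> (\<forall>\<rho>\<in>{1..<r}. card (edges_of_colour G \<rho>) = ?t \<rho>)"
    unfolding has_colour_counts_def by (intro ball_cong refl iff)
  then show ?thesis unfolding R using last by blast
qed

lemma density_of_colour_counts:
  assumes p: "p \<in> density_vectors r" and r: "r \<ge> 2" and G: "G \<in> rgraphs r" and n: "card (verts G) \<ge> 2"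
    and cc: "has_colour_counts r p G"
  shows "l1_dist r (graph_density r G) p \<le> real r ^ 2 / real (card (verts G) choose 2)"
proof -
  define N where "N = card (verts G) choose 2"
  have N: "real N > 0" using n by (simp add: N_def)
  have "\<bar>graph_density r G \<rho> - p \<rho>\<bar> \<le> real r / real N" if \<rho>: "\<rho> \<in> {1..r}" for \<rho>
  proof -
    have "graph_density r G \<rho> = real (colour_target r p N \<rho>) / real N"
      using cc has_colour_counts_iff[OF p r G] \<rho> by (simp add: graph_density_def colour_density_def N_def)
    then have "graph_density r G \<rho> - p \<rho> = (real (colour_target r p N \<rho>) - p \<rho> * real N) / real N"
      using N by (simp add: field_simps)
    then show ?thesis using colour_target(2)[OF p r \<rho>, of N] N by (simp add: abs_divide divide_right_mono)
  qed
  then have "l1_dist r (graph_density r G) p \<le> (\<Sum>\<rho>\<in>{1..r}. real r / real N)" by (rule sum_mono)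
  then show ?thesis by (simp add: N_def power2_eq_square)
qed

lemma exists_near_with_colour_counts:
  assumes p: "p \<in> density_vectors r" and r: "r \<ge> 2" and G: "G \<in> rgraphs r" and n: "card (verts G) \<ge> 2"
  shows "\<exists>G2\<in>rgraphs r. verts G2 = verts G \<and> has_colour_counts r p G2 \<and>
    edit_dist G G2 \<le> l1_dist r (graph_density r G) p + real r ^ 2 / real (card (verts G) choose 2)"
proof -
  define V where "V = verts G"
  define E where "E = nsets V 2"
  define N where "N = card V choose 2"
  define t where "t = colour_target r p N"
  have V: "finite V" using G by (auto simp: V_def rgraphs_def verts_def)
  have E: "finite E" "card E = N" using finite_imp_finite_nsets[OF V] by (auto simp: E_def N_def)
  have N: "real N > 0" using n by (simp add: N_def V_def)
  have cR: "colour G \<in> E \<rightarrow> {1..r}" using G by (auto simp: rgraphs_def colour_def verts_def E_def V_def)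
  obtain c' where c': "c' \<in> E \<rightarrow> {1..r}" "\<forall>\<rho>\<in>{1..r}. card {e\<in>E. c' e = \<rho>} = t \<rho>"
    and le: "card {e\<in>E. colour G e \<noteq> c' e} \<le> (\<Sum>\<rho>\<in>{1..r}. card {e\<in>E. colour G e = \<rho>} - t \<rho>)"
    using recolour_to_counts[OF E(1) finite_atLeastAtMost _ cR, of t] colour_target(1)[OF p r, of N] E(2)
    by (auto simp: t_def)
  define G2 where "G2 = (V, restrict c' E)"
  have v2: "verts G2 = V" by (simp add: G2_def verts_def)
  have G2: "G2 \<in> rgraphs r" using c'(1) V by (auto simp: rgraphs_def G2_def E_def)
  have "edges_of_colour G2 \<rho> = {e\<in>E. c' e = \<rho>}" for \<rho>
    unfolding edges_of_colour_def v2 by (auto simp: colour_def G2_def E_def)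
  then have cc: "has_colour_counts r p G2"
    unfolding has_colour_counts_iff[OF p r G2] using c'(2) by (simp add: v2 t_def N_def)
  have "real (card {e\<in>E. colour G e \<noteq> c' e}) \<le> (\<Sum>\<rho>\<in>{1..r}. real (card {e\<in>E. colour G e = \<rho>} - t \<rho>))"
    using of_nat_mono[OF le, where 'a = real] unfolding of_nat_sum .
  also have "\<dots> \<le> (\<Sum>\<rho>\<in>{1..r}. real N * \<bar>graph_density r G \<rho> - p \<rho>\<bar> + real r)"
  proof (rule sum_mono)
    fix \<rho> assume \<rho>: "\<rho> \<in> {1..r}"
    have d: "real N * graph_density r G \<rho> = real (card {e\<in>E. colour G e = \<rho>})"
      using \<rho> N by (simp add: graph_density_def colour_density_def edges_of_colour_def E_def V_def N_def)
    have "real N * \<bar>graph_density r G \<rho> - p \<rho>\<bar> = \<bar>real N * graph_density r G \<rho> - p \<rho> * real N\<bar>"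
      using N by (simp add: abs_mult_pos' right_diff_distrib mult.commute)
    then show "real (card {e\<in>E. colour G e = \<rho>} - t \<rho>) \<le> real N * \<bar>graph_density r G \<rho> - p \<rho>\<bar> + real r"
      using colour_target(2)[OF p r \<rho>, of N] unfolding d t_def by linarith
  qed
  also have "\<dots> = real N * l1_dist r (graph_density r G) p + real r ^ 2"
    by (simp add: sum.distrib sum_distrib_left power2_eq_square)
  finally have "real (card {e\<in>E. colour G e \<noteq> c' e}) / real N
    \<le> (real N * l1_dist r (graph_density r G) p + real r ^ 2) / real N"
    by (rule divide_right_mono) simp
  also have "\<dots> = l1_dist r (graph_density r G) p + real r ^ 2 / real N"
    using N by (simp add: add_divide_distrib)
  also have "{e\<in>E. colour G e \<noteq> c' e} = {e\<in>nsets (verts G) 2. colour G e \<noteq> colour G2 e}"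
    by (auto simp: E_def V_def G2_def colour_def)
  finally have "edit_dist G G2 \<le> l1_dist r (graph_density r G) p + real r ^ 2 / real (card (verts G) choose 2)"
    unfolding edit_dist_def N_def V_def .
  then show ?thesis using G2 v2 cc by (intro bexI[of _ G2]) (auto simp: V_def)
qed

lemma choose_two_ge: "n \<ge> 2 \<Longrightarrow> real (n choose 2) \<ge> real n - 1"
proof -
  assume n: "n \<ge> 2"
  have "2 * (n - 1) \<le> n * (n - 1)" using n by (intro mult_right_mono) auto
  then have "n - 1 \<le> n choose 2" unfolding choose_two by linarith
  then show ?thesis using n by linarith
qed

section \<open>The space of density vectors\<close>

lemma topspace_densities:
  "topspace (subtopology (powertop_real {1..r}) (density_vectors r)) = density_vectors r"
  by (auto simp: density_vectors_def PiE_iff extensional_def)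

lemma compactin_density_vectors: "compactin (powertop_real {1..r}) (density_vectors r)"
proof -
  let ?X = "powertop_real {1..r} :: (nat \<Rightarrow> real) topology"
  have "continuous_map ?X euclideanreal (\<lambda>x. \<Sum>\<rho>\<in>{1..r}. x \<rho>)"
    by (intro continuous_map_sum continuous_map_product_projection) auto
  then have "closedin ?X {x \<in> topspace ?X. (\<Sum>\<rho>\<in>{1..r}. x \<rho>) \<in> {1}}"
    by (rule closedin_continuous_map_preimage) simp
  moreover have "compactin ?X (PiE {1..r} (\<lambda>_. {0..1}))"
    unfolding compactin_PiE by simp
  ultimately have "compactin ?X ({x \<in> topspace ?X. (\<Sum>\<rho>\<in>{1..r}. x \<rho>) \<in> {1}} \<inter> PiE {1..r} (\<lambda>_. {0..1}))"
    by (rule closed_Int_compactin)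
  also have "{x \<in> topspace ?X. (\<Sum>\<rho>\<in>{1..r}. x \<rho>) \<in> {1}} \<inter> PiE {1..r} (\<lambda>_. {0..1}) = density_vectors r"
  proof (intro equalityI subsetI)
    fix x assume x: "x \<in> density_vectors r"
    then show "x \<in> {x \<in> topspace ?X. (\<Sum>\<rho>\<in>{1..r}. x \<rho>) \<in> {1}} \<inter> PiE {1..r} (\<lambda>_. {0..1})"
      using density_vectorsD[OF x] by (auto simp: density_vectors_def PiE_iff)
  qed (auto simp: density_vectors_def PiE_iff)
  finally show ?thesis .
qed

lemma continuous_map_if_lipschitz:
  assumes f: "\<And>p q. p \<in> density_vectors r \<Longrightarrow> q \<in> density_vectors r \<Longrightarrow> f p \<le> f q + l1_dist r p q"
  shows "continuous_on_densities r f"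
proof -
  let ?X = "subtopology (powertop_real {1..r}) (density_vectors r)"
  have "openin ?X {x \<in> density_vectors r. f x \<in> U}" if U: "open U" for U
  proof (subst openin_subopen, intro ballI)
    fix p assume "p \<in> {x \<in> density_vectors r. f x \<in> U}"
    then have p: "p \<in> density_vectors r" "f p \<in> U" by auto
    obtain e where e: "e > 0" "ball (f p) e \<subseteq> U" using U p(2) open_contains_ball by blast
    \<comment> \<open>If all r coordinates move by less than \<open>d\<close>, the sum of the
      changes is at most r d and hence below \<open>e\<close>; r + 1 is never zero.\<close>
    define d where "d = e / real (r + 1)"
    have d: "d > 0" using e by (simp add: d_def)
    have rd: "real r * d < e" using e by (simp add: d_def field_simps)
    define T where "T = PiE {1..r} (\<lambda>\<rho>. ball (p \<rho>) d)"
    have "openin (powertop_real {1..r}) T" unfolding T_def by (subst openin_PiE) auto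
    then have "openin ?X (T \<inter> density_vectors r)" by (rule openin_subtopology_Int)
    moreover have "p \<in> T \<inter> density_vectors r" using p d by (auto simp: T_def density_vectors_def PiE_iff)
    moreover have "T \<inter> density_vectors r \<subseteq> {x \<in> density_vectors r. f x \<in> U}"
    proof
      fix q assume q: "q \<in> T \<inter> density_vectors r"
      have "l1_dist r p q \<le> (\<Sum>\<rho>\<in>{1..r}. d)"
        using q by (intro sum_mono) (auto simp: T_def PiE_iff dist_real_def less_imp_le)
      then have s: "l1_dist r p q < e" using rd by simp
      have s': "l1_dist r q p = l1_dist r p q" by (simp add: abs_minus_commute)
      have "dist (f p) (f q) < e" using f[of p q] f[of q p] p q s s' by (auto simp: dist_real_def abs_less_iff)
      then show "q \<in> {x \<in> density_vectors r. f x \<in> U}" using e(2) q by auto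
    qed
    ultimately show "\<exists>T. openin ?X T \<and> p \<in> T \<and> T \<subseteq> {x \<in> density_vectors r. f x \<in> U}" by blast
  qed
  then show ?thesis
    unfolding continuous_on_densities_def continuous_map topspace_densities by (simp add: open_openin[symmetric])
qed

text \<open>Closedness passes through compactness: \<open>S\<close> is compact as a closed subset of
  a compact space, and its continuous image in the Hausdorff cube is compact, hence closed.\<close>

lemma closedin_first_coords:
  assumes S: "closedin (subtopology (powertop_real {1..r}) (density_vectors r)) S"
  shows "closedin (product_topology (\<lambda>_. top_of_set {0..1}) {1..r - 1}) (first_coords r ` S)"
proof (rule compactin_imp_closedin)
  let ?X = "subtopology (powertop_real {1..r}) (density_vectors r)"
  let ?Y = "product_topology (\<lambda>_. top_of_set {0..1::real}) {1..r - 1}"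
  show "Hausdorff_space ?Y"
    unfolding Hausdorff_space_product_topology by (auto intro!: Hausdorff_space_subtopology)
  have "compactin ?X S"
    by (rule closedin_compact_space[OF compact_space_subtopology[OF compactin_density_vectors] S])
  moreover have "continuous_map ?X ?Y (first_coords r)"
    unfolding continuous_map_componentwise
  proof (intro conjI ballI)
    show "first_coords r ` topspace ?X \<subseteq> extensional {1..r - 1}" by (auto simp: first_coords_def)
    fix k assume k: "k \<in> {1..r - 1}"
    then have kr: "k \<in> {1..r}" by auto
    have "continuous_map ?X euclideanreal (\<lambda>x. x k)"
      using continuous_map_from_subtopology[OF continuous_map_product_projection[OF kr]] .
    then have "continuous_map ?X (top_of_set {0..1}) (\<lambda>x. x k)"
      unfolding continuous_map_in_subtopology topspace_densities using density_vectorsD[of _ r] kr by auto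
    then show "continuous_map ?X (top_of_set {0..1}) (\<lambda>x. first_coords r x k)"
      using k by (simp add: first_coords_def)
  qed
  ultimately show "compactin ?Y (first_coords r ` S)" by (rule image_compactin)
qed

section \<open>Limits of the maximal distances\<close>

context full_hereditary_property
begin

text \<open>There are infinitely many graphs with \<open>n\<close> vertices among the natural
  numbers, but the distances are multiples of 1 / (n choose 2) in [0, 1]. The predicate
  \<open>Q\<close> lets one lemma serve both maxima.\<close>

lemma finite_edit_dist_to_values:
  "finite {edit_dist_to G \<H> | G. G \<in> rgraphs r \<and> card (verts G) = n \<and> Q G}"
proof (rule finite_subset)
  show "{edit_dist_to G \<H> | G. G \<in> rgraphs r \<and> card (verts G) = n \<and> Q G}
    \<subseteq> (\<lambda>j. real j / real (n choose 2)) ` {..n choose 2}"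
  proof
    fix d assume "d \<in> {edit_dist_to G \<H> | G. G \<in> rgraphs r \<and> card (verts G) = n \<and> Q G}"
    then obtain G where G: "d = edit_dist_to G \<H>" "G \<in> rgraphs r" "card (verts G) = n" by blast
    have f: "finite (verts G)" using G(2) by (auto simp: rgraphs_def verts_def)
    then obtain G' where G': "d = edit_dist G G'" using edit_dist_to_attained G(1) by blast
    have "card {e \<in> nsets (verts G) 2. colour G e \<noteq> colour G' e} \<le> card (nsets (verts G) 2)"
      using finite_imp_finite_nsets[OF f] by (intro card_mono) auto
    then show "d \<in> (\<lambda>j. real j / real (n choose 2)) ` {..n choose 2}"
      unfolding G' edit_dist_def G(3) by (intro image_eqI[OF refl]) (simp add: G(3))
  qed
qed simp

lemma max_edit_dist_dens_alt:
  "max_edit_dist_dens r n p \<H> = Max {edit_dist_to G \<H> | G. G \<in> rgraphs r \<and> card (verts G) = n \<and> has_colour_counts r p G}"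
  unfolding max_edit_dist_dens_def has_colour_counts_def
  by (rule arg_cong[of _ _ Max]) (rule Collect_cong, blast)

text \<open>The trivial conjunct gives the set the form of
  \<open>finite_edit_dist_to_values\<close>.\<close>

lemma max_edit_dist_alt:
  "max_edit_dist r n \<H> = Max {edit_dist_to G \<H> | G. G \<in> rgraphs r \<and> card (verts G) = n \<and> True}"
  by (simp add: max_edit_dist_def)

text \<open>A graph with the prescribed counts has densities close to \<open>p\<close>, which gives
  the upper bound. For the lower bound a quasirandom graph is recoloured to the exact counts; its
  deviation from the limit, its density error and the rounding cost at most e each, so less than
  \<epsilon> = 4e is lost.\<close>

lemma max_edit_dist_dens_tendsto:
  assumes p: "p \<in> density_vectors r"
  shows "(\<lambda>n. max_edit_dist_dens r n p \<H>) \<longlonglongrightarrow> limit_dist p"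
proof (rule LIMSEQ_I)
  fix \<epsilon> :: real assume \<epsilon>: "\<epsilon> > 0"
  define e where "e = \<epsilon> / 4"
  have e: "e > 0" using \<epsilon> by (simp add: e_def)
  obtain \<delta> n0 where \<delta>: "\<delta> > 0" and qr: "\<forall>G\<in>rgraphs r. n0 \<le> card (verts G) \<longrightarrow> quasirandom r p \<delta> G \<longrightarrow>
      \<bar>edit_dist_to G \<H> - limit_dist p\<bar> \<le> e \<and> l1_dist r (graph_density r G) p \<le> e
      \<and> (\<exists>K\<in>types. f_type K p \<le> limit_dist p + e)"
    using quasirandom_edit_dist[OF p e] by blast
  obtain n1 where n1: "\<forall>n\<ge>n1. \<exists>G\<in>rgraphs r. verts G = {..<n} \<and> quasirandom r p \<delta> G"
    using exists_quasirandom[OF p \<delta>] by blast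
  obtain n2 :: nat where n2: "1 + real r ^ 2 / e < real n2" using reals_Archimedean2 by blast
  have "norm (max_edit_dist_dens r n p \<H> - limit_dist p) < \<epsilon>" if n: "n \<ge> max 2 (max n0 (max n1 n2))" for n
  proof -
    define S where "S = {edit_dist_to G \<H> | G. G \<in> rgraphs r \<and> card (verts G) = n \<and> has_colour_counts r p G}"
    have fS: "finite S" unfolding S_def by (rule finite_edit_dist_to_values)
    have nn: "n \<ge> 2" "n0 \<le> n" "n1 \<le> n" "1 + real r ^ 2 / e < real n" using n n2 by auto
    have "real r ^ 2 / e < real (n choose 2)" using choose_two_ge[OF nn(1)] nn(4) by linarith
    moreover have "real (n choose 2) > 0" using nn by simp
    ultimately have N: "real r ^ 2 / real (n choose 2) < e" using e by (simp add: field_simps)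
    have up: "x \<le> limit_dist p + e" if "x \<in> S" for x
    proof -
      obtain G where G: "x = edit_dist_to G \<H>" "G \<in> rgraphs r" "card (verts G) = n" "has_colour_counts r p G"
        using \<open>x \<in> S\<close> unfolding S_def by blast
      have n2: "card (verts G) \<ge> 2" using G nn by simp
      have "x \<le> limit_dist (graph_density r G)" unfolding G(1) by (rule edit_dist_to_le_limit_dist[OF G(2) n2])
      also have "\<dots> \<le> limit_dist p + l1_dist r (graph_density r G) p"
        by (rule limit_dist_lipschitz[OF density_in_density_vectors[OF G(2) n2]])
      finally show ?thesis using density_of_colour_counts[OF p r2 G(2) n2 G(4)] N G(3) by simp
    qed
    obtain G where G: "G \<in> rgraphs r" "verts G = {..<n}" "quasirandom r p \<delta> G" using n1 nn(3) by blast
    have cG: "card (verts G) = n" "finite (verts G)" by (auto simp: G(2))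
    have d: "\<bar>edit_dist_to G \<H> - limit_dist p\<bar> \<le> e" "l1_dist r (graph_density r G) p \<le> e"
      using qr G nn(2) cG(1) by auto
    have "card (verts G) \<ge> 2" using cG nn by simp
    then obtain G2 where G2: "G2 \<in> rgraphs r" "verts G2 = verts G" "has_colour_counts r p G2"
      and near: "edit_dist G G2 \<le> l1_dist r (graph_density r G) p + real r ^ 2 / real (card (verts G) choose 2)"
      using exists_near_with_colour_counts[OF p r2 G(1)] by blast
    have "card (verts G2) = n" using G2 cG by simp
    then have S2: "edit_dist_to G2 \<H> \<in> S" unfolding S_def using G2 by blast
    have "edit_dist_to G \<H> \<le> edit_dist G G2 + edit_dist_to G2 \<H>"
      by (rule edit_dist_to_triangle[OF cG(2) G2(2)])
    then have low: "limit_dist p - 3 * e < edit_dist_to G2 \<H>" using near d N unfolding cG(1) by linarith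
    have "edit_dist_to G2 \<H> \<le> Max S" by (rule Max_ge[OF fS S2])
    moreover have "Max S \<in> S" by (rule Max_in[OF fS]) (use S2 in auto)
    then have "Max S \<le> limit_dist p + e" by (rule up)
    ultimately show ?thesis using low e unfolding max_edit_dist_dens_alt S_def[symmetric] by (simp add: e_def abs_less_iff)
  qed
  then show "\<exists>n0. \<forall>n\<ge>n0. norm (max_edit_dist_dens r n p \<H> - limit_dist p) < \<epsilon>" by blast
qed

lemma edit_dist_dens_eq: "p \<in> density_vectors r \<Longrightarrow> edit_dist_dens r p \<H> = limit_dist p"
  unfolding edit_dist_dens_def by (rule limI[OF max_edit_dist_dens_tendsto])

lemma continuous_limit_dist: "continuous_on_densities r limit_dist"
  by (rule continuous_map_if_lipschitz) (rule limit_dist_lipschitz)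

lemma exists_maximiser:
  "\<exists>p\<in>density_vectors r. \<forall>q\<in>density_vectors r. limit_dist q \<le> limit_dist p"
proof -
  have "compactin (subtopology (powertop_real {1..r}) (density_vectors r)) (density_vectors r)"
    using compactin_density_vectors by simp
  then have "compactin euclideanreal (limit_dist ` density_vectors r)"
    using continuous_limit_dist unfolding continuous_on_densities_def by (rule image_compactin)
  then have "compact (limit_dist ` density_vectors r)" by simp
  moreover have "limit_dist ` density_vectors r \<noteq> {}"
  proof -
    define G :: "nat rgraph" where "G = ({..<2}, \<lambda>e\<in>nsets {..<2} 2. 1)"
    have "G \<in> rgraphs r" using r2 by (auto simp: G_def rgraphs_def)
    then have "graph_density r G \<in> density_vectors r" by (rule density_in_density_vectors) (simp add: G_def verts_def)
    then show ?thesis by blast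
  qed
  ultimately show ?thesis using compact_attains_sup by fastforce
qed

text \<open>The maximum over all graphs is at least the one with the counts of the maximiser
  \<open>p\<close>, and at most \<open>limit_dist p\<close>, since each graph is bounded by the
  value at its own densities.\<close>

lemma max_edit_dist_tendsto:
  assumes p: "p \<in> density_vectors r" and mx: "\<And>q. q \<in> density_vectors r \<Longrightarrow> limit_dist q \<le> limit_dist p"
  shows "(\<lambda>n. max_edit_dist r n \<H>) \<longlonglongrightarrow> limit_dist p"
proof (rule tendsto_sandwich[OF _ _ max_edit_dist_dens_tendsto[OF p] tendsto_const])
  have S: "finite {edit_dist_to G \<H> | G. G \<in> rgraphs r \<and> card (verts G) = n \<and> Q G}" for n Q
    by (rule finite_edit_dist_to_values)
  have ex: "\<exists>G\<in>rgraphs r. card (verts G) = n \<and> has_colour_counts r p G" if "n \<ge> 2" for n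
  proof -
    define G :: "nat rgraph" where "G = ({..<n}, \<lambda>e\<in>nsets {..<n} 2. 1)"
    have "G \<in> rgraphs r" using r2 by (auto simp: G_def rgraphs_def)
    moreover have "card (verts G) = n" by (simp add: G_def verts_def)
    ultimately show ?thesis using exists_near_with_colour_counts[OF p r2, of G] that by metis
  qed
  show "\<forall>\<^sub>F n in sequentially. max_edit_dist_dens r n p \<H> \<le> max_edit_dist r n \<H>"
  proof (rule eventually_sequentiallyI[of 2])
    fix n :: nat assume "2 \<le> n"
    then obtain G :: "nat rgraph" where "G \<in> rgraphs r" "card (verts G) = n" "has_colour_counts r p G" using ex by blast
    then show "max_edit_dist_dens r n p \<H> \<le> max_edit_dist r n \<H>"
      unfolding max_edit_dist_dens_alt max_edit_dist_alt by (intro Max_mono S) blast+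
  qed
  show "\<forall>\<^sub>F n in sequentially. max_edit_dist r n \<H> \<le> limit_dist p"
  proof (rule eventually_sequentiallyI[of 2])
    fix n :: nat assume n: "2 \<le> n"
    then obtain G :: "nat rgraph" where G: "G \<in> rgraphs r" "card (verts G) = n" using ex by blast
    have "max_edit_dist r n \<H> \<in> {edit_dist_to G \<H> | G. G \<in> rgraphs r \<and> card (verts G) = n \<and> True}"
      unfolding max_edit_dist_alt by (rule Max_in[OF S]) (use G in blast)
    then obtain G where G: "max_edit_dist r n \<H> = edit_dist_to G \<H>" "G \<in> rgraphs r" "card (verts G) = n" by blast
    then have "max_edit_dist r n \<H> \<le> limit_dist (graph_density r G)"
      using edit_dist_to_le_limit_dist[OF G(2)] n by simp
    also have "\<dots> \<le> limit_dist p" using mx density_in_density_vectors[OF G(2)] G(3) n by simp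
    finally show "max_edit_dist r n \<H> \<le> limit_dist p" .
  qed
qed

lemma max_densities_eq:
  "max_densities r \<H> = {p \<in> density_vectors r. \<forall>q\<in>density_vectors r. limit_dist q \<le> limit_dist p}"
  unfolding max_densities_def by (simp add: edit_dist_dens_eq cong: conj_cong)

text \<open>By concavity the value at a mixture of two maximisers is at least the maximum, and
  restricting to the first coordinates commutes with mixing.\<close>

lemma convex_max_densities: "convex_coords (r - 1) (first_coords r ` max_densities r \<H>)"
  unfolding convex_coords_def
proof (intro ballI)
  fix x y and t :: real assume x: "x \<in> first_coords r ` max_densities r \<H>"
    and y: "y \<in> first_coords r ` max_densities r \<H>" and t: "t \<in> {0..1}"
  obtain p where p: "x = first_coords r p" "p \<in> density_vectors r" "\<And>q. q \<in> density_vectors r \<Longrightarrow> limit_dist q \<le> limit_dist p"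
    using x by (auto simp: max_densities_eq)
  obtain q where q: "y = first_coords r q" "q \<in> density_vectors r" "\<And>s. s \<in> density_vectors r \<Longrightarrow> limit_dist s \<le> limit_dist q"
    using y by (auto simp: max_densities_eq)
  define m where "m = (\<lambda>\<rho>\<in>{1..r}. t * p \<rho> + (1 - t) * q \<rho>)"
  have m: "m \<in> density_vectors r" unfolding m_def by (rule mix_in_density_vectors[OF p(2) q(2) t])
  have "limit_dist p = limit_dist q" using p(3)[OF q(2)] q(3)[OF p(2)] by simp
  then have "limit_dist p \<le> limit_dist m"
    using limit_dist_concave[OF p(2) q(2) t] by (simp add: m_def algebra_simps)
  then have "m \<in> max_densities r \<H>" using m p(3) by (force simp: max_densities_eq)
  moreover have "(\<lambda>i\<in>{1..r - 1}. t * x i + (1 - t) * y i) = first_coords r m"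
    by (auto simp: fun_eq_iff m_def p(1) q(1) first_coords_def restrict_def)
  ultimately show "(\<lambda>i\<in>{1..r - 1}. t * x i + (1 - t) * y i) \<in> first_coords r ` max_densities r \<H>" by blast
qed

lemma closedin_max_densities:
  "closedin (subtopology (powertop_real {1..r}) (density_vectors r)) (max_densities r \<H>)"
proof -
  obtain p where p: "p \<in> density_vectors r" "\<forall>q\<in>density_vectors r. limit_dist q \<le> limit_dist p"
    using exists_maximiser by blast
  have "max_densities r \<H> = {q \<in> density_vectors r. limit_dist q \<in> {limit_dist p}}"
    using p unfolding max_densities_eq by (auto intro: antisym)
  also have "closedin (subtopology (powertop_real {1..r}) (density_vectors r)) \<dots>"
    using closedin_continuous_map_preimage[OF continuous_limit_dist[unfolded continuous_on_densities_def], of "{limit_dist p}"]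
    unfolding topspace_densities by simp
  finally show ?thesis .
qed

end

theorem theorem8:
  fixes r :: nat and \<H> \<F> :: "nat rgraph set" and p :: "nat \<Rightarrow> real"
  assumes "r \<ge> 2"
    and "hereditary r \<H>"
    and "\<And>n. \<exists>G \<in> \<H>. card (verts G) = n"
    and "forbidden_family r \<H> \<F>"
    and "p \<in> density_vectors r"
  shows "convergent (\<lambda>n. max_edit_dist_dens r n p \<H>)
    \<and>
    (edit_dist_dens r p \<H> = (INF K \<in> (allowed_types r \<F> :: nat rtype set). f_type K p) \<and>
     edit_dist_dens r p \<H> = (INF K \<in> (allowed_types r \<F> :: nat rtype set). g_type K p))
    \<and>
    (\<forall>\<epsilon>>0. (\<lambda>n. measure_pmf.prob (random_rgraph r n p)
        {G. edit_dist_dens r p \<H> - \<epsilon> \<le> edit_dist_to G \<H> \<and>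
            edit_dist_to G \<H> \<le> edit_dist_dens r p \<H> + \<epsilon>}) \<longlonglongrightarrow> 1)
    \<and>
    (\<lambda>n. measure_pmf.expectation (random_rgraph r n p) (\<lambda>G. edit_dist_to G \<H>))
      \<longlonglongrightarrow> edit_dist_dens r p \<H>
    \<and>
    (continuous_on_densities r (\<lambda>q. edit_dist_dens r q \<H>) \<and>
     concave_down r (\<lambda>q. edit_dist_dens r q \<H>))
    \<and>
    (\<exists>pstar \<in> max_densities r \<H>.
       edit_dist_dens r pstar \<H> = lim_edit_dist r \<H> \<and>
       (\<lambda>n. measure_pmf.expectation (random_rgraph r n pstar) (\<lambda>G. edit_dist_to G \<H>))
         \<longlonglongrightarrow> lim_edit_dist r \<H>)
    \<and>
    (max_densities r \<H> \<noteq> {} \<and>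
     convergent (\<lambda>n. max_edit_dist r n \<H>) \<and>
     convex_coords (r - 1) (first_coords r ` max_densities r \<H>) \<and>
     closedin (product_topology (\<lambda>_. top_of_set {0..1}) {1..r - 1})
       (first_coords r ` max_densities r \<H>))"
proof -
  interpret full_hereditary_property r \<H> \<F>
    by unfold_locales (use assms in auto)
  note p = assms(5)
  have dp: "edit_dist_dens r p \<H> = limit_dist p" by (rule edit_dist_dens_eq[OF p])
  obtain ps where ps: "ps \<in> density_vectors r" "\<And>q. q \<in> density_vectors r \<Longrightarrow> limit_dist q \<le> limit_dist ps"
    using exists_maximiser by blast
  have psm: "ps \<in> max_densities r \<H>" using ps by (simp add: max_densities_eq)
  have lim: "lim_edit_dist r \<H> = limit_dist ps"
    unfolding lim_edit_dist_def by (rule limI[OF max_edit_dist_tendsto[OF ps]])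
  show ?thesis
  proof (intro conjI allI impI)
    show "convergent (\<lambda>n. max_edit_dist_dens r n p \<H>)"
      by (rule convergentI[OF max_edit_dist_dens_tendsto[OF p]])
    show "edit_dist_dens r p \<H> = (INF K\<in>types. f_type K p)"
      unfolding dp by (rule limit_dist_eq_INF_f_type[OF p])
    show "edit_dist_dens r p \<H> = (INF K\<in>types. g_type K p)"
      unfolding dp by (rule limit_dist_def)
    \<comment> \<open>The upper inequality carries a tolerance as well: a sample is bounded by the
      value at its own edge densities, and these only approximate \<open>p\<close>.\<close>
    show "(\<lambda>n. random_prob r n p
        {G. edit_dist_dens r p \<H> - \<epsilon> \<le> edit_dist_to G \<H> \<and>
            edit_dist_to G \<H> \<le> edit_dist_dens r p \<H> + \<epsilon>}) \<longlonglongrightarrow> 1" if \<epsilon>: "\<epsilon> > 0" for \<epsilon>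
    proof (rule tendsto_sandwich[OF _ _ random_edit_dist_whp[OF p \<epsilon>] tendsto_const])
      show "\<forall>\<^sub>F n in sequentially.
        random_prob r n p {G. finite (verts G) \<and> \<bar>edit_dist_to G \<H> - limit_dist p\<bar> \<le> \<epsilon>}
        \<le> random_prob r n p {G. edit_dist_dens r p \<H> - \<epsilon> \<le> edit_dist_to G \<H> \<and>
            edit_dist_to G \<H> \<le> edit_dist_dens r p \<H> + \<epsilon>}"
        unfolding dp by (intro always_eventually allI measure_pmf.finite_measure_mono) (auto simp: abs_le_iff)
    qed simp
    show "(\<lambda>n. measure_pmf.expectation (random_rgraph r n p) (\<lambda>G. edit_dist_to G \<H>)) \<longlonglongrightarrow> edit_dist_dens r p \<H>"
      unfolding dp by (rule expectation_edit_dist[OF p])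
    show "continuous_on_densities r (\<lambda>q. edit_dist_dens r q \<H>)"
      unfolding continuous_on_densities_def
      by (rule continuous_map_eq[OF continuous_limit_dist[unfolded continuous_on_densities_def]])
        (simp only: topspace_densities edit_dist_dens_eq)
    show "concave_down r (\<lambda>q. edit_dist_dens r q \<H>)"
      unfolding concave_down_def
    proof (intro ballI)
      fix p q and t :: real assume pqt: "p \<in> density_vectors r" "q \<in> density_vectors r" "t \<in> {0..1}"
      show "t * edit_dist_dens r p \<H> + (1 - t) * edit_dist_dens r q \<H>
        \<le> edit_dist_dens r (\<lambda>\<rho>\<in>{1..r}. t * p \<rho> + (1 - t) * q \<rho>) \<H>"
        unfolding edit_dist_dens_eq[OF pqt(1)] edit_dist_dens_eq[OF pqt(2)]
          edit_dist_dens_eq[OF mix_in_density_vectors[OF pqt]] by (rule limit_dist_concave[OF pqt])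
    qed
    show "\<exists>pstar\<in>max_densities r \<H>. edit_dist_dens r pstar \<H> = lim_edit_dist r \<H> \<and>
       (\<lambda>n. measure_pmf.expectation (random_rgraph r n pstar) (\<lambda>G. edit_dist_to G \<H>)) \<longlonglongrightarrow> lim_edit_dist r \<H>"
      using psm edit_dist_dens_eq[OF ps(1)] expectation_edit_dist[OF ps(1)] lim by (intro bexI[of _ ps]) auto
    show "max_densities r \<H> \<noteq> {}" using psm by blast
    show "convergent (\<lambda>n. max_edit_dist r n \<H>)"
      by (rule convergentI[OF max_edit_dist_tendsto[OF ps]])
    show "convex_coords (r - 1) (first_coords r ` max_densities r \<H>)" by (rule convex_max_densities)
    show "closedin (product_topology (\<lambda>_. top_of_set {0..1}) {1..r - 1}) (first_coords r ` max_densities r \<H>)"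
      by (rule closedin_first_coords[OF closedin_max_densities])
  qed
qed

end
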